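(* Let $G$ be a finite group and let $\mathbb{K}$ be a field whose characteristic does not divide $|G|$. Let $B=\mathbb{K}[G]$ be the group algebra (elements viewed as functions on $G$ with convolution product), with $l_B(f)=f(1)$. Let $A=Z(B)$ be its center, with $l_A(f)=f(1)/|G|$. Let $\phi:A\to B$ be the inclusion, let $\star:B\to B$ be the linear map with $g^\star=g^{-1}$ for $g\in G$, and let $\star:A\to A$ be its restriction to $A$. Let $U=\sum_{g\in G}g^2\in A$. Then $((A,l_A),(B,l_B),\phi,U,\star)$ is a semi-simple equipped Cardy--Frobenius algebra over $\mathbb{K}$.
   Context: All algebras are finite-dimensional, associative and unital over a field $\mathbb{K}$. A Frobenius pair $(C,l_C)$ is an algebra $C$ with a linear functional $l_C:C\to\mathbb{K}$ such that the bilinear form $(c_1,c_2)_C=l_C(c_1c_2)$ is symmetric and non-degenerate. A Cardy--Frobenius algebra $((A,l_A),(B,l_B),\phi)$ consists of: (1) a commutative Frobenius pair $(A,l_A)$; (2) a Frobenius pair $(B,l_B)$, not necessarily commutative; (3) an algebra homomorphism $\phi:A\to B$ whose image is contained in the center of $B$ and which satisfies the Cardy condition $(\phi^*(b'),\phi^*(b''))_A=\mathrm{Tr}\,W^B_{b'b''}$ for all $b',b''\in B$. Here $\phi^*:B\to A$ is the dual map, defined by $(\phi^*(b),a)_A=(b,\phi(a))_B$, and $W^B_{b'b''}:B\to B$ is the linear operator $b\mapsto b'bb''$. An equipped Cardy--Frobenius algebra $((A,l_A),(B,l_B),\phi,U,\star)$ is a Cardy--Frobenius algebra together with: involutive linear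 anti-automorphisms $\star:A\to A$ and $\star:B\to B$ such that $l_A(x^\star)=l_A(x)$, $l_B(x^\star)=l_B(x)$, $\phi(x^\star)=\phi(x)^\star$; and an element $U\in A$ such that $U^2=K_A^\star$ and $\phi(U)=K_B^\star$. Here, for a Frobenius pair $(C,l_C)$ with basis $\gamma_1,\dots,\gamma_N$ and with $(F_C^{ij})$ the inverse of the matrix $((\gamma_i,\gamma_j)_C)$, one puts $K_C^\star=\sum_{i,j}F_C^{ij}\gamma_i\gamma_j^\star$. Such a structure is semi-simple if the algebras $A$ and $B$ are semi-simple. *)

theory Defs
  imports "HOL-Algebra.Ideal" "Jordan_Normal_Form.Missing_VectorSpace"
begin

section \<open>Finite-dimensional algebras over a field\<close>

text \<open>The locale \<open>algebra\<close> of HOL-Algebra covers commutative algebras only.\<close>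

locale fin_dim_algebra = vectorspace K C + C?: ring C
  for K :: "('k, 'x) ring_scheme" and C :: "('k, 'c, 'y) module_scheme" +
  assumes smult_mult_left:
      "\<lbrakk>a \<in> carrier K; x \<in> carrier C; y \<in> carrier C\<rbrakk> \<Longrightarrow>
        (a \<odot>\<^bsub>C\<^esub> x) \<otimes>\<^bsub>C\<^esub> y = a \<odot>\<^bsub>C\<^esub> (x \<otimes>\<^bsub>C\<^esub> y)"
    and smult_mult_right:
      "\<lbrakk>a \<in> carrier K; x \<in> carrier C; y \<in> carrier C\<rbrakk> \<Longrightarrow>
        x \<otimes>\<^bsub>C\<^esub> (a \<odot>\<^bsub>C\<^esub> y) = a \<odot>\<^bsub>C\<^esub> (x \<otimes>\<^bsub>C\<^esub> y)"
    and fin_dim: "fin_dim"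

text \<open>The trace and the element \<open>K_star\<close> below are computed in an arbitrarily chosen
  finite basis; neither value depends on that choice.\<close>

definition (in vectorspace) some_basis :: "'c set" where
  "some_basis = (SOME X. finite X \<and> basis X)"

definition (in vectorspace) coord :: "'c set \<Rightarrow> 'c \<Rightarrow> 'c \<Rightarrow> 'a" where
  "coord X v = (THE a. a \<in> X \<rightarrow>\<^sub>E carrier K \<and> lincomb a X = v)"

definition (in vectorspace) lin_trace :: "('c \<Rightarrow> 'c) \<Rightarrow> 'a" where
  "lin_trace T = (\<Oplus>\<^bsub>K\<^esub>x\<in>some_basis. coord some_basis (T x) x)"

definition linear_functional ::
    "('k, 'x) ring_scheme \<Rightarrow> ('k, 'c, 'y) module_scheme \<Rightarrow> ('c \<Rightarrow> 'k) \<Rightarrow> bool" where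
  "linear_functional K V l \<longleftrightarrow>
     l \<in> carrier V \<rightarrow> carrier K \<and>
     (\<forall>v\<in>carrier V. \<forall>w\<in>carrier V. l (v \<oplus>\<^bsub>V\<^esub> w) = l v \<oplus>\<^bsub>K\<^esub> l w) \<and>
     (\<forall>a\<in>carrier K. \<forall>v\<in>carrier V. l (a \<odot>\<^bsub>V\<^esub> v) = a \<otimes>\<^bsub>K\<^esub> l v)"

definition ring_center :: "('c, 'y) ring_scheme \<Rightarrow> 'c set" where
  "ring_center C = {x \<in> carrier C. \<forall>y\<in>carrier C. x \<otimes>\<^bsub>C\<^esub> y = y \<otimes>\<^bsub>C\<^esub> x}"

definition involutive_anti_automorphism ::
    "('k, 'x) ring_scheme \<Rightarrow> ('k, 'c, 'y) module_scheme \<Rightarrow> ('c \<Rightarrow> 'c) \<Rightarrow> bool" where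
  "involutive_anti_automorphism K C s \<longleftrightarrow>
     s \<in> module_hom K C C \<and>
     s \<one>\<^bsub>C\<^esub> = \<one>\<^bsub>C\<^esub> \<and>
     (\<forall>x\<in>carrier C. \<forall>y\<in>carrier C. s (x \<otimes>\<^bsub>C\<^esub> y) = s y \<otimes>\<^bsub>C\<^esub> s x) \<and>
     (\<forall>x\<in>carrier C. s (s x) = x)"


section \<open>Semi-simplicity\<close>

definition left_ideal :: "'c set \<Rightarrow> ('c, 'y) ring_scheme \<Rightarrow> bool" where
  "left_ideal I C \<longleftrightarrow>
     additive_subgroup I C \<and> (\<forall>c\<in>carrier C. \<forall>x\<in>I. c \<otimes>\<^bsub>C\<^esub> x \<in> I)"

definition minimal_left_ideal :: "'c set \<Rightarrow> ('c, 'y) ring_scheme \<Rightarrow> bool" where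
  "minimal_left_ideal I C \<longleftrightarrow>
     left_ideal I C \<and> I \<noteq> {\<zero>\<^bsub>C\<^esub>} \<and>
     (\<forall>J. left_ideal J C \<and> J \<subseteq> I \<longrightarrow> J = {\<zero>\<^bsub>C\<^esub>} \<or> J = I)"

text \<open>The left regular module is a finite direct sum of simple submodules. The submodules of
  the left regular module are the left ideals, which in a unital algebra are automatically
  linear subspaces.\<close>

definition semisimple :: "('c, 'y) ring_scheme \<Rightarrow> bool" where
  "semisimple C \<longleftrightarrow>
     (\<exists>(n::nat) I. (\<forall>i<n. minimal_left_ideal (I i) C) \<and>
        (\<forall>x\<in>carrier C. \<exists>!c. c \<in> (\<Pi>\<^sub>E i\<in>{..<n}. I i) \<and> x = (\<Oplus>\<^bsub>C\<^esub>i\<in>{..<n}. c i)))"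


section \<open>Cardy--Frobenius algebras\<close>

definition frob_form :: "('c, 'y) ring_scheme \<Rightarrow> ('c \<Rightarrow> 'k) \<Rightarrow> 'c \<Rightarrow> 'c \<Rightarrow> 'k" where
  "frob_form C l x y = l (x \<otimes>\<^bsub>C\<^esub> y)"

locale frobenius_pair = fin_dim_algebra K C
  for K :: "('k, 'x) ring_scheme" and C :: "('k, 'c, 'y) module_scheme" +
  fixes l :: "'c \<Rightarrow> 'k"
  assumes l_linear: "linear_functional K C l"
    and form_sym:
      "\<lbrakk>x \<in> carrier C; y \<in> carrier C\<rbrakk> \<Longrightarrow> frob_form C l x y = frob_form C l y x"
    and form_nondegenerate:
      "\<lbrakk>x \<in> carrier C; \<And>y. y \<in> carrier C \<Longrightarrow> frob_form C l x y = \<zero>\<^bsub>K\<^esub>\<rbrakk> \<Longrightarrow> x = \<zero>\<^bsub>C\<^esub>"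

text \<open>Matrices are indexed by the elements of the basis \<open>X\<close>; only the entries with both
  indices in \<open>X\<close> matter, and on those the inverse matrix is unique.\<close>

definition (in frobenius_pair) inverse_gram :: "'c set \<Rightarrow> 'c \<Rightarrow> 'c \<Rightarrow> 'k" where
  "inverse_gram X = (SOME F.
     (\<forall>x\<in>X. \<forall>y\<in>X. F x y \<in> carrier K) \<and>
     (\<forall>x\<in>X. \<forall>z\<in>X. (\<Oplus>\<^bsub>K\<^esub>y\<in>X. F x y \<otimes>\<^bsub>K\<^esub> frob_form C l y z) = (if x = z then \<one>\<^bsub>K\<^esub> else \<zero>\<^bsub>K\<^esub>)) \<and>
     (\<forall>x\<in>X. \<forall>z\<in>X. (\<Oplus>\<^bsub>K\<^esub>y\<in>X. frob_form C l x y \<otimes>\<^bsub>K\<^esub> F y z) = (if x = z then \<one>\<^bsub>K\<^esub> else \<zero>\<^bsub>K\<^esub>)))"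

definition (in frobenius_pair) K_star :: "('c \<Rightarrow> 'c) \<Rightarrow> 'c" where
  "K_star s = (\<Oplus>\<^bsub>C\<^esub>x\<in>some_basis. \<Oplus>\<^bsub>C\<^esub>y\<in>some_basis.
     inverse_gram some_basis x y \<odot>\<^bsub>C\<^esub> (x \<otimes>\<^bsub>C\<^esub> s y))"

definition dual_map ::
    "('a, 'y) ring_scheme \<Rightarrow> ('a \<Rightarrow> 'k) \<Rightarrow> ('b, 'z) ring_scheme \<Rightarrow> ('b \<Rightarrow> 'k) \<Rightarrow>
     ('a \<Rightarrow> 'b) \<Rightarrow> 'b \<Rightarrow> 'a" where
  "dual_map A lA B lB \<phi> b =
     (THE a. a \<in> carrier A \<and> (\<forall>x\<in>carrier A. frob_form A lA a x = frob_form B lB b (\<phi> x)))"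

locale cardy_frobenius_algebra =
  A: frobenius_pair K A lA + B: frobenius_pair K B lB
  for K :: "('k, 'x) ring_scheme"
    and A :: "('k, 'a, 'y) module_scheme" and lA :: "'a \<Rightarrow> 'k"
    and B :: "('k, 'b, 'z) module_scheme" and lB :: "'b \<Rightarrow> 'k" +
  fixes \<phi> :: "'a \<Rightarrow> 'b"
  assumes A_comm: "\<lbrakk>x \<in> carrier A; y \<in> carrier A\<rbrakk> \<Longrightarrow> x \<otimes>\<^bsub>A\<^esub> y = y \<otimes>\<^bsub>A\<^esub> x"
    and phi_ring_hom: "\<phi> \<in> ring_hom A B"
    and phi_linear: "\<phi> \<in> module_hom K A B"
    and phi_central: "\<phi> ` carrier A \<subseteq> ring_center B"
    and cardy_condition:
      "\<lbrakk>b' \<in> carrier B; b'' \<in> carrier B\<rbrakk> \<Longrightarrow>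
        frob_form A lA (dual_map A lA B lB \<phi> b') (dual_map A lA B lB \<phi> b'') =
        B.lin_trace (\<lambda>b. b' \<otimes>\<^bsub>B\<^esub> b \<otimes>\<^bsub>B\<^esub> b'')"

locale equipped_cardy_frobenius_algebra = cardy_frobenius_algebra K A lA B lB \<phi>
  for K :: "('k, 'x) ring_scheme"
    and A :: "('k, 'a, 'y) module_scheme" and lA :: "'a \<Rightarrow> 'k"
    and B :: "('k, 'b, 'z) module_scheme" and lB :: "'b \<Rightarrow> 'k"
    and \<phi> :: "'a \<Rightarrow> 'b" +
  fixes U :: 'a and starA :: "'a \<Rightarrow> 'a" and starB :: "'b \<Rightarrow> 'b"
  assumes starA: "involutive_anti_automorphism K A starA"
    and starB: "involutive_anti_automorphism K B starB"
    and lA_star: "x \<in> carrier A \<Longrightarrow> lA (starA x) = lA x"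
    and lB_star: "y \<in> carrier B \<Longrightarrow> lB (starB y) = lB y"
    and phi_star: "x \<in> carrier A \<Longrightarrow> \<phi> (starA x) = starB (\<phi> x)"
    and U_closed: "U \<in> carrier A"
    and U_squared: "U [^]\<^bsub>A\<^esub> (2::nat) = A.K_star starA"
    and phi_U: "\<phi> U = B.K_star starB"

locale semisimple_equipped_cardy_frobenius_algebra = equipped_cardy_frobenius_algebra +
  assumes A_semisimple: "semisimple A"
    and B_semisimple: "semisimple B"


section \<open>The group algebra\<close>

definition characteristic :: "('k, 'x) ring_scheme \<Rightarrow> nat" where
  "characteristic K =
     (if \<exists>n::nat. n > 0 \<and> [n] \<cdot>\<^bsub>K\<^esub> \<one>\<^bsub>K\<^esub> = \<zero>\<^bsub>K\<^esub> then LEAST n. n > 0 \<and> [n] \<cdot>\<^bsub>K\<^esub> \<one>\<^bsub>K\<^esub> = \<zero>\<^bsub>K\<^esub> else 0)"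

definition delta ::
    "('k, 'x) ring_scheme \<Rightarrow> ('g, 'z) monoid_scheme \<Rightarrow> 'g \<Rightarrow> ('g \<Rightarrow> 'k)" where
  "delta K G g = (\<lambda>x\<in>carrier G. if x = g then \<one>\<^bsub>K\<^esub> else \<zero>\<^bsub>K\<^esub>)"

definition group_algebra ::
    "('k, 'x) ring_scheme \<Rightarrow> ('g, 'z) monoid_scheme \<Rightarrow> ('k, 'g \<Rightarrow> 'k) module" where
  "group_algebra K G = \<lparr>
     carrier = carrier G \<rightarrow>\<^sub>E carrier K,
     mult = (\<lambda>f h. \<lambda>x\<in>carrier G. \<Oplus>\<^bsub>K\<^esub>y\<in>carrier G. f y \<otimes>\<^bsub>K\<^esub> h (inv\<^bsub>G\<^esub> y \<otimes>\<^bsub>G\<^esub> x)),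
     one = delta K G \<one>\<^bsub>G\<^esub>,
     zero = (\<lambda>x\<in>carrier G. \<zero>\<^bsub>K\<^esub>),
     add = (\<lambda>f h. \<lambda>x\<in>carrier G. f x \<oplus>\<^bsub>K\<^esub> h x),
     smult = (\<lambda>a f. \<lambda>x\<in>carrier G. a \<otimes>\<^bsub>K\<^esub> f x)\<rparr>"

definition center_algebra :: "('k, 'c) module \<Rightarrow> ('k, 'c) module" where
  "center_algebra C = C\<lparr>carrier := ring_center C\<rparr>"

text \<open>The linear extension of \<open>g \<mapsto> g\<^sup>-\<^sup>1\<close>.\<close>

definition group_star ::
    "('k, 'x) ring_scheme \<Rightarrow> ('g, 'z) monoid_scheme \<Rightarrow> ('g \<Rightarrow> 'k) \<Rightarrow> ('g \<Rightarrow> 'k)" where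
  "group_star K G f =
     (\<Oplus>\<^bsub>group_algebra K G\<^esub>g\<in>carrier G. f g \<odot>\<^bsub>group_algebra K G\<^esub> delta K G (inv\<^bsub>G\<^esub> g))"

definition sum_of_squares ::
    "('k, 'x) ring_scheme \<Rightarrow> ('g, 'z) monoid_scheme \<Rightarrow> ('g \<Rightarrow> 'k)" where
  "sum_of_squares K G = (\<Oplus>\<^bsub>group_algebra K G\<^esub>g\<in>carrier G. delta K G (g \<otimes>\<^bsub>G\<^esub> g))"

end

theory Submission
  imports Defs
begin

text \<open>Write \<open>\<delta> g\<close> for the basis element of \<open>B = K[G]\<close> at \<open>g\<close>, \<open>n\<close> for the image of \<open>|G|\<close> in \<open>K\<close>
(nonzero by the hypothesis on the characteristic) and
\<open>conj_sum b = \<Sum>g. \<delta> g * b * \<delta> (g\<^sup>-\<^sup>1)\<close>. The map \<open>conj_sum\<close> takes values in the center \<open>A\<close>, is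
\<open>A\<close>-linear, multiplies central elements by \<open>n\<close> and multiplies \<open>l\<^sub>B\<close> by \<open>n\<close>, so that
\<open>(z, conj_sum b)\<^sub>A = (z, b)\<^sub>B\<close> for central \<open>z\<close>. Most of the theorem follows from this one identity: the
form on \<open>A\<close> is non-degenerate because the form on \<open>B\<close> is, and the dual map \<open>\<phi>\<^sup>*\<close> is \<open>conj_sum\<close>.

Traces and the elements \<open>K\<^sup>*\<close> are handled by a basis-free device. If \<open>x = \<Sum>i. (x, w\<^sub>i) u\<^sub>i\<close> holds for
all \<open>x\<close>, then \<open>Tr T = \<Sum>i. (T u\<^sub>i, w\<^sub>i)\<close> and \<open>K\<^sup>* = \<Sum>i. u\<^sub>i w\<^sub>i\<^sup>*\<close> (lemmas
\<open>lin_trace_dual_families\<close> and \<open>K_star_dual_families\<close>); the families may be larger than a basis.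
For \<open>B\<close> the families \<open>\<delta> g\<close>, \<open>\<delta> (g\<^sup>-\<^sup>1)\<close> indexed by \<open>G\<close> qualify, and they give
\<open>Tr (b \<mapsto> b' b b'') = l\<^sub>B (b' * conj_sum b'')\<close>, which is the Cardy condition, and \<open>K\<^sub>B\<^sup>* = \<Sum>g. \<delta> (g\<^sup>2) = U\<close>.
For \<open>A\<close> the families \<open>conj_sum (\<delta> g) / n\<close>, \<open>conj_sum (\<delta> (g\<^sup>-\<^sup>1))\<close>, again indexed by \<open>G\<close>, qualify,
so conjugacy classes and their sizes never enter. They give
\<open>K\<^sub>A\<^sup>* = conj_sum (\<Sum>g. \<delta> g * conj_sum (\<delta> g)) / n\<close>, and the inner sum is \<open>U\<^sup>2\<close> because
\<open>g h g h\<^sup>-\<^sup>1 = (g h)\<^sup>2 (h\<^sup>-\<^sup>1)\<^sup>2\<close>; being central, \<open>U\<^sup>2\<close> is fixed by \<open>conj_sum / n\<close>.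

Semi-simplicity uses one criterion for both algebras: it suffices that every left ideal \<open>I\<close> contains
an element \<open>e\<close> with \<open>x e = x\<close> for all \<open>x \<in> I\<close> (lemma \<open>semisimple_of_right_units\<close>). For \<open>B\<close> this is
Maschke's averaging argument. For an ideal \<open>I\<close> of \<open>A\<close>, take such an \<open>e\<close> for a suitable left ideal of \<open>B\<close>
containing \<open>I\<close>, and average: \<open>conj_sum e / n\<close> lies in \<open>I\<close> and has the required property.\<close>

section \<open>Finite sums\<close>

lemmas (in abelian_monoid) finsum_swap = add.finprod_finprod_swap

lemma (in abelian_monoid) finsum_bij:
  assumes "bij_betw h I J" "f \<in> J \<rightarrow> carrier G"
  shows "(\<Oplus>i\<in>I. f (h i)) = (\<Oplus>j\<in>J. f j)"
  using assms finsum_reindex[of f h I] by (simp add: bij_betw_def)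

lemma (in abelian_monoid) finsum_single:
  assumes "finite I" "k \<in> I" "f k \<in> carrier G" "\<And>i. \<lbrakk>i \<in> I; i \<noteq> k\<rbrakk> \<Longrightarrow> f i = \<zero>"
  shows "(\<Oplus>i\<in>I. f i) = f k"
proof -
  have "(\<Oplus>i\<in>I. f i) = (\<Oplus>i\<in>I. if k = i then f k else \<zero>)"
    using assms by (intro finsum_cong') auto
  also have "\<dots> = f k"
    using assms finsum_singleton[of k I "\<lambda>_. f k"] by simp
  finally show ?thesis .
qed

section \<open>Linear algebra\<close>

lemma linear_functional_add:
  "\<lbrakk>linear_functional K V l; v \<in> carrier V; w \<in> carrier V\<rbrakk> \<Longrightarrow> l (v \<oplus>\<^bsub>V\<^esub> w) = l v \<oplus>\<^bsub>K\<^esub> l w"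
  by (simp add: linear_functional_def)

lemma linear_functional_smult:
  "\<lbrakk>linear_functional K V l; a \<in> carrier K; v \<in> carrier V\<rbrakk> \<Longrightarrow> l (a \<odot>\<^bsub>V\<^esub> v) = a \<otimes>\<^bsub>K\<^esub> l v"
  by (simp add: linear_functional_def)

lemma linear_functional_closed:
  "\<lbrakk>linear_functional K V l; v \<in> carrier V\<rbrakk> \<Longrightarrow> l v \<in> carrier K"
  by (auto simp: linear_functional_def)

context vectorspace
begin

lemma linear_functional_finsum:
  assumes l: "linear_functional K V l" and "finite I" "v \<in> I \<rightarrow> carrier V"
  shows "l (\<Oplus>\<^bsub>V\<^esub>i\<in>I. v i) = (\<Oplus>\<^bsub>K\<^esub>i\<in>I. l (v i))"
  using assms(2,3)
proof (induction I rule: finite_induct)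
  case empty
  have "l (\<zero>\<^bsub>K\<^esub> \<odot>\<^bsub>V\<^esub> \<zero>\<^bsub>V\<^esub>) = \<zero>\<^bsub>K\<^esub> \<otimes>\<^bsub>K\<^esub> l \<zero>\<^bsub>V\<^esub>"
    using l by (intro linear_functional_smult) auto
  then show ?case using linear_functional_closed[OF l M.zero_closed] by simp
next
  case (insert k I)
  have c: "(\<Oplus>\<^bsub>V\<^esub>i\<in>I. v i) \<in> carrier V" using insert by (intro M.finsum_closed) auto
  have "l (\<Oplus>\<^bsub>V\<^esub>i\<in>insert k I. v i) = l (v k \<oplus>\<^bsub>V\<^esub> (\<Oplus>\<^bsub>V\<^esub>i\<in>I. v i))"
    using insert by (subst M.finsum_insert) auto
  also have "\<dots> = l (v k) \<oplus>\<^bsub>K\<^esub> (\<Oplus>\<^bsub>K\<^esub>i\<in>I. l (v i))"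
    using insert c by (subst linear_functional_add[OF l]) auto
  also have "\<dots> = (\<Oplus>\<^bsub>K\<^esub>i\<in>insert k I. l (v i))"
    using insert linear_functional_closed[OF l] by (intro R.finsum_insert[symmetric]) auto
  finally show ?case .
qed

lemma linear_functional_lincomb:
  assumes l: "linear_functional K V l" and "finite I" "v \<in> I \<rightarrow> carrier V" "a \<in> I \<rightarrow> carrier K"
  shows "l (\<Oplus>\<^bsub>V\<^esub>i\<in>I. a i \<odot>\<^bsub>V\<^esub> v i) = (\<Oplus>\<^bsub>K\<^esub>i\<in>I. a i \<otimes>\<^bsub>K\<^esub> l (v i))"
proof -
  have "l (\<Oplus>\<^bsub>V\<^esub>i\<in>I. a i \<odot>\<^bsub>V\<^esub> v i) = (\<Oplus>\<^bsub>K\<^esub>i\<in>I. l (a i \<odot>\<^bsub>V\<^esub> v i))"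
    using assms by (intro linear_functional_finsum) auto
  also have "\<dots> = (\<Oplus>\<^bsub>K\<^esub>i\<in>I. a i \<otimes>\<^bsub>K\<^esub> l (v i))"
    using assms linear_functional_closed[OF l]
    by (intro R.finsum_cong') (auto simp: linear_functional_smult[OF l] Pi_iff)
  finally show ?thesis .
qed

lemma module_hom_finsum:
  assumes T: "T \<in> module_hom K V W" and W: "module K W" and "finite I" "v \<in> I \<rightarrow> carrier V"
  shows "T (\<Oplus>\<^bsub>V\<^esub>i\<in>I. v i) = (\<Oplus>\<^bsub>W\<^esub>i\<in>I. T (v i))"
proof -
  interpret W: module K W by fact
  interpret T: mod_hom K V W T by unfold_locales fact
  show ?thesis using assms(3,4)
  proof (induction I rule: finite_induct)
    case (insert k I)
    have c: "(\<Oplus>\<^bsub>V\<^esub>i\<in>I. v i) \<in> carrier V" using insert by (intro M.finsum_closed) auto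
    have "T (\<Oplus>\<^bsub>V\<^esub>i\<in>insert k I. v i) = T (v k \<oplus>\<^bsub>V\<^esub> (\<Oplus>\<^bsub>V\<^esub>i\<in>I. v i))"
      using insert by (subst M.finsum_insert) auto
    also have "\<dots> = T (v k) \<oplus>\<^bsub>W\<^esub> (\<Oplus>\<^bsub>W\<^esub>i\<in>I. T (v i))"
      using insert c by (subst T.f_add) auto
    also have "\<dots> = (\<Oplus>\<^bsub>W\<^esub>i\<in>insert k I. T (v i))"
      using insert by (intro W.M.finsum_insert[symmetric]) auto
    finally show ?case .
  qed simp
qed

lemma module_hom_lincomb:
  assumes T: "T \<in> module_hom K V W" and W: "module K W" and "finite I"
    and "v \<in> I \<rightarrow> carrier V" "a \<in> I \<rightarrow> carrier K"
  shows "T (\<Oplus>\<^bsub>V\<^esub>i\<in>I. a i \<odot>\<^bsub>V\<^esub> v i) = (\<Oplus>\<^bsub>W\<^esub>i\<in>I. a i \<odot>\<^bsub>W\<^esub> T (v i))"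
proof -
  interpret W: module K W by fact
  interpret T: mod_hom K V W T by unfold_locales fact
  have "T (\<Oplus>\<^bsub>V\<^esub>i\<in>I. a i \<odot>\<^bsub>V\<^esub> v i) = (\<Oplus>\<^bsub>W\<^esub>i\<in>I. T (a i \<odot>\<^bsub>V\<^esub> v i))"
    using assms by (intro module_hom_finsum) auto
  also have "\<dots> = (\<Oplus>\<^bsub>W\<^esub>i\<in>I. a i \<odot>\<^bsub>W\<^esub> T (v i))"
    using assms by (intro W.M.finsum_cong') (auto simp: Pi_iff)
  finally show ?thesis .
qed

lemma coord_closed_lincomb:
  assumes "finite X" "basis X" "v \<in> carrier V"
  shows "coord X v \<in> X \<rightarrow>\<^sub>E carrier K \<and> lincomb (coord X v) X = v"
proof -
  have "X \<subseteq> carrier V" using assms(2) by (simp add: basis_def)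
  then have "\<exists>!a. a \<in> X \<rightarrow>\<^sub>E carrier K \<and> lincomb a X = v"
    using basis_criterion[of X] assms by auto
  then show ?thesis unfolding coord_def by (rule theI')
qed

lemma coord_closed:
  assumes "finite X" "basis X" "v \<in> carrier V" "x \<in> X"
  shows "coord X v x \<in> carrier K"
  using coord_closed_lincomb[OF assms(1-3)] assms(4) by (auto simp: PiE_def)

lemma lincomb_coord:
  assumes "finite X" "basis X" "v \<in> carrier V"
  shows "(\<Oplus>\<^bsub>V\<^esub>x\<in>X. coord X v x \<odot>\<^bsub>V\<^esub> x) = v"
  using coord_closed_lincomb[OF assms] by (simp add: lincomb_def)

lemma coord_eqI:
  assumes X: "finite X" "basis X" and a: "a \<in> X \<rightarrow> carrier K" and "x \<in> X"
  shows "coord X (lincomb a X) x = a x"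
proof -
  have XV: "X \<subseteq> carrier V" using X by (simp add: basis_def)
  let ?v = "lincomb a X"
  have v: "?v \<in> carrier V" using XV a by auto
  have "restrict a X \<in> X \<rightarrow>\<^sub>E carrier K" using a by auto
  moreover have "lincomb (restrict a X) X = ?v"
    using XV a by (intro lincomb_cong) auto
  moreover have "\<exists>!a. a \<in> X \<rightarrow>\<^sub>E carrier K \<and> lincomb a X = ?v"
    using basis_criterion[of X] X XV v by auto
  ultimately have "restrict a X = coord X ?v"
    using coord_closed_lincomb[OF X v] by blast
  then show ?thesis using \<open>x \<in> X\<close> by (metis restrict_apply')
qed

lemma coord_linear:
  assumes X: "finite X" "basis X" and "x \<in> X"
  shows "linear_functional K V (\<lambda>v. coord X v x)"
  unfolding linear_functional_def
proof (intro conjI ballI)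
  have XV: "X \<subseteq> carrier V" using X by (simp add: basis_def)
  show "(\<lambda>v. coord X v x) \<in> carrier V \<rightarrow> carrier K" using coord_closed[OF X _ \<open>x \<in> X\<close>] by auto
  fix v assume v: "v \<in> carrier V"
  note cv = coord_closed[OF X v]
  { fix w assume w: "w \<in> carrier V"
    note cw = coord_closed[OF X w]
    have "lincomb (\<lambda>x. coord X v x \<oplus>\<^bsub>K\<^esub> coord X w x) X = lincomb (coord X v) X \<oplus>\<^bsub>V\<^esub> lincomb (coord X w) X"
      using X XV cv cw by (intro lincomb_sum) auto
    also have "\<dots> = v \<oplus>\<^bsub>V\<^esub> w"
      using coord_closed_lincomb[OF X v] coord_closed_lincomb[OF X w] by simp
    finally show "coord X (v \<oplus>\<^bsub>V\<^esub> w) x = coord X v x \<oplus>\<^bsub>K\<^esub> coord X w x"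
      using coord_eqI[OF X, of "\<lambda>x. coord X v x \<oplus>\<^bsub>K\<^esub> coord X w x" x] cv cw \<open>x \<in> X\<close> by auto }
  fix a assume a: "a \<in> carrier K"
  have "lincomb (\<lambda>x. a \<otimes>\<^bsub>K\<^esub> coord X v x) X = a \<odot>\<^bsub>V\<^esub> lincomb (coord X v) X"
    using X XV cv a by (intro lincomb_smult) auto
  also have "\<dots> = a \<odot>\<^bsub>V\<^esub> v" using coord_closed_lincomb[OF X v] by simp
  finally show "coord X (a \<odot>\<^bsub>V\<^esub> v) x = a \<otimes>\<^bsub>K\<^esub> coord X v x"
    using coord_eqI[OF X, of "\<lambda>x. a \<otimes>\<^bsub>K\<^esub> coord X v x" x] cv a \<open>x \<in> X\<close> by auto
qed

lemma some_basis:
  assumes "fin_dim"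
  shows "finite some_basis" "basis some_basis" "some_basis \<subseteq> carrier V"
proof -
  have "finite some_basis \<and> basis some_basis"
    unfolding some_basis_def using finite_basis_exists[OF assms] by (rule someI_ex)
  then show "finite some_basis" "basis some_basis" "some_basis \<subseteq> carrier V"
    by (auto simp: basis_def)
qed

text \<open>A trace formula for expansions in possibly overcomplete families. Expand
\<open>T x\<close> through the \<open>v i\<close> and each \<open>v i\<close> through the basis: both sides equal
\<open>\<Sum>i x. f\<^sub>i (T x) * coord (v i) x\<close>, summed over \<open>i\<close> and over the basis vectors \<open>x\<close>.\<close>

lemma lin_trace_eq_sum:
  assumes fd: "fin_dim" and T: "T \<in> module_hom K V V" and I: "finite I" and v: "v \<in> I \<rightarrow> carrier V"
    and f: "\<And>i. i \<in> I \<Longrightarrow> linear_functional K V (f i)"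
    and expand: "\<And>x. x \<in> carrier V \<Longrightarrow> (\<Oplus>\<^bsub>V\<^esub>i\<in>I. f i x \<odot>\<^bsub>V\<^esub> v i) = x"
  shows "lin_trace T = (\<Oplus>\<^bsub>K\<^esub>i\<in>I. f i (T (v i)))"
proof -
  let ?X = some_basis
  note X = some_basis(1,2)[OF fd] and XV = some_basis(3)[OF fd]
  have Tc: "T x \<in> carrier V" if "x \<in> carrier V" for x using T that by (auto simp: module_hom_def)
  note fc = linear_functional_closed[OF f]
  have cc: "coord ?X x y \<in> carrier K" if "x \<in> carrier V" "y \<in> ?X" for x y
    using coord_closed[OF X] that by auto
  have vc: "v i \<in> carrier V" if "i \<in> I" for i using v that by auto
  have "lin_trace T = (\<Oplus>\<^bsub>K\<^esub>x\<in>?X. \<Oplus>\<^bsub>K\<^esub>i\<in>I. f i (T x) \<otimes>\<^bsub>K\<^esub> coord ?X (v i) x)"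
    unfolding lin_trace_def
  proof (intro R.finsum_cong' refl funcsetI)
    fix x assume x: "x \<in> ?X"
    then have Tx: "T x \<in> carrier V" using Tc XV by auto
    have "coord ?X (T x) x = coord ?X (\<Oplus>\<^bsub>V\<^esub>i\<in>I. f i (T x) \<odot>\<^bsub>V\<^esub> v i) x"
      using expand[OF Tx] by simp
    also have "\<dots> = (\<Oplus>\<^bsub>K\<^esub>i\<in>I. f i (T x) \<otimes>\<^bsub>K\<^esub> coord ?X (v i) x)"
      using I v fc Tx by (intro linear_functional_lincomb[OF coord_linear[OF X x]]) auto
    finally show "coord ?X (T x) x = (\<Oplus>\<^bsub>K\<^esub>i\<in>I. f i (T x) \<otimes>\<^bsub>K\<^esub> coord ?X (v i) x)" .
    show "(\<Oplus>\<^bsub>K\<^esub>i\<in>I. f i (T x) \<otimes>\<^bsub>K\<^esub> coord ?X (v i) x) \<in> carrier K"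
      using fc Tx cc vc x by (intro R.finsum_closed) auto
  qed
  also have "\<dots> = (\<Oplus>\<^bsub>K\<^esub>i\<in>I. \<Oplus>\<^bsub>K\<^esub>x\<in>?X. f i (T x) \<otimes>\<^bsub>K\<^esub> coord ?X (v i) x)"
    using I X fc Tc cc vc XV by (intro R.finsum_swap) auto
  also have "\<dots> = (\<Oplus>\<^bsub>K\<^esub>i\<in>I. f i (T (v i)))"
  proof (intro R.finsum_cong' refl funcsetI)
    fix i assume i: "i \<in> I"
    show "f i (T (v i)) \<in> carrier K" using i vc Tc fc by auto
    have "f i (T (v i)) = f i (T (\<Oplus>\<^bsub>V\<^esub>x\<in>?X. coord ?X (v i) x \<odot>\<^bsub>V\<^esub> x))"
      using lincomb_coord[OF X] vc i by simp
    also have "\<dots> = f i (\<Oplus>\<^bsub>V\<^esub>x\<in>?X. coord ?X (v i) x \<odot>\<^bsub>V\<^esub> T x)"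
      using X XV cc vc i by (subst module_hom_lincomb[OF T]) (auto intro: module_axioms)
    also have "\<dots> = (\<Oplus>\<^bsub>K\<^esub>x\<in>?X. coord ?X (v i) x \<otimes>\<^bsub>K\<^esub> f i (T x))"
      using X XV cc vc i Tc by (intro linear_functional_lincomb[OF f[OF i]]) auto
    also have "\<dots> = (\<Oplus>\<^bsub>K\<^esub>x\<in>?X. f i (T x) \<otimes>\<^bsub>K\<^esub> coord ?X (v i) x)"
      using X XV cc vc i Tc fc by (intro R.finsum_cong' refl R.m_comm) auto
    finally show "(\<Oplus>\<^bsub>K\<^esub>x\<in>?X. f i (T x) \<otimes>\<^bsub>K\<^esub> coord ?X (v i) x) = f i (T (v i))" by simp
  qed
  finally show ?thesis .
qed

end

lemma (in module) submodule_finsum_closed: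
  assumes N: "submodule R N M" and "finite A" "f \<in> A \<rightarrow> N"
  shows "(\<Oplus>\<^bsub>M\<^esub>a\<in>A. f a) \<in> N"
  using assms(2,3)
proof (induction A rule: finite_induct)
  case empty
  then show ?case using N by (simp add: submodule.zero_closed)
next
  case (insert a A)
  have "f \<in> insert a A \<rightarrow> carrier M" using submodule.subset[OF N] insert by auto
  then have "(\<Oplus>\<^bsub>M\<^esub>a\<in>insert a A. f a) = f a \<oplus>\<^bsub>M\<^esub> (\<Oplus>\<^bsub>M\<^esub>a\<in>A. f a)"
    using insert by (intro M.finsum_insert) auto
  then show ?case using insert N by (auto intro: submodule.m_closed)
qed

lemma (in module) finsum_submodule:
  assumes N: "submodule R N M" and "finite A" "f \<in> A \<rightarrow> N"
  shows "(\<Oplus>\<^bsub>M\<lparr>carrier := N\<rparr>\<^esub>a\<in>A. f a) = (\<Oplus>\<^bsub>M\<^esub>a\<in>A. f a)"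
proof -
  interpret N: module R "M\<lparr>carrier := N\<rparr>" using N by (rule submodule_is_module)
  show ?thesis using assms(2,3)
  proof (induction A rule: finite_induct)
    case (insert a A)
    have f: "f \<in> insert a A \<rightarrow> carrier M" using submodule.subset[OF N] insert by auto
    have "(\<Oplus>\<^bsub>M\<lparr>carrier := N\<rparr>\<^esub>a\<in>insert a A. f a) = f a \<oplus>\<^bsub>M\<^esub> (\<Oplus>\<^bsub>M\<lparr>carrier := N\<rparr>\<^esub>a\<in>A. f a)"
      using insert N.M.finsum_insert[of A a f] by auto
    also have "\<dots> = f a \<oplus>\<^bsub>M\<^esub> (\<Oplus>\<^bsub>M\<^esub>a\<in>A. f a)" using insert by simp
    also have "\<dots> = (\<Oplus>\<^bsub>M\<^esub>a\<in>insert a A. f a)"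
      using insert f by (intro M.finsum_insert[symmetric]) auto
    finally show ?case .
  qed simp
qed

context vectorspace
begin

lemma coord_basis_vector:
  assumes X: "finite X" "basis X" and "x \<in> X" "z \<in> X"
  shows "coord X z x = (if x = z then \<one>\<^bsub>K\<^esub> else \<zero>\<^bsub>K\<^esub>)"
proof -
  let ?a = "\<lambda>y. if y = z then \<one>\<^bsub>K\<^esub> else \<zero>\<^bsub>K\<^esub>"
  have XV: "X \<subseteq> carrier V" using X by (simp add: basis_def)
  have "lincomb ?a X = ?a z \<odot>\<^bsub>V\<^esub> z"
    unfolding lincomb_def using X XV \<open>z \<in> X\<close>
    by (intro M.finsum_single[where f = "\<lambda>y. ?a y \<odot>\<^bsub>V\<^esub> y"]) auto
  also have "\<dots> = z" using XV \<open>z \<in> X\<close> by auto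
  finally show ?thesis using coord_eqI[OF X, of ?a x] \<open>x \<in> X\<close> by auto
qed

lemma lin_indpt_insert:
  assumes "S \<subseteq> carrier V" "lin_indpt S" "v \<in> carrier V" "v \<notin> span S"
  shows "v \<notin> S" "lin_indpt (insert v S)"
proof -
  show "v \<notin> S" using in_own_span[OF assms(1)] assms(4) by auto
  then show "lin_indpt (insert v S)"
    using lin_dep_iff_in_span[OF assms(1-3)] assms(4) by simp
qed

lemma maximal_lin_indpt_extension:
  assumes fd: "fin_dim" and W: "submodule K W V" and S: "S \<subseteq> W" "lin_indpt S"
  obtains T where "S \<subseteq> T" "T \<subseteq> W" "finite T" "lin_indpt T" "span T = W"
proof -
  have WV: "W \<subseteq> carrier V" using W by (rule submodule.subset)
  define P where "P = (\<lambda>T. S \<subseteq> T \<and> T \<subseteq> W \<and> lin_indpt T)"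
  have "\<exists>T. finite T \<and> maximal T P"
  proof (rule maximal_exists)
    show "finite T \<and> card T \<le> dim" if "P T" for T
      using that WV li_le_dim[OF fd, of T] by (auto simp: P_def)
    show "P S" using S by (simp add: P_def)
  qed
  then obtain T where T: "finite T" "P T" and max: "\<And>T'. \<lbrakk>T \<subseteq> T'; P T'\<rbrakk> \<Longrightarrow> T' = T"
    by (auto simp: maximal_def)
  have "W \<subseteq> span T"
  proof
    fix w assume w: "w \<in> W"
    show "w \<in> span T"
    proof (rule ccontr)
      assume "w \<notin> span T"
      with lin_indpt_insert[of T w] have "w \<notin> T" "lin_indpt (insert w T)"
        using T w WV by (auto simp: P_def)
      then show False using max[of "insert w T"] T w by (auto simp: P_def)
    qed
  qed
  moreover have "span T \<subseteq> W" using T W by (intro span_is_subset) (auto simp: P_def)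
  ultimately show ?thesis using T that by (auto simp: P_def)
qed

text \<open>Extend a basis \<open>S\<close> of \<open>W\<close> to a basis of the whole space and drop the coordinates outside \<open>S\<close>.\<close>

lemma linear_projection_onto_submodule:
  assumes fd: "fin_dim" and W: "submodule K W V"
  obtains p where "p \<in> module_hom K V V" "\<And>v. v \<in> carrier V \<Longrightarrow> p v \<in> W"
    "\<And>w. w \<in> W \<Longrightarrow> p w = w"
proof -
  interpret W: submodule K W V by fact
  have top: "submodule K (carrier V) V" by unfold_locales auto
  obtain S where S: "S \<subseteq> W" "finite S" "lin_indpt S" "span S = W"
    using maximal_lin_indpt_extension[OF fd W, of "{}"] by (auto simp: lin_dep_def)
  obtain X where X: "S \<subseteq> X" "X \<subseteq> carrier V" "finite X" "lin_indpt X" "span X = carrier V"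
    using maximal_lin_indpt_extension[OF fd top, of S] S W.subset by auto
  have bX: "basis X" using X by (simp add: basis_def)
  note cX = coord_closed[OF X(3) bX]
  define p where "p = (\<lambda>v. \<Oplus>\<^bsub>V\<^esub>x\<in>S. coord X v x \<odot>\<^bsub>V\<^esub> x)"
  have lin: "linear_functional K V (\<lambda>v. coord X v x)" if "x \<in> S" for x
    using coord_linear[OF X(3) bX] X(1) that by auto
  note add = linear_functional_add[OF lin] and smult = linear_functional_smult[OF lin]
  have pc: "p v = lincomb (coord X v) S" for v by (simp add: p_def lincomb_def)
  have SV: "S \<subseteq> carrier V" using X by auto
  have cS: "coord X v \<in> S \<rightarrow> carrier K" if "v \<in> carrier V" for v
    using cX[OF that] X(1) by auto
  have pW: "p v \<in> W" if "v \<in> carrier V" for v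
    using finite_span[OF S(2) SV] S(4) cS[OF that] by (auto simp: pc)
  have "p \<in> module_hom K V V"
    unfolding module_hom_def
  proof (intro CollectI conjI allI impI)
    show "p \<in> carrier V \<rightarrow> carrier V" using pW W.subset by auto
    fix v w assume "v \<in> carrier V \<and> w \<in> carrier V"
    then have v: "v \<in> carrier V" and w: "w \<in> carrier V" by auto
    have "p (v \<oplus>\<^bsub>V\<^esub> w) = lincomb (\<lambda>x. coord X v x \<oplus>\<^bsub>K\<^esub> coord X w x) S"
      unfolding pc using SV v w cS by (intro lincomb_cong) (auto simp: add Pi_iff)
    then show "p (v \<oplus>\<^bsub>V\<^esub> w) = p v \<oplus>\<^bsub>V\<^esub> p w"
      using lincomb_sum[OF S(2) SV cS[OF v] cS[OF w]] by (simp add: pc)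
  next
    fix a v assume "a \<in> carrier K \<and> v \<in> carrier V"
    then have a: "a \<in> carrier K" and v: "v \<in> carrier V" by auto
    have "p (a \<odot>\<^bsub>V\<^esub> v) = lincomb (\<lambda>x. a \<otimes>\<^bsub>K\<^esub> coord X v x) S"
      unfolding pc using SV v a cS by (intro lincomb_cong) (auto simp: smult Pi_iff)
    then show "p (a \<odot>\<^bsub>V\<^esub> v) = a \<odot>\<^bsub>V\<^esub> p v"
      using lincomb_smult[OF SV cS[OF v] a] by (simp add: pc)
  qed
  moreover have "p w = w" if w: "w \<in> W" for w
  proof -
    obtain a where a: "a \<in> S \<rightarrow> carrier K" "w = lincomb a S"
      using w S(4) finite_span[OF S(2) SV] by auto
    let ?b = "\<lambda>x. if x \<in> S then a x else \<zero>\<^bsub>K\<^esub>"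
    have "lincomb ?b X = lincomb a S"
      unfolding lincomb_def
      using X(1,2,3) a(1)
      by (intro M.add.finprod_mono_neutral_cong_right) (auto simp: Pi_iff)
    moreover have "coord X (lincomb ?b X) x = a x" if "x \<in> S" for x
      using coord_eqI[OF X(3) bX, of ?b x] a(1) X(1) that by (auto simp: Pi_iff)
    ultimately have "coord X w x = a x" if "x \<in> S" for x using that a(2) by simp
    then have "p w = lincomb a S"
      unfolding pc using SV a by (intro lincomb_cong) auto
    then show ?thesis using a by simp
  qed
  ultimately show ?thesis using that pW by blast
qed

lemma submodule_fin_dim:
  assumes fd: "fin_dim" and W: "submodule K W V"
  shows "vectorspace.fin_dim K (vs W)"
proof -
  interpret W: vectorspace K "vs W" using W vectorspace_axioms
    by (intro subspace_is_vs) (simp add: subspace_def)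
  obtain T where "T \<subseteq> W" "finite T" "span T = W"
    using maximal_lin_indpt_extension[OF fd W, of "{}"] by (auto simp: lin_dep_def)
  then show ?thesis
    using span_li_not_depend(1)[OF _ W] unfolding W.fin_dim_def by auto
qed

text \<open>The dimension of \<open>W\<close>, measured by independent sets of the ambient space, so that ranks of different
subspaces are compared without passing to the restricted structures. It serves as the measure for
inductions over subspaces.\<close>

definition indep_rank :: "'c set \<Rightarrow> nat" where
  "indep_rank W = Max {card S | S. S \<subseteq> W \<and> lin_indpt S}"

lemma indep_rank_strict_mono:
  assumes fd: "fin_dim" and W: "submodule K W V" and WW': "W \<subset> W'" and W': "W' \<subseteq> carrier V"
  shows "indep_rank W < indep_rank W'"
proof -
  have WV: "W \<subseteq> carrier V" using W by (rule submodule.subset)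
  let ?C = "\<lambda>W. {card S | S. S \<subseteq> W \<and> lin_indpt S}"
  have fin: "finite (?C U)" if "U \<subseteq> carrier V" for U
  proof (rule finite_subset)
    show "?C U \<subseteq> {..dim}" using li_le_dim(2)[OF fd] that by blast
  qed simp
  have "lin_indpt {}" by (simp add: lin_dep_def)
  then have "?C W \<noteq> {}" by blast
  then have "Max (?C W) \<in> ?C W" using fin[OF WV] by (intro Max_in) auto
  then obtain S where S: "S \<subseteq> W" "lin_indpt S" "indep_rank W = card S"
    by (auto simp: indep_rank_def)
  obtain v where v: "v \<in> W'" "v \<notin> W" using WW' by auto
  have "span S \<subseteq> W" using S W by (intro span_is_subset) auto
  then have "v \<notin> S" "lin_indpt (insert v S)"
    using lin_indpt_insert[of S v] S v W' WV by auto
  moreover have "finite S" using S WV li_le_dim(1)[OF fd, of S] by auto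
  ultimately have "Suc (card S) \<in> ?C W'"
    using S v WW' by (intro CollectI exI[of _ "insert v S"]) auto
  then have "Suc (card S) \<le> indep_rank W'"
    unfolding indep_rank_def using fin[OF W'] by (intro Max_ge) auto
  then show ?thesis using S by simp
qed

end

section \<open>Dual families in a Frobenius pair\<close>

lemma (in fin_dim_algebra) sandwich_linear:
  assumes "a \<in> carrier C" "b \<in> carrier C"
  shows "(\<lambda>x. a \<otimes>\<^bsub>C\<^esub> x \<otimes>\<^bsub>C\<^esub> b) \<in> module_hom K C C"
  using assms
  by (auto simp: module_hom_def C.l_distr C.r_distr smult_mult_left smult_mult_right)

context frobenius_pair
begin

lemma form_linear_left:
  assumes "y \<in> carrier C"
  shows "linear_functional K C (\<lambda>x. frob_form C l x y)"
  using assms l_linear unfolding linear_functional_def frob_form_def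
  by (auto simp: C.l_distr smult_mult_left Pi_iff)

lemma form_linear_right:
  assumes "x \<in> carrier C"
  shows "linear_functional K C (\<lambda>y. frob_form C l x y)"
  using assms l_linear unfolding linear_functional_def frob_form_def
  by (auto simp: C.r_distr smult_mult_right Pi_iff)

lemma form_closed: "\<lbrakk>x \<in> carrier C; y \<in> carrier C\<rbrakk> \<Longrightarrow> frob_form C l x y \<in> carrier K"
  using linear_functional_closed[OF form_linear_right] by auto

lemma form_eqI:
  assumes x: "x \<in> carrier C" and y: "y \<in> carrier C"
    and eq: "\<And>z. z \<in> carrier C \<Longrightarrow> frob_form C l x z = frob_form C l y z"
  shows "x = y"
proof -
  have "x \<ominus>\<^bsub>C\<^esub> y = \<zero>\<^bsub>C\<^esub>"
  proof (rule form_nondegenerate)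
    show "x \<ominus>\<^bsub>C\<^esub> y \<in> carrier C" using x y by simp
    fix z assume z: "z \<in> carrier C"
    note lin = form_linear_left[OF z]
    have my: "(\<ominus>\<^bsub>K\<^esub> \<one>\<^bsub>K\<^esub>) \<odot>\<^bsub>C\<^esub> y = \<ominus>\<^bsub>C\<^esub> y" using y by (simp add: smult_minus_1)
    have "x \<ominus>\<^bsub>C\<^esub> y = x \<oplus>\<^bsub>C\<^esub> (\<ominus>\<^bsub>K\<^esub> \<one>\<^bsub>K\<^esub>) \<odot>\<^bsub>C\<^esub> y" by (simp add: my M.minus_eq)
    then have "frob_form C l (x \<ominus>\<^bsub>C\<^esub> y) z =
        frob_form C l x z \<oplus>\<^bsub>K\<^esub> (\<ominus>\<^bsub>K\<^esub> \<one>\<^bsub>K\<^esub>) \<otimes>\<^bsub>K\<^esub> frob_form C l y z"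
      using x y by (simp add: linear_functional_add[OF lin] linear_functional_smult[OF lin])
    also have "\<dots> = \<zero>\<^bsub>K\<^esub>"
      using form_closed[OF y z] by (simp add: eq[OF z] R.l_minus R.r_neg)
    finally show "frob_form C l (x \<ominus>\<^bsub>C\<^esub> y) z = \<zero>\<^bsub>K\<^esub>" .
  qed
  then show ?thesis using x y by simp
qed

text \<open>The element \<open>\<Sum>i. u\<^sub>i \<otimes> w\<^sub>i\<close> is the Casimir element of the form. Every basis together with its dual
basis is an example, but the index set may be larger than the dimension.\<close>

definition dual_families :: "'i set \<Rightarrow> ('i \<Rightarrow> 'c) \<Rightarrow> ('i \<Rightarrow> 'c) \<Rightarrow> bool" where
  "dual_families I u w \<longleftrightarrow> finite I \<and> u \<in> I \<rightarrow> carrier C \<and> w \<in> I \<rightarrow> carrier C \<and>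
     (\<forall>x\<in>carrier C. (\<Oplus>\<^bsub>C\<^esub>i\<in>I. frob_form C l x (w i) \<odot>\<^bsub>C\<^esub> u i) = x)"

text \<open>By symmetry of the form, \<open>x\<close> and \<open>\<Sum>i. (x, u\<^sub>i) w\<^sub>i\<close> pair equally with every vector.\<close>

lemma dual_families_swap:
  assumes "dual_families I u w"
  shows "dual_families I w u"
proof -
  have I: "finite I" and u: "u \<in> I \<rightarrow> carrier C" and w: "w \<in> I \<rightarrow> carrier C"
    and ex: "\<And>x. x \<in> carrier C \<Longrightarrow> (\<Oplus>\<^bsub>C\<^esub>i\<in>I. frob_form C l x (w i) \<odot>\<^bsub>C\<^esub> u i) = x"
    using assms by (auto simp: dual_families_def)
  have uc: "u i \<in> carrier C" and wc: "w i \<in> carrier C" if "i \<in> I" for i using u w that by auto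
  have "(\<Oplus>\<^bsub>C\<^esub>i\<in>I. frob_form C l x (u i) \<odot>\<^bsub>C\<^esub> w i) = x" if x: "x \<in> carrier C" for x
  proof (rule form_eqI)
    show "(\<Oplus>\<^bsub>C\<^esub>i\<in>I. frob_form C l x (u i) \<odot>\<^bsub>C\<^esub> w i) \<in> carrier C"
      using x uc wc form_closed by (intro M.finsum_closed) auto
    show "x \<in> carrier C" by fact
    fix z assume z: "z \<in> carrier C"
    have "frob_form C l (\<Oplus>\<^bsub>C\<^esub>i\<in>I. frob_form C l x (u i) \<odot>\<^bsub>C\<^esub> w i) z =
        (\<Oplus>\<^bsub>K\<^esub>i\<in>I. frob_form C l x (u i) \<otimes>\<^bsub>K\<^esub> frob_form C l (w i) z)"
      using I w uc x form_closed by (intro linear_functional_lincomb[OF form_linear_left[OF z]]) auto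
    also have "\<dots> = (\<Oplus>\<^bsub>K\<^esub>i\<in>I. frob_form C l z (w i) \<otimes>\<^bsub>K\<^esub> frob_form C l x (u i))"
      using x z uc wc form_closed by (intro R.finsum_cong') (auto simp: R.m_comm form_sym)
    also have "\<dots> = frob_form C l x (\<Oplus>\<^bsub>C\<^esub>i\<in>I. frob_form C l z (w i) \<odot>\<^bsub>C\<^esub> u i)"
      using I u wc z form_closed
      by (intro linear_functional_lincomb[OF form_linear_right[OF x], symmetric]) auto
    also have "\<dots> = frob_form C l x z" using ex[OF z] by simp
    finally show "frob_form C l (\<Oplus>\<^bsub>C\<^esub>i\<in>I. frob_form C l x (u i) \<odot>\<^bsub>C\<^esub> w i) z = frob_form C l x z" .
  qed
  then show ?thesis using I u w by (simp add: dual_families_def)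
qed

lemma lin_trace_dual_families:
  assumes "dual_families I u w" and T: "T \<in> module_hom K C C"
  shows "lin_trace T = (\<Oplus>\<^bsub>K\<^esub>i\<in>I. frob_form C l (T (u i)) (w i))"
  using assms form_linear_left fin_dim
  by (intro lin_trace_eq_sum) (auto simp: dual_families_def)

text \<open>Any pair of dual families yields an inverse of the Gram matrix, with entries
\<open>\<Sum>i. coord (u\<^sub>i) x * coord (w\<^sub>i) y\<close>. Hence the choice in \<open>inverse_gram\<close> ranges over a nonempty set and
the chosen matrix has the defining properties.\<close>

lemma inverse_gram_right:
  assumes dual: "dual_families I u w" and X: "finite X" "basis X"
  shows "\<And>x y. \<lbrakk>x \<in> X; y \<in> X\<rbrakk> \<Longrightarrow> inverse_gram X x y \<in> carrier K"
    and "\<And>x z. \<lbrakk>x \<in> X; z \<in> X\<rbrakk> \<Longrightarrow>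
      (\<Oplus>\<^bsub>K\<^esub>y\<in>X. frob_form C l x y \<otimes>\<^bsub>K\<^esub> inverse_gram X y z) = (if x = z then \<one>\<^bsub>K\<^esub> else \<zero>\<^bsub>K\<^esub>)"
proof -
  have I: "finite I" and u: "u \<in> I \<rightarrow> carrier C" and w: "w \<in> I \<rightarrow> carrier C"
    and ex: "\<And>x. x \<in> carrier C \<Longrightarrow> (\<Oplus>\<^bsub>C\<^esub>i\<in>I. frob_form C l x (w i) \<odot>\<^bsub>C\<^esub> u i) = x"
    using dual by (auto simp: dual_families_def)
  have ex': "\<And>x. x \<in> carrier C \<Longrightarrow> (\<Oplus>\<^bsub>C\<^esub>i\<in>I. frob_form C l x (u i) \<odot>\<^bsub>C\<^esub> w i) = x"
    using dual_families_swap[OF dual] by (auto simp: dual_families_def)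
  have uc: "u i \<in> carrier C" and wc: "w i \<in> carrier C" if "i \<in> I" for i using u w that by auto
  have XC: "X \<subseteq> carrier C" using X by (simp add: basis_def)
  then have XC': "x \<in> carrier C" if "x \<in> X" for x using that by auto
  note cc = coord_closed[OF X] and lin = coord_linear[OF X] and fc = form_closed
  let ?F = "\<lambda>x y. \<Oplus>\<^bsub>K\<^esub>i\<in>I. coord X (u i) x \<otimes>\<^bsub>K\<^esub> coord X (w i) y"
  let ?P = "\<lambda>F. (\<forall>x\<in>X. \<forall>y\<in>X. F x y \<in> carrier K) \<and>
     (\<forall>x\<in>X. \<forall>z\<in>X. (\<Oplus>\<^bsub>K\<^esub>y\<in>X. F x y \<otimes>\<^bsub>K\<^esub> frob_form C l y z) = (if x = z then \<one>\<^bsub>K\<^esub> else \<zero>\<^bsub>K\<^esub>)) \<and>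
     (\<forall>x\<in>X. \<forall>z\<in>X. (\<Oplus>\<^bsub>K\<^esub>y\<in>X. frob_form C l x y \<otimes>\<^bsub>K\<^esub> F y z) = (if x = z then \<one>\<^bsub>K\<^esub> else \<zero>\<^bsub>K\<^esub>))"
  have "?P ?F"
  proof (intro conjI ballI)
    show "?F x y \<in> carrier K" if "x \<in> X" "y \<in> X" for x y
      using that cc uc wc by (intro R.finsum_closed) auto
  next
    fix x z assume x: "x \<in> X" and z: "z \<in> X"
    have "(\<Oplus>\<^bsub>K\<^esub>y\<in>X. ?F x y \<otimes>\<^bsub>K\<^esub> frob_form C l y z) =
        (\<Oplus>\<^bsub>K\<^esub>y\<in>X. \<Oplus>\<^bsub>K\<^esub>i\<in>I. coord X (u i) x \<otimes>\<^bsub>K\<^esub> (coord X (w i) y \<otimes>\<^bsub>K\<^esub> frob_form C l y z))"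
      using I x z cc uc wc fc XC'
      by (intro R.finsum_cong') (auto simp: R.finsum_ldistr R.m_assoc Pi_iff intro!: R.finsum_cong' R.finsum_closed)
    also have "\<dots> = (\<Oplus>\<^bsub>K\<^esub>i\<in>I. \<Oplus>\<^bsub>K\<^esub>y\<in>X. coord X (u i) x \<otimes>\<^bsub>K\<^esub> (coord X (w i) y \<otimes>\<^bsub>K\<^esub> frob_form C l y z))"
      using I X x z cc uc wc fc XC' by (intro R.finsum_swap) auto
    also have "\<dots> = (\<Oplus>\<^bsub>K\<^esub>i\<in>I. frob_form C l z (w i) \<otimes>\<^bsub>K\<^esub> coord X (u i) x)"
    proof (intro R.finsum_cong' refl funcsetI)
      fix i assume i: "i \<in> I"
      show "frob_form C l z (w i) \<otimes>\<^bsub>K\<^esub> coord X (u i) x \<in> carrier K"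
        using i x z cc uc wc fc XC' by auto
      have "(\<Oplus>\<^bsub>K\<^esub>y\<in>X. coord X (u i) x \<otimes>\<^bsub>K\<^esub> (coord X (w i) y \<otimes>\<^bsub>K\<^esub> frob_form C l y z)) =
          coord X (u i) x \<otimes>\<^bsub>K\<^esub> (\<Oplus>\<^bsub>K\<^esub>y\<in>X. coord X (w i) y \<otimes>\<^bsub>K\<^esub> frob_form C l y z)"
        using X i x z cc uc wc fc XC' by (intro R.finsum_rdistr[symmetric]) auto
      also have "(\<Oplus>\<^bsub>K\<^esub>y\<in>X. coord X (w i) y \<otimes>\<^bsub>K\<^esub> frob_form C l y z) =
          frob_form C l (\<Oplus>\<^bsub>C\<^esub>y\<in>X. coord X (w i) y \<odot>\<^bsub>C\<^esub> y) z"
        using X i z cc wc XC'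
        by (intro linear_functional_lincomb[OF form_linear_left, symmetric]) auto
      also have "\<dots> = frob_form C l z (w i)"
        using lincomb_coord[OF X wc[OF i]] form_sym i wc z XC' by simp
      finally show "(\<Oplus>\<^bsub>K\<^esub>y\<in>X. coord X (u i) x \<otimes>\<^bsub>K\<^esub> (coord X (w i) y \<otimes>\<^bsub>K\<^esub> frob_form C l y z)) =
          frob_form C l z (w i) \<otimes>\<^bsub>K\<^esub> coord X (u i) x"
        using i x z cc uc wc fc XC' by (simp add: R.m_comm)
    qed
    also have "\<dots> = coord X (\<Oplus>\<^bsub>C\<^esub>i\<in>I. frob_form C l z (w i) \<odot>\<^bsub>C\<^esub> u i) x"
      using I u wc fc XC' z by (intro linear_functional_lincomb[OF lin[OF x], symmetric]) auto
    also have "\<dots> = (if x = z then \<one>\<^bsub>K\<^esub> else \<zero>\<^bsub>K\<^esub>)"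
      using ex XC' z coord_basis_vector[OF X x z] by simp
    finally show "(\<Oplus>\<^bsub>K\<^esub>y\<in>X. ?F x y \<otimes>\<^bsub>K\<^esub> frob_form C l y z) = (if x = z then \<one>\<^bsub>K\<^esub> else \<zero>\<^bsub>K\<^esub>)" .
  next
    fix x z assume x: "x \<in> X" and z: "z \<in> X"
    have "(\<Oplus>\<^bsub>K\<^esub>y\<in>X. frob_form C l x y \<otimes>\<^bsub>K\<^esub> ?F y z) =
        (\<Oplus>\<^bsub>K\<^esub>y\<in>X. \<Oplus>\<^bsub>K\<^esub>i\<in>I. frob_form C l x y \<otimes>\<^bsub>K\<^esub> (coord X (u i) y \<otimes>\<^bsub>K\<^esub> coord X (w i) z))"
      using I x z cc uc wc fc XC'
      by (intro R.finsum_cong') (auto simp: R.finsum_rdistr Pi_iff intro!: R.finsum_cong' R.finsum_closed)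
    also have "\<dots> = (\<Oplus>\<^bsub>K\<^esub>i\<in>I. \<Oplus>\<^bsub>K\<^esub>y\<in>X. frob_form C l x y \<otimes>\<^bsub>K\<^esub> (coord X (u i) y \<otimes>\<^bsub>K\<^esub> coord X (w i) z))"
      using I X x z cc uc wc fc XC' by (intro R.finsum_swap) auto
    also have "\<dots> = (\<Oplus>\<^bsub>K\<^esub>i\<in>I. frob_form C l x (u i) \<otimes>\<^bsub>K\<^esub> coord X (w i) z)"
    proof (intro R.finsum_cong' refl funcsetI)
      fix i assume i: "i \<in> I"
      show "frob_form C l x (u i) \<otimes>\<^bsub>K\<^esub> coord X (w i) z \<in> carrier K"
        using i x z cc uc wc fc XC' by auto
      have "(\<Oplus>\<^bsub>K\<^esub>y\<in>X. frob_form C l x y \<otimes>\<^bsub>K\<^esub> (coord X (u i) y \<otimes>\<^bsub>K\<^esub> coord X (w i) z)) =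
          (\<Oplus>\<^bsub>K\<^esub>y\<in>X. (coord X (u i) y \<otimes>\<^bsub>K\<^esub> frob_form C l x y) \<otimes>\<^bsub>K\<^esub> coord X (w i) z)"
        using X i x z cc uc wc fc XC' by (intro R.finsum_cong') (auto simp: R.m_ac)
      also have "\<dots> = (\<Oplus>\<^bsub>K\<^esub>y\<in>X. coord X (u i) y \<otimes>\<^bsub>K\<^esub> frob_form C l x y) \<otimes>\<^bsub>K\<^esub> coord X (w i) z"
        using X i x z cc uc wc fc XC' by (intro R.finsum_ldistr[symmetric]) auto
      also have "(\<Oplus>\<^bsub>K\<^esub>y\<in>X. coord X (u i) y \<otimes>\<^bsub>K\<^esub> frob_form C l x y) =
          frob_form C l x (\<Oplus>\<^bsub>C\<^esub>y\<in>X. coord X (u i) y \<odot>\<^bsub>C\<^esub> y)"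
        using X i x cc uc XC'
        by (intro linear_functional_lincomb[OF form_linear_right, symmetric]) auto
      also have "\<dots> = frob_form C l x (u i)"
        using lincomb_coord[OF X uc[OF i]] by simp
      finally show "(\<Oplus>\<^bsub>K\<^esub>y\<in>X. frob_form C l x y \<otimes>\<^bsub>K\<^esub> (coord X (u i) y \<otimes>\<^bsub>K\<^esub> coord X (w i) z)) =
          frob_form C l x (u i) \<otimes>\<^bsub>K\<^esub> coord X (w i) z" .
    qed
    also have "\<dots> = coord X (\<Oplus>\<^bsub>C\<^esub>i\<in>I. frob_form C l x (u i) \<odot>\<^bsub>C\<^esub> w i) z"
      using I w uc fc XC' x by (intro linear_functional_lincomb[OF lin[OF z], symmetric]) auto
    also have "\<dots> = (if x = z then \<one>\<^bsub>K\<^esub> else \<zero>\<^bsub>K\<^esub>)"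
      using ex' XC' x coord_basis_vector[OF X z x] by auto
    finally show "(\<Oplus>\<^bsub>K\<^esub>y\<in>X. frob_form C l x y \<otimes>\<^bsub>K\<^esub> ?F y z) = (if x = z then \<one>\<^bsub>K\<^esub> else \<zero>\<^bsub>K\<^esub>)" .
  qed
  then have P: "?P (inverse_gram X)" unfolding inverse_gram_def by (rule someI[of ?P ?F])
  show "inverse_gram X x y \<in> carrier K" if "x \<in> X" "y \<in> X" for x y
    using P[THEN conjunct1] that by simp
  show "(\<Oplus>\<^bsub>K\<^esub>y\<in>X. frob_form C l x y \<otimes>\<^bsub>K\<^esub> inverse_gram X y z) = (if x = z then \<one>\<^bsub>K\<^esub> else \<zero>\<^bsub>K\<^esub>)"
    if "x \<in> X" "z \<in> X" for x z
    using P[THEN conjunct2, THEN conjunct2, rule_format, OF that] .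
qed

text \<open>Expand each basis vector \<open>x\<close> as \<open>\<Sum>i. (x, w\<^sub>i) u\<^sub>i\<close> in the definition of \<open>K_star\<close>. The coefficient of
\<open>u\<^sub>i * s y\<close> becomes \<open>\<Sum>x. (x, w\<^sub>i) F x y\<close>, which is the coordinate of \<open>w\<^sub>i\<close> at \<open>y\<close> because \<open>F\<close> inverts
the Gram matrix; summing over \<open>y\<close> leaves \<open>u\<^sub>i * s (w\<^sub>i)\<close>.\<close>

lemma K_star_dual_families:
  assumes dual: "dual_families I u w" and s: "s \<in> module_hom K C C"
  shows "K_star s = (\<Oplus>\<^bsub>C\<^esub>i\<in>I. u i \<otimes>\<^bsub>C\<^esub> s (w i))"
proof -
  let ?X = some_basis
  let ?F = "inverse_gram ?X"
  have I: "finite I" and u: "u \<in> I \<rightarrow> carrier C" and w: "w \<in> I \<rightarrow> carrier C"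
    and ex: "\<And>x. x \<in> carrier C \<Longrightarrow> (\<Oplus>\<^bsub>C\<^esub>i\<in>I. frob_form C l x (w i) \<odot>\<^bsub>C\<^esub> u i) = x"
    using dual by (auto simp: dual_families_def)
  have uc: "u i \<in> carrier C" and wc: "w i \<in> carrier C" if "i \<in> I" for i using u w that by auto
  note X = some_basis(1,2)[OF fin_dim]
  have XC: "x \<in> carrier C" if "x \<in> ?X" for x using some_basis(3)[OF fin_dim] that by auto
  note F = inverse_gram_right[OF dual X]
  note cc = coord_closed[OF X] and fc = form_closed
  have sc: "s x \<in> carrier C" if "x \<in> carrier C" for x using s that by (auto simp: module_hom_def)
  have coord_w: "(\<Oplus>\<^bsub>K\<^esub>x\<in>?X. frob_form C l x (w i) \<otimes>\<^bsub>K\<^esub> ?F x y) = coord ?X (w i) y"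
    if i: "i \<in> I" and y: "y \<in> ?X" for i y
  proof -
    have "(\<Oplus>\<^bsub>K\<^esub>x\<in>?X. frob_form C l x (w i) \<otimes>\<^bsub>K\<^esub> ?F x y) =
        (\<Oplus>\<^bsub>K\<^esub>x\<in>?X. \<Oplus>\<^bsub>K\<^esub>z\<in>?X. coord ?X (w i) z \<otimes>\<^bsub>K\<^esub> (frob_form C l z x \<otimes>\<^bsub>K\<^esub> ?F x y))"
    proof (intro R.finsum_cong' refl funcsetI)
      fix x assume x: "x \<in> ?X"
      show "(\<Oplus>\<^bsub>K\<^esub>z\<in>?X. coord ?X (w i) z \<otimes>\<^bsub>K\<^esub> (frob_form C l z x \<otimes>\<^bsub>K\<^esub> ?F x y)) \<in> carrier K"
        using x y i cc wc fc XC F(1) by (intro R.finsum_closed) auto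
      have "frob_form C l x (w i) = frob_form C l (\<Oplus>\<^bsub>C\<^esub>z\<in>?X. coord ?X (w i) z \<odot>\<^bsub>C\<^esub> z) x"
        using lincomb_coord[OF X wc[OF i]] form_sym i x wc XC by simp
      also have "\<dots> = (\<Oplus>\<^bsub>K\<^esub>z\<in>?X. coord ?X (w i) z \<otimes>\<^bsub>K\<^esub> frob_form C l z x)"
        using X i x cc wc XC by (intro linear_functional_lincomb[OF form_linear_left]) auto
      finally have "frob_form C l x (w i) \<otimes>\<^bsub>K\<^esub> ?F x y =
          (\<Oplus>\<^bsub>K\<^esub>z\<in>?X. coord ?X (w i) z \<otimes>\<^bsub>K\<^esub> frob_form C l z x) \<otimes>\<^bsub>K\<^esub> ?F x y" by simp
      also have "\<dots> = (\<Oplus>\<^bsub>K\<^esub>z\<in>?X. (coord ?X (w i) z \<otimes>\<^bsub>K\<^esub> frob_form C l z x) \<otimes>\<^bsub>K\<^esub> ?F x y)"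
        using X i x y cc wc fc XC F(1) by (intro R.finsum_ldistr) auto
      also have "\<dots> = (\<Oplus>\<^bsub>K\<^esub>z\<in>?X. coord ?X (w i) z \<otimes>\<^bsub>K\<^esub> (frob_form C l z x \<otimes>\<^bsub>K\<^esub> ?F x y))"
        using X i x y cc wc fc XC F(1) by (intro R.finsum_cong') (auto simp: R.m_assoc)
      finally show "frob_form C l x (w i) \<otimes>\<^bsub>K\<^esub> ?F x y =
          (\<Oplus>\<^bsub>K\<^esub>z\<in>?X. coord ?X (w i) z \<otimes>\<^bsub>K\<^esub> (frob_form C l z x \<otimes>\<^bsub>K\<^esub> ?F x y))" .
    qed
    also have "\<dots> = (\<Oplus>\<^bsub>K\<^esub>z\<in>?X. \<Oplus>\<^bsub>K\<^esub>x\<in>?X. coord ?X (w i) z \<otimes>\<^bsub>K\<^esub> (frob_form C l z x \<otimes>\<^bsub>K\<^esub> ?F x y))"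
      using X i y cc wc fc XC F(1) by (intro R.finsum_swap) auto
    also have "\<dots> = (\<Oplus>\<^bsub>K\<^esub>z\<in>?X. coord ?X (w i) z \<otimes>\<^bsub>K\<^esub> (\<Oplus>\<^bsub>K\<^esub>x\<in>?X. frob_form C l z x \<otimes>\<^bsub>K\<^esub> ?F x y))"
      using X i y cc wc fc XC F(1)
      by (intro R.finsum_cong' refl R.finsum_rdistr[symmetric]) (auto intro!: R.m_closed R.finsum_closed)
    also have "\<dots> = (\<Oplus>\<^bsub>K\<^esub>z\<in>?X. if y = z then coord ?X (w i) z else \<zero>\<^bsub>K\<^esub>)"
      using i y cc wc by (intro R.finsum_cong') (auto simp: F(2))
    also have "\<dots> = coord ?X (w i) y"
      using R.finsum_singleton[OF y X(1), of "coord ?X (w i)"] i cc wc by auto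
    finally show ?thesis .
  qed
  have "K_star s = (\<Oplus>\<^bsub>C\<^esub>x\<in>?X. \<Oplus>\<^bsub>C\<^esub>y\<in>?X. ?F x y \<odot>\<^bsub>C\<^esub> (x \<otimes>\<^bsub>C\<^esub> s y))"
    by (simp add: K_star_def)
  also have "\<dots> = (\<Oplus>\<^bsub>C\<^esub>y\<in>?X. \<Oplus>\<^bsub>C\<^esub>x\<in>?X. ?F x y \<odot>\<^bsub>C\<^esub> (x \<otimes>\<^bsub>C\<^esub> s y))"
    using X F(1) XC sc by (intro M.finsum_swap) auto
  also have "\<dots> = (\<Oplus>\<^bsub>C\<^esub>y\<in>?X. \<Oplus>\<^bsub>C\<^esub>i\<in>I. u i \<otimes>\<^bsub>C\<^esub> (coord ?X (w i) y \<odot>\<^bsub>C\<^esub> s y))"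
  proof (intro M.finsum_cong' refl funcsetI)
    fix y assume y: "y \<in> ?X"
    then have sy: "s y \<in> carrier C" using sc XC by auto
    show "(\<Oplus>\<^bsub>C\<^esub>i\<in>I. u i \<otimes>\<^bsub>C\<^esub> (coord ?X (w i) y \<odot>\<^bsub>C\<^esub> s y)) \<in> carrier C"
      using y uc wc cc sy by (intro M.finsum_closed) auto
    have "(\<Oplus>\<^bsub>C\<^esub>x\<in>?X. ?F x y \<odot>\<^bsub>C\<^esub> (x \<otimes>\<^bsub>C\<^esub> s y)) =
       (\<Oplus>\<^bsub>C\<^esub>x\<in>?X. \<Oplus>\<^bsub>C\<^esub>i\<in>I. (frob_form C l x (w i) \<otimes>\<^bsub>K\<^esub> ?F x y) \<odot>\<^bsub>C\<^esub> (u i \<otimes>\<^bsub>C\<^esub> s y))"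
    proof (intro M.finsum_cong' refl funcsetI)
      fix x assume x: "x \<in> ?X"
      show "(\<Oplus>\<^bsub>C\<^esub>i\<in>I. (frob_form C l x (w i) \<otimes>\<^bsub>K\<^esub> ?F x y) \<odot>\<^bsub>C\<^esub> (u i \<otimes>\<^bsub>C\<^esub> s y)) \<in> carrier C"
        using x y uc wc sy fc F(1) XC by (intro M.finsum_closed) auto
      have "?F x y \<odot>\<^bsub>C\<^esub> (x \<otimes>\<^bsub>C\<^esub> s y) =
          ?F x y \<odot>\<^bsub>C\<^esub> ((\<Oplus>\<^bsub>C\<^esub>i\<in>I. frob_form C l x (w i) \<odot>\<^bsub>C\<^esub> u i) \<otimes>\<^bsub>C\<^esub> s y)"
        using ex[OF XC[OF x]] by simp
      also have "\<dots> = ?F x y \<odot>\<^bsub>C\<^esub> (\<Oplus>\<^bsub>C\<^esub>i\<in>I. (frob_form C l x (w i) \<odot>\<^bsub>C\<^esub> u i) \<otimes>\<^bsub>C\<^esub> s y)"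
        using I x uc wc sy fc XC by (subst C.finsum_ldistr) auto
      also have "\<dots> = (\<Oplus>\<^bsub>C\<^esub>i\<in>I. ?F x y \<odot>\<^bsub>C\<^esub> ((frob_form C l x (w i) \<odot>\<^bsub>C\<^esub> u i) \<otimes>\<^bsub>C\<^esub> s y))"
        using x y uc wc sy fc XC F(1) by (intro finsum_smult) auto
      also have "\<dots> = (\<Oplus>\<^bsub>C\<^esub>i\<in>I. (frob_form C l x (w i) \<otimes>\<^bsub>K\<^esub> ?F x y) \<odot>\<^bsub>C\<^esub> (u i \<otimes>\<^bsub>C\<^esub> s y))"
        using x y uc wc sy fc XC F(1)
        by (intro M.finsum_cong') (auto simp: smult_mult_left R.m_comm simp flip: smult_assoc1)
      finally show "?F x y \<odot>\<^bsub>C\<^esub> (x \<otimes>\<^bsub>C\<^esub> s y) =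
          (\<Oplus>\<^bsub>C\<^esub>i\<in>I. (frob_form C l x (w i) \<otimes>\<^bsub>K\<^esub> ?F x y) \<odot>\<^bsub>C\<^esub> (u i \<otimes>\<^bsub>C\<^esub> s y))" .
    qed
    also have "\<dots> = (\<Oplus>\<^bsub>C\<^esub>i\<in>I. \<Oplus>\<^bsub>C\<^esub>x\<in>?X. (frob_form C l x (w i) \<otimes>\<^bsub>K\<^esub> ?F x y) \<odot>\<^bsub>C\<^esub> (u i \<otimes>\<^bsub>C\<^esub> s y))"
      using I X y uc wc sy fc XC F(1) by (intro M.finsum_swap) auto
    also have "\<dots> = (\<Oplus>\<^bsub>C\<^esub>i\<in>I. u i \<otimes>\<^bsub>C\<^esub> (coord ?X (w i) y \<odot>\<^bsub>C\<^esub> s y))"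
    proof (intro M.finsum_cong' refl funcsetI)
      fix i assume i: "i \<in> I"
      show "u i \<otimes>\<^bsub>C\<^esub> (coord ?X (w i) y \<odot>\<^bsub>C\<^esub> s y) \<in> carrier C" using i y uc wc cc sy by auto
      have "(\<Oplus>\<^bsub>C\<^esub>x\<in>?X. (frob_form C l x (w i) \<otimes>\<^bsub>K\<^esub> ?F x y) \<odot>\<^bsub>C\<^esub> (u i \<otimes>\<^bsub>C\<^esub> s y)) =
          (\<Oplus>\<^bsub>K\<^esub>x\<in>?X. frob_form C l x (w i) \<otimes>\<^bsub>K\<^esub> ?F x y) \<odot>\<^bsub>C\<^esub> (u i \<otimes>\<^bsub>C\<^esub> s y)"
        using i y uc wc sy fc XC F(1) by (intro finsum_smult_r[symmetric]) auto
      also have "\<dots> = u i \<otimes>\<^bsub>C\<^esub> (coord ?X (w i) y \<odot>\<^bsub>C\<^esub> s y)"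
        using coord_w[OF i y] i y uc wc cc sy by (simp add: smult_mult_right)
      finally show "(\<Oplus>\<^bsub>C\<^esub>x\<in>?X. (frob_form C l x (w i) \<otimes>\<^bsub>K\<^esub> ?F x y) \<odot>\<^bsub>C\<^esub> (u i \<otimes>\<^bsub>C\<^esub> s y)) =
          u i \<otimes>\<^bsub>C\<^esub> (coord ?X (w i) y \<odot>\<^bsub>C\<^esub> s y)" .
    qed
    finally show "(\<Oplus>\<^bsub>C\<^esub>x\<in>?X. ?F x y \<odot>\<^bsub>C\<^esub> (x \<otimes>\<^bsub>C\<^esub> s y)) =
        (\<Oplus>\<^bsub>C\<^esub>i\<in>I. u i \<otimes>\<^bsub>C\<^esub> (coord ?X (w i) y \<odot>\<^bsub>C\<^esub> s y))" .
  qed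
  also have "\<dots> = (\<Oplus>\<^bsub>C\<^esub>i\<in>I. \<Oplus>\<^bsub>C\<^esub>y\<in>?X. u i \<otimes>\<^bsub>C\<^esub> (coord ?X (w i) y \<odot>\<^bsub>C\<^esub> s y))"
    using I X uc wc sc cc XC by (intro M.finsum_swap) auto
  also have "\<dots> = (\<Oplus>\<^bsub>C\<^esub>i\<in>I. u i \<otimes>\<^bsub>C\<^esub> s (w i))"
  proof (intro M.finsum_cong' refl funcsetI)
    fix i assume i: "i \<in> I"
    show "u i \<otimes>\<^bsub>C\<^esub> s (w i) \<in> carrier C" using i uc wc sc by auto
    have "(\<Oplus>\<^bsub>C\<^esub>y\<in>?X. u i \<otimes>\<^bsub>C\<^esub> (coord ?X (w i) y \<odot>\<^bsub>C\<^esub> s y)) =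
        u i \<otimes>\<^bsub>C\<^esub> (\<Oplus>\<^bsub>C\<^esub>y\<in>?X. coord ?X (w i) y \<odot>\<^bsub>C\<^esub> s y)"
      using X i uc wc sc cc XC by (intro C.finsum_rdistr[symmetric]) auto
    also have "(\<Oplus>\<^bsub>C\<^esub>y\<in>?X. coord ?X (w i) y \<odot>\<^bsub>C\<^esub> s y) = s (\<Oplus>\<^bsub>C\<^esub>y\<in>?X. coord ?X (w i) y \<odot>\<^bsub>C\<^esub> y)"
      using X i wc cc XC
      by (intro module_hom_lincomb[OF s, symmetric]) (auto intro: module_axioms)
    also have "\<dots> = s (w i)" using lincomb_coord[OF X wc[OF i]] by simp
    finally show "(\<Oplus>\<^bsub>C\<^esub>y\<in>?X. u i \<otimes>\<^bsub>C\<^esub> (coord ?X (w i) y \<odot>\<^bsub>C\<^esub> s y)) = u i \<otimes>\<^bsub>C\<^esub> s (w i)" .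
  qed
  finally show ?thesis .
qed

end

section \<open>A criterion for semi-simplicity\<close>

context fin_dim_algebra
begin

lemma left_ideal_subset: "left_ideal I C \<Longrightarrow> I \<subseteq> carrier C"
  by (simp add: left_ideal_def additive_subgroup.a_subset)

lemma left_ideal_submodule:
  assumes I: "left_ideal I C"
  shows "submodule K I C"
proof -
  interpret I: additive_subgroup I C using I by (simp add: left_ideal_def)
  show ?thesis
  proof unfold_locales
    show "I \<subseteq> carrier C" by (rule I.a_subset)
    show "v \<oplus>\<^bsub>C\<^esub> w \<in> I" if "v \<in> I" "w \<in> I" for v w using that by (rule I.a_closed)
    show "\<zero>\<^bsub>C\<^esub> \<in> I" by (rule I.zero_closed)
    fix c v assume c: "c \<in> carrier K" and v: "v \<in> I"
    then have vC: "v \<in> carrier C" using I.a_subset by auto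
    have "c \<odot>\<^bsub>C\<^esub> v = (c \<odot>\<^bsub>C\<^esub> \<one>\<^bsub>C\<^esub>) \<otimes>\<^bsub>C\<^esub> v"
      using c vC smult_mult_left[of c "\<one>\<^bsub>C\<^esub>" v] by simp
    also have "\<dots> \<in> I" using I c v by (auto simp: left_ideal_def)
    finally show "c \<odot>\<^bsub>C\<^esub> v \<in> I" .
  qed
qed

lemma left_ideal_minus:
  assumes I: "left_ideal I C" and "x \<in> I" "y \<in> I"
  shows "x \<ominus>\<^bsub>C\<^esub> y \<in> I"
proof -
  interpret I: additive_subgroup I C using I by (simp add: left_ideal_def)
  show ?thesis using assms I.a_closed I.a_inv_closed by (simp add: M.minus_eq)
qed

lemma minimal_left_ideal_exists:
  assumes "left_ideal I C" "I \<noteq> {\<zero>\<^bsub>C\<^esub>}"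
  obtains J where "minimal_left_ideal J C" "J \<subseteq> I"
proof -
  have "\<exists>J. minimal_left_ideal J C \<and> J \<subseteq> I"
    using assms
  proof (induction "indep_rank I" arbitrary: I rule: less_induct)
    case less
    show ?case
    proof (cases "minimal_left_ideal I C")
      case False
      then obtain J where J: "left_ideal J C" "J \<subseteq> I" "J \<noteq> {\<zero>\<^bsub>C\<^esub>}" "J \<noteq> I"
        using less.prems by (auto simp: minimal_left_ideal_def)
      then have "indep_rank J < indep_rank I"
        using left_ideal_submodule left_ideal_subset less.prems
        by (intro indep_rank_strict_mono fin_dim) auto
      then show ?thesis using less.hyps[of J] J by blast
    qed blast
  qed
  then show ?thesis using that by blast
qed

text \<open>A right unit \<open>e \<in> M\<close> of a minimal left ideal \<open>M \<subseteq> I\<close> splits \<open>M\<close> off: right multiplication by \<open>e\<close>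
projects \<open>I\<close> onto \<open>M\<close>, and its kernel \<open>N\<close> is a left ideal of smaller rank. By induction on the rank,
every left ideal, in particular the whole algebra, is a direct sum of minimal left ideals.\<close>

lemma semisimple_of_right_units:
  assumes right_unit: "\<And>I. left_ideal I C \<Longrightarrow> \<exists>e\<in>I. \<forall>x\<in>I. x \<otimes>\<^bsub>C\<^esub> e = x"
  shows "semisimple C"
proof -
  have decomp: "\<exists>(n::nat) J. (\<forall>i<n. minimal_left_ideal (J i) C) \<and> (\<forall>i<n. J i \<subseteq> I) \<and>
        (\<forall>x\<in>I. \<exists>!c. c \<in> (\<Pi>\<^sub>E i\<in>{..<n}. J i) \<and> x = (\<Oplus>\<^bsub>C\<^esub>i\<in>{..<n}. c i))"
    if "left_ideal I C" for I
    using that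
  proof (induction "indep_rank I" arbitrary: I rule: less_induct)
    case less
    note I = \<open>left_ideal I C\<close>
    have IC: "I \<subseteq> carrier C" using left_ideal_subset[OF I] .
    show ?case
    proof (cases "I = {\<zero>\<^bsub>C\<^esub>}")
      case True
      then show ?thesis by (intro exI[of _ 0]) auto
    next
      case False
      obtain M where M: "minimal_left_ideal M C" "M \<subseteq> I"
        using minimal_left_ideal_exists[OF I False] .
      have Mi: "left_ideal M C" and M0: "M \<noteq> {\<zero>\<^bsub>C\<^esub>}"
        using M(1) by (auto simp: minimal_left_ideal_def)
      obtain e where e: "e \<in> M" and Me: "\<And>x. x \<in> M \<Longrightarrow> x \<otimes>\<^bsub>C\<^esub> e = x"
        using right_unit[OF Mi] by blast
      have MC: "M \<subseteq> carrier C" using M(2) IC by auto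
      have eC: "e \<in> carrier C" using e MC by auto
      have xeM: "x \<otimes>\<^bsub>C\<^esub> e \<in> M" if "x \<in> carrier C" for x
        using Mi that e by (auto simp: left_ideal_def)
      \<comment> \<open>The complement of \<open>M\<close>: an element \<open>x\<close> of \<open>I\<close> is \<open>x e + (x - x e)\<close>.\<close>
      define N where "N = {x \<in> I. x \<otimes>\<^bsub>C\<^esub> e = \<zero>\<^bsub>C\<^esub>}"
      interpret I: submodule K I C using left_ideal_submodule[OF I] .
      have Ni: "left_ideal N C"
        unfolding left_ideal_def
      proof (intro conjI ballI)
        show "additive_subgroup N C"
        proof (intro additive_subgroup.intro subgroup.intro)
          show "N \<subseteq> carrier (add_monoid C)" using IC by (auto simp: N_def)
          show "x \<otimes>\<^bsub>add_monoid C\<^esub> y \<in> N" if "x \<in> N" "y \<in> N" for x y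
            using that IC eC by (auto simp: N_def C.l_distr subsetD)
          show "\<one>\<^bsub>add_monoid C\<^esub> \<in> N" using eC by (auto simp: N_def)
          show "inv\<^bsub>add_monoid C\<^esub> x \<in> N" if "x \<in> N" for x
          proof -
            have x: "x \<in> I" "x \<in> carrier C" "x \<otimes>\<^bsub>C\<^esub> e = \<zero>\<^bsub>C\<^esub>" using that IC by (auto simp: N_def)
            have "\<ominus>\<^bsub>C\<^esub> x = \<zero>\<^bsub>C\<^esub> \<ominus>\<^bsub>C\<^esub> x" using x by (simp add: M.minus_eq)
            also have "\<dots> \<in> I" using x by (intro left_ideal_minus[OF I]) auto
            finally have "\<ominus>\<^bsub>C\<^esub> x \<in> N" using x eC by (simp add: N_def C.l_minus)
            then show ?thesis by (simp add: a_inv_def)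
          qed
        qed
        show "c \<otimes>\<^bsub>C\<^esub> x \<in> N" if "c \<in> carrier C" "x \<in> N" for c x
          using that I IC eC by (auto simp: N_def left_ideal_def C.m_assoc subsetD)
      qed
      have NI: "N \<subseteq> I" by (auto simp: N_def)
      have split: "x \<ominus>\<^bsub>C\<^esub> x \<otimes>\<^bsub>C\<^esub> e \<in> N" if "x \<in> I" for x
      proof -
        have xC: "x \<in> carrier C" using that IC by auto
        have "(x \<ominus>\<^bsub>C\<^esub> x \<otimes>\<^bsub>C\<^esub> e) \<otimes>\<^bsub>C\<^esub> e = x \<otimes>\<^bsub>C\<^esub> e \<ominus>\<^bsub>C\<^esub> (x \<otimes>\<^bsub>C\<^esub> e) \<otimes>\<^bsub>C\<^esub> e"
          using xC eC by (simp add: M.minus_eq C.l_distr C.l_minus)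
        also have "\<dots> = \<zero>\<^bsub>C\<^esub>" using Me[OF xeM[OF xC]] xC eC by (simp add: M.minus_eq M.r_neg)
        finally show ?thesis
          using left_ideal_minus[OF I that] xeM[OF xC] M(2) by (auto simp: N_def)
      qed
      have "N \<noteq> I"
      proof
        assume "N = I"
        then have "x \<in> N" if "x \<in> M" for x using that M(2) by auto
        then have "x = \<zero>\<^bsub>C\<^esub>" if "x \<in> M" for x using Me[OF that] that by (simp add: N_def)
        then show False using M0 Mi left_ideal_submodule[OF Mi] submodule.zero_closed by blast
      qed
      then have "indep_rank N < indep_rank I"
        using left_ideal_submodule[OF Ni] IC NI by (intro indep_rank_strict_mono fin_dim) auto
      from less.hyps[OF this Ni] obtain n :: nat and J where
        Jmin: "\<forall>i<n. minimal_left_ideal (J i) C" and JN: "\<forall>i<n. J i \<subseteq> N" and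
        J: "\<forall>x\<in>N. \<exists>!c. c \<in> (\<Pi>\<^sub>E i\<in>{..<n}. J i) \<and> x = (\<Oplus>\<^bsub>C\<^esub>i\<in>{..<n}. c i)"
        by (elim exE conjE) (rule that, assumption+)
      \<comment> \<open>The decomposition of \<open>N\<close>, with \<open>M\<close> appended as the last summand.\<close>
      let ?J = "J(n := M)"
      have ins: "{..<Suc n} = insert n {..<n}" by auto
      have JC': "J i \<subseteq> carrier C" if "i < n" for i using that JN NI IC by blast
      have JC: "?J i \<subseteq> carrier C" if "i < Suc n" for i
        using that JC'[of i] MC by (cases "i = n") simp_all
      have sum_Suc: "(\<Oplus>\<^bsub>C\<^esub>i\<in>{..<Suc n}. c i) = c n \<oplus>\<^bsub>C\<^esub> (\<Oplus>\<^bsub>C\<^esub>i\<in>{..<n}. c i)"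
        if "\<And>i. i < Suc n \<Longrightarrow> c i \<in> ?J i" for c
      proof -
        have "c i \<in> carrier C" if "i < Suc n" for i using JC[OF that] \<open>\<And>i. i < Suc n \<Longrightarrow> c i \<in> ?J i\<close>[OF that] by blast
        then show ?thesis unfolding ins by (intro M.finsum_insert) auto
      qed
      have sumN: "(\<Oplus>\<^bsub>C\<^esub>i\<in>{..<n}. c i) \<in> N" if "\<And>i. i < n \<Longrightarrow> c i \<in> J i" for c
        using that JN by (intro submodule_finsum_closed[OF left_ideal_submodule[OF Ni]] funcsetI) blast+
      have "\<exists>!c. c \<in> (\<Pi>\<^sub>E i\<in>{..<Suc n}. ?J i) \<and> x = (\<Oplus>\<^bsub>C\<^esub>i\<in>{..<Suc n}. c i)" if x: "x \<in> I" for x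
      proof -
        have xC: "x \<in> carrier C" using x IC by auto
        from bspec[OF J split[OF x]] obtain c where
          cx: "c \<in> (\<Pi>\<^sub>E i\<in>{..<n}. J i) \<and> x \<ominus>\<^bsub>C\<^esub> x \<otimes>\<^bsub>C\<^esub> e = (\<Oplus>\<^bsub>C\<^esub>i\<in>{..<n}. c i)" and
          c_unique: "\<forall>c'. c' \<in> (\<Pi>\<^sub>E i\<in>{..<n}. J i) \<and>
            x \<ominus>\<^bsub>C\<^esub> x \<otimes>\<^bsub>C\<^esub> e = (\<Oplus>\<^bsub>C\<^esub>i\<in>{..<n}. c' i) \<longrightarrow> c' = c"
          by (rule ex1E) (rule that)
        note c = cx[THEN conjunct1] cx[THEN conjunct2]
        let ?c = "c(n := x \<otimes>\<^bsub>C\<^esub> e)"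
        show ?thesis
        proof (intro ex1I[of _ ?c] conjI; (elim conjE)?)
          show cP: "?c \<in> (\<Pi>\<^sub>E i\<in>{..<Suc n}. ?J i)"
            unfolding ins using c(1) xeM[OF xC] by (auto simp: PiE_iff extensional_def)
          have "(\<Oplus>\<^bsub>C\<^esub>i\<in>{..<Suc n}. ?c i) = x \<otimes>\<^bsub>C\<^esub> e \<oplus>\<^bsub>C\<^esub> (\<Oplus>\<^bsub>C\<^esub>i\<in>{..<n}. ?c i)"
            using cP by (subst sum_Suc) (auto simp: PiE_iff)
          also have "(\<Oplus>\<^bsub>C\<^esub>i\<in>{..<n}. ?c i) = (\<Oplus>\<^bsub>C\<^esub>i\<in>{..<n}. c i)"
            using c(1) JC' by (intro M.finsum_cong') (auto simp: PiE_iff)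
          also have "x \<otimes>\<^bsub>C\<^esub> e \<oplus>\<^bsub>C\<^esub> (\<Oplus>\<^bsub>C\<^esub>i\<in>{..<n}. c i) = x"
            using xC eC by (simp flip: c(2) add: M.minus_eq M.a_lcomm M.r_neg)
          finally show "x = (\<Oplus>\<^bsub>C\<^esub>i\<in>{..<Suc n}. ?c i)" ..
        next
          fix d assume dP: "d \<in> (\<Pi>\<^sub>E i\<in>{..<Suc n}. ?J i)" and xd: "x = (\<Oplus>\<^bsub>C\<^esub>i\<in>{..<Suc n}. d i)"
          let ?y = "\<Oplus>\<^bsub>C\<^esub>i\<in>{..<n}. d i"
          have dJ: "d i \<in> ?J i" if "i < Suc n" for i using dP that by (auto simp: PiE_iff)
          have dn: "d n \<in> M" using dJ[of n] by simp
          have dJ': "d i \<in> J i" if "i < n" for i using dJ[of i] that by simp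
          have yN: "?y \<in> N" using sumN[of d] dJ' by blast
          have yC: "?y \<in> carrier C" "?y \<otimes>\<^bsub>C\<^esub> e = \<zero>\<^bsub>C\<^esub>" using yN IC by (auto simp: N_def)
          have xsum: "x = d n \<oplus>\<^bsub>C\<^esub> ?y" using xd sum_Suc[of d] dJ by simp
          have dnC: "d n \<in> carrier C" using dn MC by auto
          have xe: "x \<otimes>\<^bsub>C\<^esub> e = d n"
            using Me[OF dn] yC dnC eC by (simp add: xsum C.l_distr)
          have "x \<ominus>\<^bsub>C\<^esub> x \<otimes>\<^bsub>C\<^esub> e = ?y"
            unfolding xe using xsum yC(1) dnC by (simp add: M.minus_eq M.a_comm M.a_lcomm M.r_neg M.r_neg1 M.r_neg2)
          also have "?y = (\<Oplus>\<^bsub>C\<^esub>i\<in>{..<n}. (restrict d {..<n}) i)"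
            using subsetD[OF JC' dJ'] by (intro M.finsum_cong') auto
          finally have "x \<ominus>\<^bsub>C\<^esub> x \<otimes>\<^bsub>C\<^esub> e = (\<Oplus>\<^bsub>C\<^esub>i\<in>{..<n}. (restrict d {..<n}) i)" .
          moreover have "restrict d {..<n} \<in> (\<Pi>\<^sub>E i\<in>{..<n}. J i)" using dJ' by auto
          ultimately have "restrict d {..<n} = c" by (intro c_unique[rule_format] conjI)
          then have "d i = c i" if "i < n" for i using that by (metis lessThan_iff restrict_apply')
          moreover have "d i = undefined" if "\<not> i < Suc n" for i
            using dP that by (auto simp: PiE_iff extensional_def)
          moreover have "c i = undefined" if "\<not> i < n" for i
            using c(1) that by (auto simp: PiE_iff extensional_def)
          ultimately have "d i = ?c i" for i
            using xe by (cases "i < n"; cases "i = n") auto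
          then show "d = ?c" by (rule ext)
        qed
      qed
      moreover have "minimal_left_ideal (?J i) C" if "i < Suc n" for i
        using that Jmin M(1) by (cases "i = n") auto
      moreover have "J i \<subseteq> I" if "i < n" for i using that JN NI by blast
      then have "?J i \<subseteq> I" if "i < Suc n" for i
        using that M(2) by (cases "i = n") auto
      ultimately show ?thesis by (intro exI[of _ "Suc n"] exI[of _ ?J] conjI allI impI ballI)
    qed
  qed
  have "left_ideal (carrier C) C"
    unfolding left_ideal_def by (auto intro!: additive_subgroup.intro M.add.subgroup_self)
  from decomp[OF this] obtain n :: nat and J where
    "\<forall>i<n. minimal_left_ideal (J i) C" and
    "\<forall>x\<in>carrier C. \<exists>!c. c \<in> (\<Pi>\<^sub>E i\<in>{..<n}. J i) \<and> x = (\<Oplus>\<^bsub>C\<^esub>i\<in>{..<n}. c i)"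
    by (elim exE conjE) (rule that, assumption+)
  then show ?thesis unfolding semisimple_def by (intro exI conjI)
qed

end

section \<open>The center of an algebra\<close>

context fin_dim_algebra
begin

lemma center_submodule: "submodule K (ring_center C) C"
  by unfold_locales
    (auto simp: ring_center_def C.l_distr C.r_distr smult_mult_left smult_mult_right)

lemma center_fin_dim_algebra: "fin_dim_algebra K (C\<lparr>carrier := ring_center C\<rparr>)"
proof -
  interpret Z: submodule K "ring_center C" C by (rule center_submodule)
  have mult: "x \<otimes>\<^bsub>C\<^esub> y \<in> ring_center C" if x: "x \<in> ring_center C" and y: "y \<in> ring_center C" for x y
  proof -
    have xC: "x \<in> carrier C" "y \<in> carrier C" using x y by (auto simp: ring_center_def)
    have "x \<otimes>\<^bsub>C\<^esub> y \<otimes>\<^bsub>C\<^esub> z = z \<otimes>\<^bsub>C\<^esub> (x \<otimes>\<^bsub>C\<^esub> y)" if z: "z \<in> carrier C" for z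
    proof -
      have "x \<otimes>\<^bsub>C\<^esub> y \<otimes>\<^bsub>C\<^esub> z = x \<otimes>\<^bsub>C\<^esub> (z \<otimes>\<^bsub>C\<^esub> y)"
        using xC z y by (simp add: C.m_assoc ring_center_def)
      also have "\<dots> = z \<otimes>\<^bsub>C\<^esub> x \<otimes>\<^bsub>C\<^esub> y"
        using xC z x by (simp add: ring_center_def flip: C.m_assoc)
      finally show ?thesis using xC z by (simp add: C.m_assoc)
    qed
    then show ?thesis using xC by (simp add: ring_center_def)
  qed
  interpret Z: vectorspace K "C\<lparr>carrier := ring_center C\<rparr>"
    using center_submodule vectorspace_axioms by (intro subspace_is_vs) (simp add: subspace_def)
  interpret Z: ring "C\<lparr>carrier := ring_center C\<rparr>"
  proof (intro ringI Z.abelian_group_axioms monoidI)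
    let ?Z = "C\<lparr>carrier := ring_center C\<rparr>"
    have ZC: "x \<in> carrier C" if "x \<in> carrier ?Z" for x using that Z.subset by auto
    show "\<one>\<^bsub>?Z\<^esub> \<in> carrier ?Z" by (simp add: ring_center_def)
    fix x assume x: "x \<in> carrier ?Z"
    show "\<one>\<^bsub>?Z\<^esub> \<otimes>\<^bsub>?Z\<^esub> x = x" "x \<otimes>\<^bsub>?Z\<^esub> \<one>\<^bsub>?Z\<^esub> = x" using ZC[OF x] by auto
    fix y z assume y: "y \<in> carrier ?Z" and z: "z \<in> carrier ?Z"
    show "x \<otimes>\<^bsub>?Z\<^esub> y \<in> carrier ?Z" using mult x y by simp
    show "x \<otimes>\<^bsub>?Z\<^esub> y \<otimes>\<^bsub>?Z\<^esub> z = x \<otimes>\<^bsub>?Z\<^esub> (y \<otimes>\<^bsub>?Z\<^esub> z)"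
      "(x \<oplus>\<^bsub>?Z\<^esub> y) \<otimes>\<^bsub>?Z\<^esub> z = x \<otimes>\<^bsub>?Z\<^esub> z \<oplus>\<^bsub>?Z\<^esub> y \<otimes>\<^bsub>?Z\<^esub> z"
      "z \<otimes>\<^bsub>?Z\<^esub> (x \<oplus>\<^bsub>?Z\<^esub> y) = z \<otimes>\<^bsub>?Z\<^esub> x \<oplus>\<^bsub>?Z\<^esub> z \<otimes>\<^bsub>?Z\<^esub> y"
      using ZC[OF x] ZC[OF y] ZC[OF z] by (simp_all add: C.m_assoc C.l_distr C.r_distr)
  qed
  show ?thesis
  proof unfold_locales
    show "Z.fin_dim" by (rule submodule_fin_dim[OF fin_dim center_submodule])
  qed (use Z.subset in \<open>simp_all add: smult_mult_left smult_mult_right subset_iff\<close>)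
qed

end

section \<open>The group algebra\<close>

text \<open>For \<open>n > 0\<close>, the remainder of \<open>n\<close> modulo the characteristic also annihilates \<open>\<one>\<close>, so it vanishes by minimality.\<close>

lemma (in ring) characteristic_dvd:
  assumes "[n] \<cdot> \<one> = \<zero>"
  shows "characteristic R dvd n"
proof (cases "n = 0")
  case False
  let ?P = "\<lambda>m::nat. m > 0 \<and> [m] \<cdot> \<one> = \<zero>"
  let ?m = "LEAST m. ?P m"
  have ex: "\<exists>m. ?P m" using assms False by blast
  then have m: "?P ?m" by (rule LeastI_ex)
  have "[n] \<cdot> \<one> = [(n div ?m * ?m)] \<cdot> \<one> \<oplus> [(n mod ?m)] \<cdot> \<one>"
    by (subst add.nat_pow_mult) auto
  also have "[(n div ?m * ?m)] \<cdot> \<one> = [(n div ?m)] \<cdot> ([?m] \<cdot> \<one>)"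
    by (simp add: add.nat_pow_pow mult.commute)
  finally have "[(n mod ?m)] \<cdot> \<one> = \<zero>" using m assms by simp
  then have "n mod ?m = 0"
    using not_less_Least[of "n mod ?m" ?P] m mod_less_divisor[of ?m n] by auto
  then show ?thesis using ex by (auto simp: characteristic_def)
qed simp

locale finite_group_algebra = G: group G + K: field K
  for G :: "('g, 'z) monoid_scheme" and K :: "('k, 'x) ring_scheme" +
  assumes finite_G: "finite (carrier G)"
begin

abbreviation B :: "('k, 'g \<Rightarrow> 'k) module" where "B \<equiv> group_algebra K G"

abbreviation \<delta> :: "'g \<Rightarrow> 'g \<Rightarrow> 'k" where "\<delta> \<equiv> delta K G"

lemma carrier_B: "carrier B = carrier G \<rightarrow>\<^sub>E carrier K"
  by (simp add: group_algebra_def)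

lemma B_apply_closed: "\<lbrakk>f \<in> carrier B; x \<in> carrier G\<rbrakk> \<Longrightarrow> f x \<in> carrier K"
  by (auto simp: carrier_B)

lemma B_eqI:
  "\<lbrakk>f \<in> carrier B; h \<in> carrier B; \<And>x. x \<in> carrier G \<Longrightarrow> f x = h x\<rbrakk> \<Longrightarrow> f = h"
  unfolding carrier_B by (rule PiE_ext)

lemma B_add_apply: "x \<in> carrier G \<Longrightarrow> (f \<oplus>\<^bsub>B\<^esub> h) x = f x \<oplus>\<^bsub>K\<^esub> h x"
  and B_zero_apply: "x \<in> carrier G \<Longrightarrow> \<zero>\<^bsub>B\<^esub> x = \<zero>\<^bsub>K\<^esub>"
  and B_smult_apply: "x \<in> carrier G \<Longrightarrow> (a \<odot>\<^bsub>B\<^esub> f) x = a \<otimes>\<^bsub>K\<^esub> f x"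
  and B_mult_apply: "x \<in> carrier G \<Longrightarrow>
    (f \<otimes>\<^bsub>B\<^esub> h) x = (\<Oplus>\<^bsub>K\<^esub>y\<in>carrier G. f y \<otimes>\<^bsub>K\<^esub> h (inv\<^bsub>G\<^esub> y \<otimes>\<^bsub>G\<^esub> x))"
  and B_one: "\<one>\<^bsub>B\<^esub> = \<delta> \<one>\<^bsub>G\<^esub>"
  by (simp_all add: group_algebra_def)

lemma delta_apply: "x \<in> carrier G \<Longrightarrow> \<delta> g x = (if x = g then \<one>\<^bsub>K\<^esub> else \<zero>\<^bsub>K\<^esub>)"
  by (simp add: delta_def)

lemma delta_closed [simp]: "\<delta> g \<in> carrier B"
  by (auto simp: delta_def carrier_B)

lemma B_mult_closed:
  assumes f: "f \<in> carrier B" and h: "h \<in> carrier B"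
  shows "f \<otimes>\<^bsub>B\<^esub> h \<in> carrier B"
proof -
  have "(f \<otimes>\<^bsub>B\<^esub> h) x \<in> carrier K" if "x \<in> carrier G" for x
    unfolding B_mult_apply[OF that] using that B_apply_closed[OF f] B_apply_closed[OF h]
    by (intro K.finsum_closed) auto
  moreover have "(f \<otimes>\<^bsub>B\<^esub> h) x = undefined" if "x \<notin> carrier G" for x
    using that by (simp add: group_algebra_def)
  ultimately show ?thesis by (simp add: carrier_B PiE_iff extensional_def)
qed

lemma bij_left_mult: "g \<in> carrier G \<Longrightarrow> bij_betw (\<lambda>x. g \<otimes>\<^bsub>G\<^esub> x) (carrier G) (carrier G)"
  by (rule bij_betwI[where g = "\<lambda>x. inv\<^bsub>G\<^esub> g \<otimes>\<^bsub>G\<^esub> x"]) (auto simp flip: G.m_assoc)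

lemma bij_right_mult: "g \<in> carrier G \<Longrightarrow> bij_betw (\<lambda>x. x \<otimes>\<^bsub>G\<^esub> g) (carrier G) (carrier G)"
  by (rule bij_betwI[where g = "\<lambda>x. x \<otimes>\<^bsub>G\<^esub> inv\<^bsub>G\<^esub> g"]) (auto simp: G.m_assoc)

lemma bij_inv: "bij_betw (\<lambda>x. inv\<^bsub>G\<^esub> x) (carrier G) (carrier G)"
  by (rule bij_betwI[where g = "\<lambda>x. inv\<^bsub>G\<^esub> x"]) auto

lemma delta_mult_apply:
  assumes "g \<in> carrier G" "f \<in> carrier B" "x \<in> carrier G"
  shows "(\<delta> g \<otimes>\<^bsub>B\<^esub> f) x = f (inv\<^bsub>G\<^esub> g \<otimes>\<^bsub>G\<^esub> x)"
proof -
  have "(\<delta> g \<otimes>\<^bsub>B\<^esub> f) x = \<delta> g g \<otimes>\<^bsub>K\<^esub> f (inv\<^bsub>G\<^esub> g \<otimes>\<^bsub>G\<^esub> x)"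
    unfolding B_mult_apply[OF assms(3)] using assms finite_G
    by (intro K.finsum_single) (auto simp: delta_apply B_apply_closed)
  then show ?thesis using assms by (simp add: delta_apply B_apply_closed)
qed

lemma mult_delta_apply:
  assumes "g \<in> carrier G" "f \<in> carrier B" "x \<in> carrier G"
  shows "(f \<otimes>\<^bsub>B\<^esub> \<delta> g) x = f (x \<otimes>\<^bsub>G\<^esub> inv\<^bsub>G\<^esub> g)"
proof -
  let ?y = "x \<otimes>\<^bsub>G\<^esub> inv\<^bsub>G\<^esub> g"
  have y: "inv\<^bsub>G\<^esub> ?y \<otimes>\<^bsub>G\<^esub> x = g" using assms by (simp add: G.inv_mult_group G.m_assoc)
  have uniq: "y = ?y" if "y \<in> carrier G" "inv\<^bsub>G\<^esub> y \<otimes>\<^bsub>G\<^esub> x = g" for y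
    using that assms by (metis G.inv_closed G.inv_inv G.inv_solve_left G.inv_solve_right)
  have "(f \<otimes>\<^bsub>B\<^esub> \<delta> g) x = f ?y \<otimes>\<^bsub>K\<^esub> \<delta> g (inv\<^bsub>G\<^esub> ?y \<otimes>\<^bsub>G\<^esub> x)"
    unfolding B_mult_apply[OF assms(3)] using assms finite_G uniq
    by (intro K.finsum_single[where f = "\<lambda>y. f y \<otimes>\<^bsub>K\<^esub> \<delta> g (inv\<^bsub>G\<^esub> y \<otimes>\<^bsub>G\<^esub> x)"])
      (auto simp: delta_apply B_apply_closed)
  then show ?thesis using assms unfolding y by (simp add: delta_apply B_apply_closed)
qed

lemma B_mult_assoc:
  assumes f: "f \<in> carrier B" and h: "h \<in> carrier B" and k: "k \<in> carrier B"
  shows "(f \<otimes>\<^bsub>B\<^esub> h) \<otimes>\<^bsub>B\<^esub> k = f \<otimes>\<^bsub>B\<^esub> (h \<otimes>\<^bsub>B\<^esub> k)"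
proof (rule B_eqI)
  fix x assume x: "x \<in> carrier G"
  note c = B_apply_closed[OF f] B_apply_closed[OF h] B_apply_closed[OF k]
  have "((f \<otimes>\<^bsub>B\<^esub> h) \<otimes>\<^bsub>B\<^esub> k) x =
      (\<Oplus>\<^bsub>K\<^esub>z\<in>carrier G. \<Oplus>\<^bsub>K\<^esub>y\<in>carrier G. f y \<otimes>\<^bsub>K\<^esub> (h (inv\<^bsub>G\<^esub> y \<otimes>\<^bsub>G\<^esub> z) \<otimes>\<^bsub>K\<^esub> k (inv\<^bsub>G\<^esub> z \<otimes>\<^bsub>G\<^esub> x)))"
    unfolding B_mult_apply[OF x] using x c finite_G
    by (intro K.finsum_cong')
      (auto simp: B_mult_apply K.finsum_ldistr K.m_assoc Pi_iff intro!: K.finsum_cong' K.finsum_closed)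
  also have "\<dots> = (\<Oplus>\<^bsub>K\<^esub>y\<in>carrier G. \<Oplus>\<^bsub>K\<^esub>z\<in>carrier G.
      f y \<otimes>\<^bsub>K\<^esub> (h (inv\<^bsub>G\<^esub> y \<otimes>\<^bsub>G\<^esub> z) \<otimes>\<^bsub>K\<^esub> k (inv\<^bsub>G\<^esub> z \<otimes>\<^bsub>G\<^esub> x)))"
    using x c finite_G by (intro K.finsum_swap) auto
  also have "\<dots> = (f \<otimes>\<^bsub>B\<^esub> (h \<otimes>\<^bsub>B\<^esub> k)) x"
    unfolding B_mult_apply[OF x, of f]
  proof (intro K.finsum_cong' refl funcsetI)
    fix y assume y: "y \<in> carrier G"
    have yx: "inv\<^bsub>G\<^esub> y \<otimes>\<^bsub>G\<^esub> x \<in> carrier G" using x y by simp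
    show "f y \<otimes>\<^bsub>K\<^esub> (h \<otimes>\<^bsub>B\<^esub> k) (inv\<^bsub>G\<^esub> y \<otimes>\<^bsub>G\<^esub> x) \<in> carrier K"
      using c y yx B_apply_closed[OF B_mult_closed[OF h k]] by auto
    let ?s = "\<lambda>z. h (inv\<^bsub>G\<^esub> y \<otimes>\<^bsub>G\<^esub> z) \<otimes>\<^bsub>K\<^esub> k (inv\<^bsub>G\<^esub> z \<otimes>\<^bsub>G\<^esub> x)"
    have "(\<Oplus>\<^bsub>K\<^esub>z\<in>carrier G. f y \<otimes>\<^bsub>K\<^esub> ?s z) = f y \<otimes>\<^bsub>K\<^esub> (\<Oplus>\<^bsub>K\<^esub>z\<in>carrier G. ?s z)"
      using x y c finite_G by (intro K.finsum_rdistr[symmetric]) auto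
    also have "(\<Oplus>\<^bsub>K\<^esub>z\<in>carrier G. ?s z) = (\<Oplus>\<^bsub>K\<^esub>v\<in>carrier G. ?s (y \<otimes>\<^bsub>G\<^esub> v))"
      using x y c by (intro K.finsum_bij[symmetric] bij_left_mult) auto
    also have "\<dots> = (h \<otimes>\<^bsub>B\<^esub> k) (inv\<^bsub>G\<^esub> y \<otimes>\<^bsub>G\<^esub> x)"
      unfolding B_mult_apply[OF yx] using x y c
      by (intro K.finsum_cong') (auto simp: G.inv_mult_group G.m_assoc simp flip: G.m_assoc[of "inv\<^bsub>G\<^esub> y" y])
    finally show "(\<Oplus>\<^bsub>K\<^esub>z\<in>carrier G. f y \<otimes>\<^bsub>K\<^esub> ?s z) = f y \<otimes>\<^bsub>K\<^esub> (h \<otimes>\<^bsub>B\<^esub> k) (inv\<^bsub>G\<^esub> y \<otimes>\<^bsub>G\<^esub> x)" .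
  qed
  finally show "((f \<otimes>\<^bsub>B\<^esub> h) \<otimes>\<^bsub>B\<^esub> k) x = (f \<otimes>\<^bsub>B\<^esub> (h \<otimes>\<^bsub>B\<^esub> k)) x" .
qed (use assms B_mult_closed in auto)

lemma B_module: "module K B"
proof -
  \<comment> \<open>\<open>B\<close> and the space of functions on \<open>G\<close> differ only in their multiplication and unit.\<close>
  have "module K (K.func_space (carrier G))" by (rule K.func_space_is_module)
  then show ?thesis
    unfolding module_def module_axioms_def abelian_group_def abelian_group_axioms_def
      abelian_monoid_def group_algebra_def K.func_space_def by simp
qed

lemma B_ring: "ring B"
proof -
  interpret B: module K B by (rule B_module)
  note c = B_apply_closed
  show ?thesis
  proof (intro ringI B.abelian_group_axioms monoidI)
    fix f assume f: "f \<in> carrier B"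
    show "\<one>\<^bsub>B\<^esub> \<otimes>\<^bsub>B\<^esub> f = f"
      using f by (intro B_eqI) (auto simp: B_one B_mult_closed delta_mult_apply)
    show "f \<otimes>\<^bsub>B\<^esub> \<one>\<^bsub>B\<^esub> = f"
      using f by (intro B_eqI) (auto simp: B_one B_mult_closed mult_delta_apply)
    fix h k assume h: "h \<in> carrier B" and k: "k \<in> carrier B"
    show "f \<otimes>\<^bsub>B\<^esub> h \<in> carrier B" using f h by (rule B_mult_closed)
    show "f \<otimes>\<^bsub>B\<^esub> h \<otimes>\<^bsub>B\<^esub> k = f \<otimes>\<^bsub>B\<^esub> (h \<otimes>\<^bsub>B\<^esub> k)" using f h k by (rule B_mult_assoc)
    show "(f \<oplus>\<^bsub>B\<^esub> h) \<otimes>\<^bsub>B\<^esub> k = f \<otimes>\<^bsub>B\<^esub> k \<oplus>\<^bsub>B\<^esub> h \<otimes>\<^bsub>B\<^esub> k"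
      using f h k
      by (intro B_eqI)
        (auto simp: B_mult_closed B_mult_apply B_add_apply c K.l_distr simp flip: K.finsum_addf
          intro!: K.finsum_cong')
    show "k \<otimes>\<^bsub>B\<^esub> (f \<oplus>\<^bsub>B\<^esub> h) = k \<otimes>\<^bsub>B\<^esub> f \<oplus>\<^bsub>B\<^esub> k \<otimes>\<^bsub>B\<^esub> h"
      using f h k
      by (intro B_eqI)
        (auto simp: B_mult_closed B_mult_apply B_add_apply c K.r_distr simp flip: K.finsum_addf
          intro!: K.finsum_cong')
  qed (simp add: B_one)
qed

lemma B_finsum_apply:
  assumes "finite I" "f \<in> I \<rightarrow> carrier B" "x \<in> carrier G"
  shows "(\<Oplus>\<^bsub>B\<^esub>i\<in>I. f i) x = (\<Oplus>\<^bsub>K\<^esub>i\<in>I. f i x)"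
proof -
  interpret B: module K B by (rule B_module)
  show ?thesis using assms
  proof (induction I rule: finite_induct)
    case (insert i I)
    then have "(\<Oplus>\<^bsub>B\<^esub>i\<in>insert i I. f i) x = (f i \<oplus>\<^bsub>B\<^esub> (\<Oplus>\<^bsub>B\<^esub>i\<in>I. f i)) x"
      by (subst B.M.finsum_insert) auto
    also have "\<dots> = f i x \<oplus>\<^bsub>K\<^esub> (\<Oplus>\<^bsub>K\<^esub>i\<in>I. f i x)"
      using insert by (simp add: B_add_apply)
    also have "\<dots> = (\<Oplus>\<^bsub>K\<^esub>i\<in>insert i I. f i x)"
      using insert by (intro K.finsum_insert[symmetric]) (auto intro: B_apply_closed)
    finally show ?case .
  qed (simp add: B_zero_apply)
qed

lemma delta_expansion:
  assumes "f \<in> carrier B"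
  shows "(\<Oplus>\<^bsub>B\<^esub>g\<in>carrier G. f g \<odot>\<^bsub>B\<^esub> \<delta> g) = f"
proof -
  interpret B: module K B by (rule B_module)
  note c = B_apply_closed[OF assms]
  show ?thesis
  proof (rule B_eqI[OF _ assms])
    show "(\<Oplus>\<^bsub>B\<^esub>g\<in>carrier G. f g \<odot>\<^bsub>B\<^esub> \<delta> g) \<in> carrier B"
      using c by (intro B.M.finsum_closed) auto
    fix x assume x: "x \<in> carrier G"
    have "(\<Oplus>\<^bsub>B\<^esub>g\<in>carrier G. f g \<odot>\<^bsub>B\<^esub> \<delta> g) x = (\<Oplus>\<^bsub>K\<^esub>g\<in>carrier G. (f g \<odot>\<^bsub>B\<^esub> \<delta> g) x)"
      using c x finite_G by (intro B_finsum_apply) auto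
    also have "\<dots> = (f x \<odot>\<^bsub>B\<^esub> \<delta> x) x"
      using c x finite_G
      by (intro K.finsum_single[where f = "\<lambda>g. (f g \<odot>\<^bsub>B\<^esub> \<delta> g) x"]) (auto simp: B_smult_apply delta_apply)
    also have "\<dots> = f x" using c x by (simp add: B_smult_apply delta_apply)
    finally show "(\<Oplus>\<^bsub>B\<^esub>g\<in>carrier G. f g \<odot>\<^bsub>B\<^esub> \<delta> g) x = f x" .
  qed
qed

lemma delta_mult:
  assumes "g \<in> carrier G" "h \<in> carrier G"
  shows "\<delta> g \<otimes>\<^bsub>B\<^esub> \<delta> h = \<delta> (g \<otimes>\<^bsub>G\<^esub> h)"
proof (rule B_eqI)
  fix x assume x: "x \<in> carrier G"
  have "inv\<^bsub>G\<^esub> g \<otimes>\<^bsub>G\<^esub> x = h \<longleftrightarrow> x = g \<otimes>\<^bsub>G\<^esub> h"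
    using assms x by (metis G.inv_solve_left)
  then show "(\<delta> g \<otimes>\<^bsub>B\<^esub> \<delta> h) x = \<delta> (g \<otimes>\<^bsub>G\<^esub> h) x"
    using assms x by (simp add: delta_mult_apply delta_apply)
qed (auto simp: B_mult_closed)

sublocale B: fin_dim_algebra K B
proof -
  interpret B: module K B by (rule B_module)
  interpret B: vectorspace K B by unfold_locales
  interpret B: ring B by (rule B_ring)
  have fd: "B.fin_dim"
    unfolding B.fin_dim_def
  proof (intro exI[of _ "\<delta> ` carrier G"] conjI)
    have S: "\<delta> ` carrier G \<subseteq> carrier B" by auto
    have "f \<in> B.span (\<delta> ` carrier G)" if "f \<in> carrier B" for f
    proof -
      have "(\<Oplus>\<^bsub>B\<^esub>g\<in>carrier G. f g \<odot>\<^bsub>B\<^esub> \<delta> g) \<in> B.span (\<delta> ` carrier G)"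
      proof (intro B.submodule_finsum_closed B.span_is_submodule S finite_G funcsetI)
        fix g assume g: "g \<in> carrier G"
        then have "\<delta> g \<in> B.span (\<delta> ` carrier G)" using B.in_own_span[OF S] by auto
        then show "f g \<odot>\<^bsub>B\<^esub> \<delta> g \<in> B.span (\<delta> ` carrier G)"
          using B_apply_closed[OF that g] submodule.smult_closed[OF B.span_is_submodule[OF S]] by auto
      qed
      then show ?thesis using delta_expansion[OF that] by simp
    qed
    then show "B.span (\<delta> ` carrier G) = carrier B" using B.span_is_subset2[OF S] by auto
  qed (use finite_G in auto)
  show "fin_dim_algebra K B"
  proof unfold_locales
    fix a f h assume a: "a \<in> carrier K" and f: "f \<in> carrier B" and h: "h \<in> carrier B"
    note c = B_apply_closed
    show "(a \<odot>\<^bsub>B\<^esub> f) \<otimes>\<^bsub>B\<^esub> h = a \<odot>\<^bsub>B\<^esub> (f \<otimes>\<^bsub>B\<^esub> h)"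
      using a f h finite_G
      by (intro B_eqI)
        (auto simp: B_mult_apply B_smult_apply c K.finsum_rdistr K.m_assoc Pi_iff intro!: K.finsum_cong')
    show "f \<otimes>\<^bsub>B\<^esub> (a \<odot>\<^bsub>B\<^esub> h) = a \<odot>\<^bsub>B\<^esub> (f \<otimes>\<^bsub>B\<^esub> h)"
      using a f h finite_G
      by (intro B_eqI)
        (auto simp: B_mult_apply B_smult_apply c K.finsum_rdistr K.m_lcomm Pi_iff intro!: K.finsum_cong')
  qed (rule fd)
qed

end

context finite_group_algebra
begin

abbreviation lB :: "('g \<Rightarrow> 'k) \<Rightarrow> 'k" where "lB \<equiv> (\<lambda>f. f \<one>\<^bsub>G\<^esub>)"

lemma lB_linear: "linear_functional K B lB"
  by (auto simp: linear_functional_def B_add_apply B_smult_apply B_apply_closed)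

lemma lB_commute:
  assumes f: "f \<in> carrier B" and h: "h \<in> carrier B"
  shows "lB (f \<otimes>\<^bsub>B\<^esub> h) = lB (h \<otimes>\<^bsub>B\<^esub> f)"
proof -
  note c = B_apply_closed[OF f] B_apply_closed[OF h]
  have "lB (f \<otimes>\<^bsub>B\<^esub> h) = (\<Oplus>\<^bsub>K\<^esub>y\<in>carrier G. f y \<otimes>\<^bsub>K\<^esub> h (inv\<^bsub>G\<^esub> y))"
    using c by (simp add: B_mult_apply) (intro K.finsum_cong', auto)
  also have "\<dots> = (\<Oplus>\<^bsub>K\<^esub>y\<in>carrier G. f (inv\<^bsub>G\<^esub> y) \<otimes>\<^bsub>K\<^esub> h (inv\<^bsub>G\<^esub> (inv\<^bsub>G\<^esub> y)))"
    using c by (intro K.finsum_bij[OF bij_inv, symmetric]) auto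
  also have "\<dots> = lB (h \<otimes>\<^bsub>B\<^esub> f)"
    using c by (simp add: B_mult_apply) (intro K.finsum_cong', auto simp: K.m_comm)
  finally show ?thesis .
qed

lemma form_delta_inv:
  assumes "f \<in> carrier B" "g \<in> carrier G"
  shows "frob_form B lB f (\<delta> (inv\<^bsub>G\<^esub> g)) = f g"
  using assms by (simp add: frob_form_def mult_delta_apply)

sublocale B: frobenius_pair K B lB
proof
  show "linear_functional K B lB" by (rule lB_linear)
  show "frob_form B lB x y = frob_form B lB y x" if "x \<in> carrier B" "y \<in> carrier B" for x y
    using that lB_commute by (simp add: frob_form_def)
  show "x = \<zero>\<^bsub>B\<^esub>" if x: "x \<in> carrier B" and "\<And>y. y \<in> carrier B \<Longrightarrow> frob_form B lB x y = \<zero>\<^bsub>K\<^esub>" for x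
    using that form_delta_inv[OF x] by (intro B_eqI) (auto simp: B_zero_apply)
qed

lemma B_dual_families: "B.dual_families (carrier G) \<delta> (\<lambda>g. \<delta> (inv\<^bsub>G\<^esub> g))"
  unfolding B.dual_families_def
proof (intro conjI ballI)
  fix f assume f: "f \<in> carrier B"
  have "(\<Oplus>\<^bsub>B\<^esub>g\<in>carrier G. frob_form B lB f (\<delta> (inv\<^bsub>G\<^esub> g)) \<odot>\<^bsub>B\<^esub> \<delta> g) =
      (\<Oplus>\<^bsub>B\<^esub>g\<in>carrier G. f g \<odot>\<^bsub>B\<^esub> \<delta> g)"
    using f B_apply_closed[OF f] by (intro B.M.finsum_cong') (auto simp: form_delta_inv)
  then show "(\<Oplus>\<^bsub>B\<^esub>g\<in>carrier G. frob_form B lB f (\<delta> (inv\<^bsub>G\<^esub> g)) \<odot>\<^bsub>B\<^esub> \<delta> g) = f"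
    using delta_expansion[OF f] by simp
qed (auto simp: finite_G)

lemma delta_mult_inv [simp]:
  assumes "g \<in> carrier G"
  shows "\<delta> g \<otimes>\<^bsub>B\<^esub> \<delta> (inv\<^bsub>G\<^esub> g) = \<one>\<^bsub>B\<^esub>" "\<delta> (inv\<^bsub>G\<^esub> g) \<otimes>\<^bsub>B\<^esub> \<delta> g = \<one>\<^bsub>B\<^esub>"
  using assms by (simp_all add: delta_mult B_one)

section \<open>Sums over conjugates\<close>

abbreviation Z :: "('g \<Rightarrow> 'k) set" where "Z \<equiv> ring_center B"

lemma Z_closed: "z \<in> Z \<Longrightarrow> z \<in> carrier B"
  by (simp add: ring_center_def)

lemma Z_commute: "\<lbrakk>z \<in> Z; f \<in> carrier B\<rbrakk> \<Longrightarrow> z \<otimes>\<^bsub>B\<^esub> f = f \<otimes>\<^bsub>B\<^esub> z"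
  by (simp add: ring_center_def)

lemma Z_I:
  assumes z: "z \<in> carrier B" and comm: "\<And>g. g \<in> carrier G \<Longrightarrow> \<delta> g \<otimes>\<^bsub>B\<^esub> z = z \<otimes>\<^bsub>B\<^esub> \<delta> g"
  shows "z \<in> Z"
proof -
  have "z \<otimes>\<^bsub>B\<^esub> f = f \<otimes>\<^bsub>B\<^esub> z" if f: "f \<in> carrier B" for f
  proof -
    note c = B_apply_closed[OF f]
    have "z \<otimes>\<^bsub>B\<^esub> (\<Oplus>\<^bsub>B\<^esub>g\<in>carrier G. f g \<odot>\<^bsub>B\<^esub> \<delta> g) = (\<Oplus>\<^bsub>B\<^esub>g\<in>carrier G. z \<otimes>\<^bsub>B\<^esub> (f g \<odot>\<^bsub>B\<^esub> \<delta> g))"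
      using c z finite_G by (intro B.finsum_rdistr) auto
    also have "\<dots> = (\<Oplus>\<^bsub>B\<^esub>g\<in>carrier G. (f g \<odot>\<^bsub>B\<^esub> \<delta> g) \<otimes>\<^bsub>B\<^esub> z)"
      using c z comm
      by (intro B.M.finsum_cong') (auto simp: B.smult_mult_left B.smult_mult_right)
    also have "\<dots> = (\<Oplus>\<^bsub>B\<^esub>g\<in>carrier G. f g \<odot>\<^bsub>B\<^esub> \<delta> g) \<otimes>\<^bsub>B\<^esub> z"
      using c z finite_G by (intro B.finsum_ldistr[symmetric]) auto
    finally show ?thesis using delta_expansion[OF f] by simp
  qed
  then show ?thesis using z by (simp add: ring_center_def)
qed

text \<open>If \<open>|G|\<close> is invertible in \<open>K\<close>, then \<open>conj_sum / |G|\<close> is a projection onto the center.\<close>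

definition conj_sum :: "('g \<Rightarrow> 'k) \<Rightarrow> ('g \<Rightarrow> 'k)" where
  "conj_sum b = (\<Oplus>\<^bsub>B\<^esub>g\<in>carrier G. \<delta> g \<otimes>\<^bsub>B\<^esub> b \<otimes>\<^bsub>B\<^esub> \<delta> (inv\<^bsub>G\<^esub> g))"

lemma conj_sum_closed: "b \<in> carrier B \<Longrightarrow> conj_sum b \<in> carrier B"
  unfolding conj_sum_def by (intro B.M.finsum_closed) auto

text \<open>Conjugation by \<open>h\<close> permutes the summands: substitute \<open>h g\<close> for \<open>g\<close>.\<close>

lemma conj_sum_central:
  assumes b: "b \<in> carrier B"
  shows "conj_sum b \<in> Z"
proof (rule Z_I[OF conj_sum_closed[OF b]])
  fix h assume h: "h \<in> carrier G"
  have "\<delta> h \<otimes>\<^bsub>B\<^esub> conj_sum b =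
      (\<Oplus>\<^bsub>B\<^esub>g\<in>carrier G. \<delta> h \<otimes>\<^bsub>B\<^esub> (\<delta> g \<otimes>\<^bsub>B\<^esub> b \<otimes>\<^bsub>B\<^esub> \<delta> (inv\<^bsub>G\<^esub> g)))"
    unfolding conj_sum_def using b finite_G by (intro B.finsum_rdistr) auto
  also have "\<dots> = (\<Oplus>\<^bsub>B\<^esub>g\<in>carrier G. \<delta> (h \<otimes>\<^bsub>G\<^esub> g) \<otimes>\<^bsub>B\<^esub> b \<otimes>\<^bsub>B\<^esub> \<delta> (inv\<^bsub>G\<^esub> (h \<otimes>\<^bsub>G\<^esub> g)) \<otimes>\<^bsub>B\<^esub> \<delta> h)"
  proof (intro B.M.finsum_cong' refl funcsetI)
    fix g assume g: "g \<in> carrier G"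
    show "\<delta> (h \<otimes>\<^bsub>G\<^esub> g) \<otimes>\<^bsub>B\<^esub> b \<otimes>\<^bsub>B\<^esub> \<delta> (inv\<^bsub>G\<^esub> (h \<otimes>\<^bsub>G\<^esub> g)) \<otimes>\<^bsub>B\<^esub> \<delta> h \<in> carrier B" using b by auto
    have "\<delta> (inv\<^bsub>G\<^esub> g) = \<delta> (inv\<^bsub>G\<^esub> (h \<otimes>\<^bsub>G\<^esub> g)) \<otimes>\<^bsub>B\<^esub> \<delta> h"
      using g h by (simp add: delta_mult G.inv_mult_group G.m_assoc)
    moreover have "\<delta> h \<otimes>\<^bsub>B\<^esub> \<delta> g = \<delta> (h \<otimes>\<^bsub>G\<^esub> g)" using g h by (simp add: delta_mult)
    ultimately show "\<delta> h \<otimes>\<^bsub>B\<^esub> (\<delta> g \<otimes>\<^bsub>B\<^esub> b \<otimes>\<^bsub>B\<^esub> \<delta> (inv\<^bsub>G\<^esub> g)) =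
        \<delta> (h \<otimes>\<^bsub>G\<^esub> g) \<otimes>\<^bsub>B\<^esub> b \<otimes>\<^bsub>B\<^esub> \<delta> (inv\<^bsub>G\<^esub> (h \<otimes>\<^bsub>G\<^esub> g)) \<otimes>\<^bsub>B\<^esub> \<delta> h"
      using b by (simp flip: B.m_assoc)
  qed
  also have "\<dots> = (\<Oplus>\<^bsub>B\<^esub>g\<in>carrier G. \<delta> g \<otimes>\<^bsub>B\<^esub> b \<otimes>\<^bsub>B\<^esub> \<delta> (inv\<^bsub>G\<^esub> g) \<otimes>\<^bsub>B\<^esub> \<delta> h)"
    using b h
    by (intro B.M.finsum_bij[OF bij_left_mult, where f = "\<lambda>g. \<delta> g \<otimes>\<^bsub>B\<^esub> b \<otimes>\<^bsub>B\<^esub> \<delta> (inv\<^bsub>G\<^esub> g) \<otimes>\<^bsub>B\<^esub> \<delta> h"]) auto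
  also have "\<dots> = conj_sum b \<otimes>\<^bsub>B\<^esub> \<delta> h"
    unfolding conj_sum_def using b finite_G by (intro B.finsum_ldistr[symmetric]) auto
  finally show "\<delta> h \<otimes>\<^bsub>B\<^esub> conj_sum b = conj_sum b \<otimes>\<^bsub>B\<^esub> \<delta> h" .
qed

lemma conj_sum_hom: "conj_sum \<in> module_hom K B B"
  unfolding module_hom_def
proof (intro CollectI conjI allI impI; (elim conjE)?)
  show "conj_sum \<in> carrier B \<rightarrow> carrier B" using conj_sum_closed by auto
  fix a b assume a: "a \<in> carrier B" and b: "b \<in> carrier B"
  have "conj_sum (a \<oplus>\<^bsub>B\<^esub> b) = (\<Oplus>\<^bsub>B\<^esub>g\<in>carrier G.
      \<delta> g \<otimes>\<^bsub>B\<^esub> a \<otimes>\<^bsub>B\<^esub> \<delta> (inv\<^bsub>G\<^esub> g) \<oplus>\<^bsub>B\<^esub> \<delta> g \<otimes>\<^bsub>B\<^esub> b \<otimes>\<^bsub>B\<^esub> \<delta> (inv\<^bsub>G\<^esub> g))"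
    unfolding conj_sum_def using a b
    by (intro B.M.finsum_cong') (auto simp: B.l_distr B.r_distr)
  also have "\<dots> = conj_sum a \<oplus>\<^bsub>B\<^esub> conj_sum b"
    unfolding conj_sum_def using a b by (intro B.M.finsum_addf) auto
  finally show "conj_sum (a \<oplus>\<^bsub>B\<^esub> b) = conj_sum a \<oplus>\<^bsub>B\<^esub> conj_sum b" .
next
  fix r b assume r: "r \<in> carrier K" and b: "b \<in> carrier B"
  have "r \<odot>\<^bsub>B\<^esub> conj_sum b = (\<Oplus>\<^bsub>B\<^esub>g\<in>carrier G. r \<odot>\<^bsub>B\<^esub> (\<delta> g \<otimes>\<^bsub>B\<^esub> b \<otimes>\<^bsub>B\<^esub> \<delta> (inv\<^bsub>G\<^esub> g)))"
    unfolding conj_sum_def using r b by (intro B.finsum_smult) auto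
  also have "\<dots> = conj_sum (r \<odot>\<^bsub>B\<^esub> b)"
    unfolding conj_sum_def using r b
    by (intro B.M.finsum_cong') (auto simp: B.smult_mult_left B.smult_mult_right)
  finally show "conj_sum (r \<odot>\<^bsub>B\<^esub> b) = r \<odot>\<^bsub>B\<^esub> conj_sum b" ..
qed

lemmas conj_sum_add = module_hom_add[OF conj_sum_hom]
  and conj_sum_smult = module_hom_smult[OF conj_sum_hom]

lemma conj_sum_mult_central:
  assumes b: "b \<in> carrier B" and z: "z \<in> Z"
  shows "conj_sum (b \<otimes>\<^bsub>B\<^esub> z) = conj_sum b \<otimes>\<^bsub>B\<^esub> z" "conj_sum (z \<otimes>\<^bsub>B\<^esub> b) = z \<otimes>\<^bsub>B\<^esub> conj_sum b"
proof -
  note zB = Z_closed[OF z]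
  have "conj_sum b \<otimes>\<^bsub>B\<^esub> z = (\<Oplus>\<^bsub>B\<^esub>g\<in>carrier G. \<delta> g \<otimes>\<^bsub>B\<^esub> b \<otimes>\<^bsub>B\<^esub> \<delta> (inv\<^bsub>G\<^esub> g) \<otimes>\<^bsub>B\<^esub> z)"
    unfolding conj_sum_def using b zB finite_G by (intro B.finsum_ldistr) auto
  also have "\<dots> = conj_sum (b \<otimes>\<^bsub>B\<^esub> z)"
    unfolding conj_sum_def using b zB
    by (intro B.M.finsum_cong') (auto simp: B.m_assoc Z_commute[OF z])
  finally show 1: "conj_sum (b \<otimes>\<^bsub>B\<^esub> z) = conj_sum b \<otimes>\<^bsub>B\<^esub> z" ..
  show "conj_sum (z \<otimes>\<^bsub>B\<^esub> b) = z \<otimes>\<^bsub>B\<^esub> conj_sum b"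
    using 1 Z_commute[OF z] b conj_sum_closed[OF b] by simp
qed

abbreviation n :: 'k where "n \<equiv> [order G] \<cdot>\<^bsub>K\<^esub> \<one>\<^bsub>K\<^esub>"

lemma K_finsum_const:
  assumes a: "a \<in> carrier K"
  shows "(\<Oplus>\<^bsub>K\<^esub>g\<in>carrier G. a) = n \<otimes>\<^bsub>K\<^esub> a"
  using a by (simp add: K.add.finprod_const order_def K.add_pow_ldistr)

lemma B_finsum_const:
  assumes b: "b \<in> carrier B"
  shows "(\<Oplus>\<^bsub>B\<^esub>g\<in>carrier G. b) = n \<odot>\<^bsub>B\<^esub> b"
  using b B_apply_closed[OF b] finite_G
  by (intro B_eqI) (auto simp: B_finsum_apply B_smult_apply K_finsum_const)

lemma conj_sum_of_central:
  assumes z: "z \<in> Z"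
  shows "conj_sum z = n \<odot>\<^bsub>B\<^esub> z"
proof -
  note zB = Z_closed[OF z]
  have "conj_sum z = (\<Oplus>\<^bsub>B\<^esub>g\<in>carrier G. z)"
    unfolding conj_sum_def using zB
    by (intro B.M.finsum_cong') (auto simp: B.m_assoc Z_commute[OF z] simp flip: B.m_assoc[of _ _ z])
  then show ?thesis using B_finsum_const[OF zB] by simp
qed

lemma lB_conj_sum:
  assumes b: "b \<in> carrier B"
  shows "lB (conj_sum b) = n \<otimes>\<^bsub>K\<^esub> lB b"
proof -
  have "lB (conj_sum b) = (\<Oplus>\<^bsub>K\<^esub>g\<in>carrier G. lB (\<delta> g \<otimes>\<^bsub>B\<^esub> b \<otimes>\<^bsub>B\<^esub> \<delta> (inv\<^bsub>G\<^esub> g)))"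
    unfolding conj_sum_def using b finite_G by (intro B_finsum_apply) auto
  also have "\<dots> = (\<Oplus>\<^bsub>K\<^esub>g\<in>carrier G. lB b)"
  proof (intro K.finsum_cong' refl funcsetI)
    show "lB b \<in> carrier K" using B_apply_closed[OF b] by simp
    fix g assume g: "g \<in> carrier G"
    have "lB (\<delta> g \<otimes>\<^bsub>B\<^esub> b \<otimes>\<^bsub>B\<^esub> \<delta> (inv\<^bsub>G\<^esub> g)) = lB (\<delta> (inv\<^bsub>G\<^esub> g) \<otimes>\<^bsub>B\<^esub> (\<delta> g \<otimes>\<^bsub>B\<^esub> b))"
      using b by (intro lB_commute) auto
    then show "lB (\<delta> g \<otimes>\<^bsub>B\<^esub> b \<otimes>\<^bsub>B\<^esub> \<delta> (inv\<^bsub>G\<^esub> g)) = lB b"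
      using b g by (simp flip: B.m_assoc)
  qed
  finally show ?thesis using K_finsum_const B_apply_closed[OF b] by simp
qed

text \<open>The families \<open>\<delta> g\<close> and \<open>\<delta> (g\<^sup>-\<^sup>1)\<close> turn the trace into
\<open>\<Sum>g. l\<^sub>B (b' * \<delta> g * b'' * \<delta> (g\<^sup>-\<^sup>1))\<close>.\<close>

lemma trace_sandwich:
  assumes b': "b' \<in> carrier B" and b'': "b'' \<in> carrier B"
  shows "B.lin_trace (\<lambda>b. b' \<otimes>\<^bsub>B\<^esub> b \<otimes>\<^bsub>B\<^esub> b'') = lB (b' \<otimes>\<^bsub>B\<^esub> conj_sum b'')"
proof -
  have "B.lin_trace (\<lambda>b. b' \<otimes>\<^bsub>B\<^esub> b \<otimes>\<^bsub>B\<^esub> b'') =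
      (\<Oplus>\<^bsub>K\<^esub>g\<in>carrier G. frob_form B lB (b' \<otimes>\<^bsub>B\<^esub> \<delta> g \<otimes>\<^bsub>B\<^esub> b'') (\<delta> (inv\<^bsub>G\<^esub> g)))"
    using B.lin_trace_dual_families[OF B_dual_families B.sandwich_linear[OF b' b'']] .
  also have "\<dots> = (\<Oplus>\<^bsub>K\<^esub>g\<in>carrier G. lB (b' \<otimes>\<^bsub>B\<^esub> (\<delta> g \<otimes>\<^bsub>B\<^esub> b'' \<otimes>\<^bsub>B\<^esub> \<delta> (inv\<^bsub>G\<^esub> g))))"
    using b' b'' by (intro K.finsum_cong') (auto simp: frob_form_def B.m_assoc intro!: B_apply_closed)
  also have "\<dots> = lB (\<Oplus>\<^bsub>B\<^esub>g\<in>carrier G. b' \<otimes>\<^bsub>B\<^esub> (\<delta> g \<otimes>\<^bsub>B\<^esub> b'' \<otimes>\<^bsub>B\<^esub> \<delta> (inv\<^bsub>G\<^esub> g)))"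
    using b' b'' finite_G by (intro B_finsum_apply[symmetric]) auto
  also have "(\<Oplus>\<^bsub>B\<^esub>g\<in>carrier G. b' \<otimes>\<^bsub>B\<^esub> (\<delta> g \<otimes>\<^bsub>B\<^esub> b'' \<otimes>\<^bsub>B\<^esub> \<delta> (inv\<^bsub>G\<^esub> g))) = b' \<otimes>\<^bsub>B\<^esub> conj_sum b''"
    unfolding conj_sum_def using b' b'' finite_G by (intro B.finsum_rdistr[symmetric]) auto
  finally show ?thesis .
qed

section \<open>The involution and the sum of squares\<close>

abbreviation star :: "('g \<Rightarrow> 'k) \<Rightarrow> ('g \<Rightarrow> 'k)" where "star \<equiv> group_star K G"

lemma star_closed: "f \<in> carrier B \<Longrightarrow> star f \<in> carrier B"
  unfolding group_star_def by (intro B.M.finsum_closed) (auto simp: B_apply_closed)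

lemma star_apply:
  assumes f: "f \<in> carrier B" and x: "x \<in> carrier G"
  shows "star f x = f (inv\<^bsub>G\<^esub> x)"
proof -
  note c = B_apply_closed[OF f]
  have "star f x = (\<Oplus>\<^bsub>K\<^esub>g\<in>carrier G. (f g \<odot>\<^bsub>B\<^esub> \<delta> (inv\<^bsub>G\<^esub> g)) x)"
    unfolding group_star_def using c x finite_G by (intro B_finsum_apply) auto
  also have "\<dots> = (f (inv\<^bsub>G\<^esub> x) \<odot>\<^bsub>B\<^esub> \<delta> (inv\<^bsub>G\<^esub> (inv\<^bsub>G\<^esub> x))) x"
    using c x finite_G
    by (intro K.finsum_single[where f = "\<lambda>g. (f g \<odot>\<^bsub>B\<^esub> \<delta> (inv\<^bsub>G\<^esub> g)) x"])
      (auto simp: B_smult_apply delta_apply)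
  also have "\<dots> = f (inv\<^bsub>G\<^esub> x)" using c x by (simp add: B_smult_apply delta_apply)
  finally show ?thesis .
qed

lemma star_delta:
  assumes "g \<in> carrier G"
  shows "star (\<delta> g) = \<delta> (inv\<^bsub>G\<^esub> g)"
  using assms by (intro B_eqI) (auto simp: star_closed star_apply delta_apply)

lemma star_star: "f \<in> carrier B \<Longrightarrow> star (star f) = f"
  by (intro B_eqI) (auto simp: star_closed star_apply)

lemma star_hom: "star \<in> module_hom K B B"
  unfolding module_hom_def
  by (auto intro!: B_eqI simp: star_closed star_apply B_add_apply B_smult_apply)

lemma star_mult:
  assumes f: "f \<in> carrier B" and h: "h \<in> carrier B"
  shows "star (f \<otimes>\<^bsub>B\<^esub> h) = star h \<otimes>\<^bsub>B\<^esub> star f"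
proof (rule B_eqI)
  fix x assume x: "x \<in> carrier G"
  note c = B_apply_closed[OF f] B_apply_closed[OF h]
  have "star (f \<otimes>\<^bsub>B\<^esub> h) x = (\<Oplus>\<^bsub>K\<^esub>y\<in>carrier G. f y \<otimes>\<^bsub>K\<^esub> h (inv\<^bsub>G\<^esub> y \<otimes>\<^bsub>G\<^esub> inv\<^bsub>G\<^esub> x))"
    using f h x by (simp add: star_apply B_mult_apply)
  also have "\<dots> = (\<Oplus>\<^bsub>K\<^esub>y\<in>carrier G. star h (x \<otimes>\<^bsub>G\<^esub> y) \<otimes>\<^bsub>K\<^esub> star f (inv\<^bsub>G\<^esub> (x \<otimes>\<^bsub>G\<^esub> y) \<otimes>\<^bsub>G\<^esub> x))"
  proof (intro K.finsum_cong' refl funcsetI)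
    fix y assume y: "y \<in> carrier G"
    have "inv\<^bsub>G\<^esub> (inv\<^bsub>G\<^esub> (x \<otimes>\<^bsub>G\<^esub> y) \<otimes>\<^bsub>G\<^esub> x) = y"
      using x y by (simp add: G.inv_mult_group G.m_assoc flip: G.m_assoc[of "inv\<^bsub>G\<^esub> x" x])
    then show "f y \<otimes>\<^bsub>K\<^esub> h (inv\<^bsub>G\<^esub> y \<otimes>\<^bsub>G\<^esub> inv\<^bsub>G\<^esub> x) =
        star h (x \<otimes>\<^bsub>G\<^esub> y) \<otimes>\<^bsub>K\<^esub> star f (inv\<^bsub>G\<^esub> (x \<otimes>\<^bsub>G\<^esub> y) \<otimes>\<^bsub>G\<^esub> x)"
      using x y f h c by (simp add: star_apply G.inv_mult_group K.m_comm)
    show "star h (x \<otimes>\<^bsub>G\<^esub> y) \<otimes>\<^bsub>K\<^esub> star f (inv\<^bsub>G\<^esub> (x \<otimes>\<^bsub>G\<^esub> y) \<otimes>\<^bsub>G\<^esub> x) \<in> carrier K"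
      using x y B_apply_closed[OF star_closed[OF f]] B_apply_closed[OF star_closed[OF h]] by auto
  qed
  also have "\<dots> = (\<Oplus>\<^bsub>K\<^esub>y\<in>carrier G. star h y \<otimes>\<^bsub>K\<^esub> star f (inv\<^bsub>G\<^esub> y \<otimes>\<^bsub>G\<^esub> x))"
    using x B_apply_closed[OF star_closed[OF f]] B_apply_closed[OF star_closed[OF h]]
    by (intro K.finsum_bij[OF bij_left_mult, where f = "\<lambda>y. star h y \<otimes>\<^bsub>K\<^esub> star f (inv\<^bsub>G\<^esub> y \<otimes>\<^bsub>G\<^esub> x)"]) auto
  finally show "star (f \<otimes>\<^bsub>B\<^esub> h) x = (star h \<otimes>\<^bsub>B\<^esub> star f) x"
    using x by (simp add: B_mult_apply)
qed (use f h star_closed in auto)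

lemma star_one: "star \<one>\<^bsub>B\<^esub> = \<one>\<^bsub>B\<^esub>"
  using star_delta[of "\<one>\<^bsub>G\<^esub>"] by (simp add: B_one)

lemma star_central:
  assumes z: "z \<in> Z"
  shows "star z \<in> Z"
proof -
  note zB = Z_closed[OF z]
  have "star z \<otimes>\<^bsub>B\<^esub> f = f \<otimes>\<^bsub>B\<^esub> star z" if f: "f \<in> carrier B" for f
  proof -
    have "star z \<otimes>\<^bsub>B\<^esub> f = star (star f \<otimes>\<^bsub>B\<^esub> z)"
      using zB f by (simp add: star_mult star_closed star_star)
    also have "\<dots> = star (z \<otimes>\<^bsub>B\<^esub> star f)"
      using Z_commute[OF z star_closed[OF f]] by simp
    also have "\<dots> = f \<otimes>\<^bsub>B\<^esub> star z"
      using zB f by (simp add: star_mult star_closed star_star)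
    finally show ?thesis .
  qed
  then show ?thesis using star_closed[OF zB] by (simp add: ring_center_def)
qed

lemma star_conj_sum:
  assumes b: "b \<in> carrier B"
  shows "star (conj_sum b) = conj_sum (star b)"
proof -
  have "star (conj_sum b) = (\<Oplus>\<^bsub>B\<^esub>g\<in>carrier G. star (\<delta> g \<otimes>\<^bsub>B\<^esub> b \<otimes>\<^bsub>B\<^esub> \<delta> (inv\<^bsub>G\<^esub> g)))"
    unfolding conj_sum_def using b finite_G B_module
    by (intro B.module_hom_finsum[OF star_hom]) auto
  also have "\<dots> = conj_sum (star b)"
    unfolding conj_sum_def using b star_closed[OF b]
    by (intro B.M.finsum_cong') (auto simp: star_mult star_delta B.m_assoc)
  finally show ?thesis .
qed

abbreviation U :: "'g \<Rightarrow> 'k" where "U \<equiv> sum_of_squares K G"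

lemma U_closed: "U \<in> carrier B"
  unfolding sum_of_squares_def by (intro B.M.finsum_closed) auto

lemma U_central: "U \<in> Z"
proof (rule Z_I[OF U_closed])
  fix h assume h: "h \<in> carrier G"
  let ?c = "\<lambda>g. h \<otimes>\<^bsub>G\<^esub> (g \<otimes>\<^bsub>G\<^esub> inv\<^bsub>G\<^esub> h)"
  have bij: "bij_betw ?c (carrier G) (carrier G)"
    using bij_betw_trans[OF bij_right_mult[of "inv\<^bsub>G\<^esub> h"] bij_left_mult[of h]] h
    by (simp add: comp_def)
  have "\<delta> h \<otimes>\<^bsub>B\<^esub> U = (\<Oplus>\<^bsub>B\<^esub>g\<in>carrier G. \<delta> h \<otimes>\<^bsub>B\<^esub> \<delta> (g \<otimes>\<^bsub>G\<^esub> g))"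
    unfolding sum_of_squares_def using finite_G by (intro B.finsum_rdistr) auto
  also have "\<dots> = (\<Oplus>\<^bsub>B\<^esub>g\<in>carrier G. \<delta> (?c g \<otimes>\<^bsub>G\<^esub> ?c g) \<otimes>\<^bsub>B\<^esub> \<delta> h)"
    using h by (intro B.M.finsum_cong')
      (auto simp: delta_mult G.m_assoc simp flip: G.m_assoc[of "inv\<^bsub>G\<^esub> h" h])
  also have "\<dots> = (\<Oplus>\<^bsub>B\<^esub>g\<in>carrier G. \<delta> (g \<otimes>\<^bsub>G\<^esub> g) \<otimes>\<^bsub>B\<^esub> \<delta> h)"
    by (intro B.M.finsum_bij[OF bij, where f = "\<lambda>g. \<delta> (g \<otimes>\<^bsub>G\<^esub> g) \<otimes>\<^bsub>B\<^esub> \<delta> h"]) auto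
  also have "\<dots> = U \<otimes>\<^bsub>B\<^esub> \<delta> h"
    unfolding sum_of_squares_def using finite_G by (intro B.finsum_ldistr[symmetric]) auto
  finally show "\<delta> h \<otimes>\<^bsub>B\<^esub> U = U \<otimes>\<^bsub>B\<^esub> \<delta> h" .
qed

lemma K_star_B: "B.K_star star = U"
  unfolding B.K_star_dual_families[OF B_dual_families star_hom] sum_of_squares_def
  by (intro B.M.finsum_cong') (auto simp: star_delta delta_mult)

text \<open>The left side is the sum of \<open>\<delta> (g h g h\<^sup>-\<^sup>1)\<close> over all \<open>g\<close> and \<open>h\<close>. Since
\<open>g h g h\<^sup>-\<^sup>1 = (g h)\<^sup>2 (h\<^sup>-\<^sup>1)\<^sup>2\<close>, and \<open>g h\<close> and \<open>h\<^sup>-\<^sup>1\<close> run independently over \<open>G\<close>, it factors.\<close>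

lemma sum_delta_conj_sum_delta:
  "(\<Oplus>\<^bsub>B\<^esub>g\<in>carrier G. \<delta> g \<otimes>\<^bsub>B\<^esub> conj_sum (\<delta> g)) = U \<otimes>\<^bsub>B\<^esub> U"
proof -
  have "(\<Oplus>\<^bsub>B\<^esub>g\<in>carrier G. \<delta> g \<otimes>\<^bsub>B\<^esub> conj_sum (\<delta> g)) =
      (\<Oplus>\<^bsub>B\<^esub>g\<in>carrier G. \<Oplus>\<^bsub>B\<^esub>h\<in>carrier G. \<delta> ((g \<otimes>\<^bsub>G\<^esub> h) \<otimes>\<^bsub>G\<^esub> (g \<otimes>\<^bsub>G\<^esub> h)) \<otimes>\<^bsub>B\<^esub> \<delta> (inv\<^bsub>G\<^esub> h \<otimes>\<^bsub>G\<^esub> inv\<^bsub>G\<^esub> h))"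
  proof (intro B.M.finsum_cong' refl funcsetI)
    fix g assume g: "g \<in> carrier G"
    show "(\<Oplus>\<^bsub>B\<^esub>h\<in>carrier G. \<delta> ((g \<otimes>\<^bsub>G\<^esub> h) \<otimes>\<^bsub>G\<^esub> (g \<otimes>\<^bsub>G\<^esub> h)) \<otimes>\<^bsub>B\<^esub> \<delta> (inv\<^bsub>G\<^esub> h \<otimes>\<^bsub>G\<^esub> inv\<^bsub>G\<^esub> h)) \<in> carrier B"
      by (intro B.M.finsum_closed) auto
    have "\<delta> g \<otimes>\<^bsub>B\<^esub> conj_sum (\<delta> g) =
        (\<Oplus>\<^bsub>B\<^esub>h\<in>carrier G. \<delta> g \<otimes>\<^bsub>B\<^esub> (\<delta> h \<otimes>\<^bsub>B\<^esub> \<delta> g \<otimes>\<^bsub>B\<^esub> \<delta> (inv\<^bsub>G\<^esub> h)))"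
      unfolding conj_sum_def using finite_G by (intro B.finsum_rdistr) auto
    also have "\<dots> = (\<Oplus>\<^bsub>B\<^esub>h\<in>carrier G. \<delta> ((g \<otimes>\<^bsub>G\<^esub> h) \<otimes>\<^bsub>G\<^esub> (g \<otimes>\<^bsub>G\<^esub> h)) \<otimes>\<^bsub>B\<^esub> \<delta> (inv\<^bsub>G\<^esub> h \<otimes>\<^bsub>G\<^esub> inv\<^bsub>G\<^esub> h))"
    proof (intro B.M.finsum_cong' refl funcsetI)
      fix h assume h: "h \<in> carrier G"
      have "h \<otimes>\<^bsub>G\<^esub> (inv\<^bsub>G\<^esub> h \<otimes>\<^bsub>G\<^esub> inv\<^bsub>G\<^esub> h) = inv\<^bsub>G\<^esub> h" using h by (simp flip: G.m_assoc)
      then show "\<delta> g \<otimes>\<^bsub>B\<^esub> (\<delta> h \<otimes>\<^bsub>B\<^esub> \<delta> g \<otimes>\<^bsub>B\<^esub> \<delta> (inv\<^bsub>G\<^esub> h)) =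
          \<delta> ((g \<otimes>\<^bsub>G\<^esub> h) \<otimes>\<^bsub>G\<^esub> (g \<otimes>\<^bsub>G\<^esub> h)) \<otimes>\<^bsub>B\<^esub> \<delta> (inv\<^bsub>G\<^esub> h \<otimes>\<^bsub>G\<^esub> inv\<^bsub>G\<^esub> h)"
        using g h by (simp add: delta_mult G.m_assoc)
    qed auto
    finally show "\<delta> g \<otimes>\<^bsub>B\<^esub> conj_sum (\<delta> g) =
      (\<Oplus>\<^bsub>B\<^esub>h\<in>carrier G. \<delta> ((g \<otimes>\<^bsub>G\<^esub> h) \<otimes>\<^bsub>G\<^esub> (g \<otimes>\<^bsub>G\<^esub> h)) \<otimes>\<^bsub>B\<^esub> \<delta> (inv\<^bsub>G\<^esub> h \<otimes>\<^bsub>G\<^esub> inv\<^bsub>G\<^esub> h))" .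
  qed
  also have "\<dots> = (\<Oplus>\<^bsub>B\<^esub>h\<in>carrier G. \<Oplus>\<^bsub>B\<^esub>g\<in>carrier G.
      \<delta> ((g \<otimes>\<^bsub>G\<^esub> h) \<otimes>\<^bsub>G\<^esub> (g \<otimes>\<^bsub>G\<^esub> h)) \<otimes>\<^bsub>B\<^esub> \<delta> (inv\<^bsub>G\<^esub> h \<otimes>\<^bsub>G\<^esub> inv\<^bsub>G\<^esub> h))"
    using finite_G by (intro B.M.finsum_swap) auto
  also have "\<dots> = (\<Oplus>\<^bsub>B\<^esub>h\<in>carrier G. U \<otimes>\<^bsub>B\<^esub> \<delta> (inv\<^bsub>G\<^esub> h \<otimes>\<^bsub>G\<^esub> inv\<^bsub>G\<^esub> h))"
  proof (intro B.M.finsum_cong' refl funcsetI)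
    fix h assume h: "h \<in> carrier G"
    let ?d = "\<delta> (inv\<^bsub>G\<^esub> h \<otimes>\<^bsub>G\<^esub> inv\<^bsub>G\<^esub> h)"
    show "U \<otimes>\<^bsub>B\<^esub> ?d \<in> carrier B" using U_closed by auto
    have "(\<Oplus>\<^bsub>B\<^esub>g\<in>carrier G. \<delta> ((g \<otimes>\<^bsub>G\<^esub> h) \<otimes>\<^bsub>G\<^esub> (g \<otimes>\<^bsub>G\<^esub> h)) \<otimes>\<^bsub>B\<^esub> ?d) =
        (\<Oplus>\<^bsub>B\<^esub>g\<in>carrier G. \<delta> (g \<otimes>\<^bsub>G\<^esub> g) \<otimes>\<^bsub>B\<^esub> ?d)"
      using h by (intro B.M.finsum_bij[OF bij_right_mult, where f = "\<lambda>g. \<delta> (g \<otimes>\<^bsub>G\<^esub> g) \<otimes>\<^bsub>B\<^esub> ?d"]) auto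
    also have "\<dots> = U \<otimes>\<^bsub>B\<^esub> ?d"
      unfolding sum_of_squares_def using finite_G by (intro B.finsum_ldistr[symmetric]) auto
    finally show "(\<Oplus>\<^bsub>B\<^esub>g\<in>carrier G. \<delta> ((g \<otimes>\<^bsub>G\<^esub> h) \<otimes>\<^bsub>G\<^esub> (g \<otimes>\<^bsub>G\<^esub> h)) \<otimes>\<^bsub>B\<^esub> ?d) = U \<otimes>\<^bsub>B\<^esub> ?d" .
  qed
  also have "\<dots> = (\<Oplus>\<^bsub>B\<^esub>h\<in>carrier G. U \<otimes>\<^bsub>B\<^esub> \<delta> (h \<otimes>\<^bsub>G\<^esub> h))"
    using U_closed by (intro B.M.finsum_bij[OF bij_inv, where f = "\<lambda>h. U \<otimes>\<^bsub>B\<^esub> \<delta> (h \<otimes>\<^bsub>G\<^esub> h)"]) auto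
  also have "\<dots> = U \<otimes>\<^bsub>B\<^esub> (\<Oplus>\<^bsub>B\<^esub>h\<in>carrier G. \<delta> (h \<otimes>\<^bsub>G\<^esub> h))"
    using U_closed finite_G by (intro B.finsum_rdistr[symmetric]) auto
  finally show ?thesis by (simp add: sum_of_squares_def)
qed

section \<open>The center as a Frobenius pair\<close>

abbreviation A :: "('k, 'g \<Rightarrow> 'k) module" where "A \<equiv> center_algebra B"

lemma A_simps: "carrier A = Z" "mult A = mult B" "one A = one B" "zero A = zero B" "add A = add B"
  "smult A = smult B"
  by (simp_all add: center_algebra_def)

lemma A_fin_dim_algebra: "fin_dim_algebra K A"
  unfolding center_algebra_def by (rule B.center_fin_dim_algebra)

lemma A_finsum:
  assumes "finite I" "f \<in> I \<rightarrow> Z"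
  shows "finsum A f I = finsum B f I"
  unfolding center_algebra_def using assms by (intro B.finsum_submodule B.center_submodule)

end

locale semisimple_group_algebra = finite_group_algebra G K
  for G :: "('g, 'z) monoid_scheme" and K :: "('k, 'x) ring_scheme" +
  assumes n_nonzero: "n \<noteq> \<zero>\<^bsub>K\<^esub>"
begin

abbreviation inv_n :: 'k where "inv_n \<equiv> inv\<^bsub>K\<^esub> n"

lemma n_inverse: "n \<in> carrier K" "inv_n \<in> carrier K" "n \<otimes>\<^bsub>K\<^esub> inv_n = \<one>\<^bsub>K\<^esub>" "inv_n \<otimes>\<^bsub>K\<^esub> n = \<one>\<^bsub>K\<^esub>"
proof -
  show n: "n \<in> carrier K" by simp
  then have "n \<in> Units K" using n_nonzero by (simp add: K.field_Units)
  then show "inv_n \<in> carrier K" "n \<otimes>\<^bsub>K\<^esub> inv_n = \<one>\<^bsub>K\<^esub>" "inv_n \<otimes>\<^bsub>K\<^esub> n = \<one>\<^bsub>K\<^esub>" by simp_all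
qed

lemma inv_n_smult_n:
  assumes "b \<in> carrier B"
  shows "inv_n \<odot>\<^bsub>B\<^esub> (n \<odot>\<^bsub>B\<^esub> b) = b"
  using assms n_inverse by (simp flip: B.smult_assoc1)

abbreviation lA :: "('g \<Rightarrow> 'k) \<Rightarrow> 'k" where "lA \<equiv> (\<lambda>f. f \<one>\<^bsub>G\<^esub> \<otimes>\<^bsub>K\<^esub> inv_n)"

text \<open>The factor \<open>n\<close> by which \<open>conj_sum\<close> changes \<open>l\<^sub>B\<close> cancels against the factor \<open>1/n\<close> in \<open>l\<^sub>A\<close>. Thus
\<open>conj_sum\<close> is adjoint to the inclusion of the center.\<close>

lemma form_A_conj_sum:
  assumes z: "z \<in> Z" and b: "b \<in> carrier B"
  shows "frob_form A lA z (conj_sum b) = frob_form B lB z b"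
proof -
  have zb: "z \<otimes>\<^bsub>B\<^esub> b \<in> carrier B" using Z_closed[OF z] b by simp
  have l: "lB (z \<otimes>\<^bsub>B\<^esub> b) \<in> carrier K" using B_apply_closed[OF zb] by simp
  have "frob_form A lA z (conj_sum b) = lB (conj_sum (z \<otimes>\<^bsub>B\<^esub> b)) \<otimes>\<^bsub>K\<^esub> inv_n"
    using conj_sum_mult_central(2)[OF b z] by (simp add: frob_form_def A_simps)
  also have "\<dots> = lB (z \<otimes>\<^bsub>B\<^esub> b) \<otimes>\<^bsub>K\<^esub> (n \<otimes>\<^bsub>K\<^esub> inv_n)"
    using l n_inverse(1,2) by (simp add: lB_conj_sum[OF zb] K.m_ac)
  also have "\<dots> = frob_form B lB z b" using l n_inverse(3) by (simp add: frob_form_def)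
  finally show ?thesis .
qed

sublocale A: frobenius_pair K A lA
proof (intro frobenius_pair.intro frobenius_pair_axioms.intro A_fin_dim_algebra)
  show "linear_functional K A lA"
    using n_inverse(2)
    by (auto simp: linear_functional_def A_simps Z_closed B_add_apply B_smult_apply B_apply_closed
        K.l_distr K.m_assoc)
  show "frob_form A lA x y = frob_form A lA y x" if "x \<in> carrier A" "y \<in> carrier A" for x y
    using that Z_commute[of x y] Z_closed[of y] by (simp add: frob_form_def A_simps)
  show "x = \<zero>\<^bsub>A\<^esub>" if x: "x \<in> carrier A" and 0: "\<And>y. y \<in> carrier A \<Longrightarrow> frob_form A lA x y = \<zero>\<^bsub>K\<^esub>" for x
  proof -
    have "frob_form B lB x b = \<zero>\<^bsub>K\<^esub>" if "b \<in> carrier B" for b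
      using 0[of "conj_sum b"] form_A_conj_sum[of x b] x that conj_sum_central by (simp add: A_simps)
    then show ?thesis using B.form_nondegenerate[of x] x Z_closed by (simp add: A_simps)
  qed
qed

text \<open>Apply \<open>conj_sum / n\<close>, which fixes a central \<open>z\<close>, to the expansion of \<open>z\<close> in the \<open>\<delta> g\<close>; by adjointness
the coefficient \<open>z g\<close> is the pairing of \<open>z\<close> with \<open>conj_sum (\<delta> (g\<^sup>-\<^sup>1))\<close>.\<close>

lemma A_dual_families:
  "A.dual_families (carrier G) (\<lambda>g. inv_n \<odot>\<^bsub>B\<^esub> conj_sum (\<delta> g)) (\<lambda>g. conj_sum (\<delta> (inv\<^bsub>G\<^esub> g)))"
  unfolding A.dual_families_def
proof (intro conjI ballI)
  have u: "inv_n \<odot>\<^bsub>B\<^esub> conj_sum (\<delta> g) \<in> Z" for g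
    using A.smult_closed[of inv_n "conj_sum (\<delta> g)"] n_inverse(2) conj_sum_central by (simp add: A_simps)
  show "(\<lambda>g. inv_n \<odot>\<^bsub>B\<^esub> conj_sum (\<delta> g)) \<in> carrier G \<rightarrow> carrier A"
    using u by (simp add: A_simps)
  show "(\<lambda>g. conj_sum (\<delta> (inv\<^bsub>G\<^esub> g))) \<in> carrier G \<rightarrow> carrier A"
    using conj_sum_central by (simp add: A_simps)
  fix z assume "z \<in> carrier A"
  then have z: "z \<in> Z" by (simp add: A_simps)
  note zB = Z_closed[OF z]
  note c = B_apply_closed[OF zB]
  have "(\<Oplus>\<^bsub>A\<^esub>g\<in>carrier G. frob_form A lA z (conj_sum (\<delta> (inv\<^bsub>G\<^esub> g))) \<odot>\<^bsub>A\<^esub> (inv_n \<odot>\<^bsub>B\<^esub> conj_sum (\<delta> g))) =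
      (\<Oplus>\<^bsub>A\<^esub>g\<in>carrier G. z g \<odot>\<^bsub>B\<^esub> (inv_n \<odot>\<^bsub>B\<^esub> conj_sum (\<delta> g)))"
    using c u A.smult_closed
    by (intro A.M.finsum_cong') (auto simp: form_A_conj_sum[OF z] form_delta_inv[OF zB] A_simps)
  also have "\<dots> = (\<Oplus>\<^bsub>B\<^esub>g\<in>carrier G. z g \<odot>\<^bsub>B\<^esub> (inv_n \<odot>\<^bsub>B\<^esub> conj_sum (\<delta> g)))"
    using c u A.smult_closed finite_G by (intro A_finsum) (auto simp: A_simps)
  also have "\<dots> = (\<Oplus>\<^bsub>B\<^esub>g\<in>carrier G. inv_n \<odot>\<^bsub>B\<^esub> (z g \<odot>\<^bsub>B\<^esub> conj_sum (\<delta> g)))"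
    using c n_inverse(2) conj_sum_closed
    by (intro B.M.finsum_cong') (auto simp: K.m_comm simp flip: B.smult_assoc1)
  also have "\<dots> = inv_n \<odot>\<^bsub>B\<^esub> (\<Oplus>\<^bsub>B\<^esub>g\<in>carrier G. z g \<odot>\<^bsub>B\<^esub> conj_sum (\<delta> g))"
    using c n_inverse(2) conj_sum_closed by (intro B.finsum_smult[symmetric]) auto
  also have "(\<Oplus>\<^bsub>B\<^esub>g\<in>carrier G. z g \<odot>\<^bsub>B\<^esub> conj_sum (\<delta> g)) = conj_sum (\<Oplus>\<^bsub>B\<^esub>g\<in>carrier G. z g \<odot>\<^bsub>B\<^esub> \<delta> g)"
    using c finite_G B_module by (intro B.module_hom_lincomb[OF conj_sum_hom, symmetric]) auto
  also have "inv_n \<odot>\<^bsub>B\<^esub> \<dots> = z"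
    using delta_expansion[OF zB] conj_sum_of_central[OF z] inv_n_smult_n[OF zB] by simp
  finally show "(\<Oplus>\<^bsub>A\<^esub>g\<in>carrier G.
      frob_form A lA z (conj_sum (\<delta> (inv\<^bsub>G\<^esub> g))) \<odot>\<^bsub>A\<^esub> (inv_n \<odot>\<^bsub>B\<^esub> conj_sum (\<delta> g))) = z" .
qed (rule finite_G)

abbreviation \<phi> :: "('g \<Rightarrow> 'k) \<Rightarrow> ('g \<Rightarrow> 'k)" where "\<phi> \<equiv> (\<lambda>f\<in>carrier A. f)"

lemma dual_map_eq_conj_sum:
  assumes b: "b \<in> carrier B"
  shows "dual_map A lA B lB \<phi> b = conj_sum b"
  unfolding dual_map_def
proof (rule the_equality)
  have cs: "conj_sum b \<in> carrier A" using conj_sum_central[OF b] by (simp add: A_simps)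
  have "frob_form A lA (conj_sum b) x = frob_form B lB b (\<phi> x)" if x: "x \<in> carrier A" for x
    using A.form_sym[OF cs x] form_A_conj_sum[of x b] B.form_sym[of x b] Z_closed[of x] b x
    by (simp add: A_simps)
  then show *: "conj_sum b \<in> carrier A \<and>
      (\<forall>x\<in>carrier A. frob_form A lA (conj_sum b) x = frob_form B lB b (\<phi> x))"
    using cs by blast
  fix a assume "a \<in> carrier A \<and> (\<forall>x\<in>carrier A. frob_form A lA a x = frob_form B lB b (\<phi> x))"
  then show "a = conj_sum b" using * by (intro A.form_eqI) auto
qed

lemma cardy:
  assumes b': "b' \<in> carrier B" and b'': "b'' \<in> carrier B"
  shows "frob_form A lA (dual_map A lA B lB \<phi> b') (dual_map A lA B lB \<phi> b'') =
    B.lin_trace (\<lambda>b. b' \<otimes>\<^bsub>B\<^esub> b \<otimes>\<^bsub>B\<^esub> b'')"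
proof -
  have "frob_form A lA (conj_sum b') (conj_sum b'') = frob_form A lA (conj_sum b'') (conj_sum b')"
    using conj_sum_central b' b'' by (intro A.form_sym) (auto simp: A_simps)
  also have "\<dots> = frob_form B lB b' (conj_sum b'')"
    using form_A_conj_sum[OF conj_sum_central[OF b''] b'] B.form_sym b' conj_sum_closed[OF b''] by simp
  finally show ?thesis
    using b' b'' by (simp add: dual_map_eq_conj_sum trace_sandwich frob_form_def)
qed

abbreviation starA :: "('g \<Rightarrow> 'k) \<Rightarrow> ('g \<Rightarrow> 'k)" where "starA \<equiv> restrict star (carrier A)"

lemma starA_hom: "starA \<in> module_hom K A A"
  using star_hom star_central Z_closed A.smult_closed A.M.a_closed
  by (auto simp: module_hom_def A_simps)

text \<open>The dual families give \<open>K\<^sub>A\<^sup>* = (\<Sum>g. conj_sum (\<delta> g)\<^sup>2) / n\<close>. Pulling the central factor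
\<open>conj_sum (\<delta> g)\<close> into the other one makes this \<open>conj_sum (U\<^sup>2) / n\<close>, and \<open>U\<^sup>2\<close> is central.\<close>

lemma K_star_A: "A.K_star starA = U \<otimes>\<^bsub>B\<^esub> U"
proof -
  have u: "inv_n \<odot>\<^bsub>B\<^esub> conj_sum (\<delta> g) \<in> Z" for g
    using A.smult_closed[of inv_n "conj_sum (\<delta> g)"] n_inverse(2) conj_sum_central by (simp add: A_simps)
  have cs: "conj_sum (\<delta> g) \<in> carrier B" for g by (simp add: conj_sum_closed)
  have "A.K_star starA =
      (\<Oplus>\<^bsub>A\<^esub>g\<in>carrier G. (inv_n \<odot>\<^bsub>B\<^esub> conj_sum (\<delta> g)) \<otimes>\<^bsub>A\<^esub> starA (conj_sum (\<delta> (inv\<^bsub>G\<^esub> g))))"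
    by (rule A.K_star_dual_families[OF A_dual_families starA_hom])
  also have "\<dots> = (\<Oplus>\<^bsub>A\<^esub>g\<in>carrier G. (inv_n \<odot>\<^bsub>B\<^esub> conj_sum (\<delta> g)) \<otimes>\<^bsub>A\<^esub> conj_sum (\<delta> g))"
    using u conj_sum_central A.m_closed
    by (intro A.M.finsum_cong') (auto simp: star_conj_sum star_delta A_simps)
  also have "\<dots> = (\<Oplus>\<^bsub>B\<^esub>g\<in>carrier G. (inv_n \<odot>\<^bsub>B\<^esub> conj_sum (\<delta> g)) \<otimes>\<^bsub>A\<^esub> conj_sum (\<delta> g))"
    using u conj_sum_central A.m_closed finite_G by (intro A_finsum) (auto simp: A_simps)
  also have "\<dots> = (\<Oplus>\<^bsub>B\<^esub>g\<in>carrier G. inv_n \<odot>\<^bsub>B\<^esub> conj_sum (\<delta> g \<otimes>\<^bsub>B\<^esub> conj_sum (\<delta> g)))"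
    using cs n_inverse(2) conj_sum_central conj_sum_closed
    by (intro B.M.finsum_cong') (auto simp: conj_sum_mult_central B.smult_mult_left A_simps)
  also have "\<dots> = inv_n \<odot>\<^bsub>B\<^esub> (\<Oplus>\<^bsub>B\<^esub>g\<in>carrier G. conj_sum (\<delta> g \<otimes>\<^bsub>B\<^esub> conj_sum (\<delta> g)))"
    using cs n_inverse(2) conj_sum_closed by (intro B.finsum_smult[symmetric]) auto
  also have "(\<Oplus>\<^bsub>B\<^esub>g\<in>carrier G. conj_sum (\<delta> g \<otimes>\<^bsub>B\<^esub> conj_sum (\<delta> g))) =
      conj_sum (\<Oplus>\<^bsub>B\<^esub>g\<in>carrier G. \<delta> g \<otimes>\<^bsub>B\<^esub> conj_sum (\<delta> g))"
    using cs finite_G B_module by (intro B.module_hom_finsum[OF conj_sum_hom, symmetric]) auto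
  also have "\<dots> = conj_sum (U \<otimes>\<^bsub>B\<^esub> U)" by (simp add: sum_delta_conj_sum_delta)
  also have "\<dots> = n \<odot>\<^bsub>B\<^esub> (U \<otimes>\<^bsub>B\<^esub> U)"
    using A.m_closed[of U U] U_central by (intro conj_sum_of_central) (simp add: A_simps)
  also have "inv_n \<odot>\<^bsub>B\<^esub> \<dots> = U \<otimes>\<^bsub>B\<^esub> U" using U_closed by (simp add: inv_n_smult_n)
  finally show ?thesis .
qed

section \<open>Semi-simplicity of the group algebra and of its center\<close>

text \<open>Average a linear projection \<open>p\<close> onto \<open>I\<close> over \<open>G\<close>. The average \<open>q\<close> is a left \<open>B\<close>-linear projection onto
\<open>I\<close>, hence right multiplication by \<open>q 1\<close>.\<close>

lemma maschke:
  assumes I: "left_ideal I B"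
  obtains e where "e \<in> I" "\<And>x. x \<in> I \<Longrightarrow> x \<otimes>\<^bsub>B\<^esub> e = x"
proof -
  note sub = B.left_ideal_submodule[OF I]
  have IB: "x \<in> carrier B" if "x \<in> I" for x using B.left_ideal_subset[OF I] that by auto
  have mult: "b \<otimes>\<^bsub>B\<^esub> x \<in> I" if "b \<in> carrier B" "x \<in> I" for b x
    using I that by (simp add: left_ideal_def)
  obtain p where p: "p \<in> module_hom K B B" and pI: "\<And>b. b \<in> carrier B \<Longrightarrow> p b \<in> I"
    and p_id: "\<And>x. x \<in> I \<Longrightarrow> p x = x"
    by (rule B.linear_projection_onto_submodule[OF B.fin_dim sub]) (rule that)
  have pB: "p b \<in> carrier B" if "b \<in> carrier B" for b using IB[OF pI[OF that]] .
  define q where "q b = inv_n \<odot>\<^bsub>B\<^esub> (\<Oplus>\<^bsub>B\<^esub>g\<in>carrier G. \<delta> g \<otimes>\<^bsub>B\<^esub> p (\<delta> (inv\<^bsub>G\<^esub> g) \<otimes>\<^bsub>B\<^esub> b))" for b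
  have s: "(\<Oplus>\<^bsub>B\<^esub>g\<in>carrier G. \<delta> g \<otimes>\<^bsub>B\<^esub> p (\<delta> (inv\<^bsub>G\<^esub> g) \<otimes>\<^bsub>B\<^esub> b)) \<in> I" if "b \<in> carrier B" for b
    using that finite_G pI mult by (intro B.submodule_finsum_closed[OF sub]) auto
  have qI: "q b \<in> I" if "b \<in> carrier B" for b
    unfolding q_def using s[OF that] n_inverse(2) by (rule submodule.smult_closed[OF sub, rotated])
  have q_id: "q x = x" if x: "x \<in> I" for x
  proof -
    have "(\<Oplus>\<^bsub>B\<^esub>g\<in>carrier G. \<delta> g \<otimes>\<^bsub>B\<^esub> p (\<delta> (inv\<^bsub>G\<^esub> g) \<otimes>\<^bsub>B\<^esub> x)) = (\<Oplus>\<^bsub>B\<^esub>g\<in>carrier G. x)"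
      using IB[OF x] mult x by (intro B.M.finsum_cong') (auto simp: p_id simp flip: B.m_assoc)
    then show ?thesis
      using IB[OF x] by (simp add: q_def B_finsum_const inv_n_smult_n)
  qed
  have q_delta: "\<delta> h \<otimes>\<^bsub>B\<^esub> q \<one>\<^bsub>B\<^esub> = q (\<delta> h)" if h: "h \<in> carrier G" for h
  proof -
    have "\<delta> h \<otimes>\<^bsub>B\<^esub> (\<Oplus>\<^bsub>B\<^esub>g\<in>carrier G. \<delta> g \<otimes>\<^bsub>B\<^esub> p (\<delta> (inv\<^bsub>G\<^esub> g) \<otimes>\<^bsub>B\<^esub> \<one>\<^bsub>B\<^esub>)) =
        (\<Oplus>\<^bsub>B\<^esub>g\<in>carrier G. \<delta> h \<otimes>\<^bsub>B\<^esub> (\<delta> g \<otimes>\<^bsub>B\<^esub> p (\<delta> (inv\<^bsub>G\<^esub> g) \<otimes>\<^bsub>B\<^esub> \<one>\<^bsub>B\<^esub>)))"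
      using finite_G pB by (intro B.finsum_rdistr) auto
    also have "\<dots> = (\<Oplus>\<^bsub>B\<^esub>g\<in>carrier G. \<delta> (h \<otimes>\<^bsub>G\<^esub> g) \<otimes>\<^bsub>B\<^esub> p (\<delta> (inv\<^bsub>G\<^esub> (h \<otimes>\<^bsub>G\<^esub> g)) \<otimes>\<^bsub>B\<^esub> \<delta> h))"
      using h pB
      by (intro B.M.finsum_cong') (auto simp: delta_mult G.inv_mult_group G.m_assoc simp flip: B.m_assoc)
    also have "\<dots> = (\<Oplus>\<^bsub>B\<^esub>g\<in>carrier G. \<delta> g \<otimes>\<^bsub>B\<^esub> p (\<delta> (inv\<^bsub>G\<^esub> g) \<otimes>\<^bsub>B\<^esub> \<delta> h))"
      using h pB
      by (intro B.M.finsum_bij[OF bij_left_mult, where f = "\<lambda>g. \<delta> g \<otimes>\<^bsub>B\<^esub> p (\<delta> (inv\<^bsub>G\<^esub> g) \<otimes>\<^bsub>B\<^esub> \<delta> h)"]) auto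
    finally show ?thesis
      using n_inverse(2) IB[OF s[of "\<one>\<^bsub>B\<^esub>"]] by (simp add: q_def B.smult_mult_right)
  qed
  have q_hom: "q \<in> module_hom K B B"
  proof -
    interpret p: mod_hom K B B p using B_module p by (simp add: mod_hom_def mod_hom_axioms_def)
    have add: "q (b \<oplus>\<^bsub>B\<^esub> c) = q b \<oplus>\<^bsub>B\<^esub> q c" if b: "b \<in> carrier B" and c: "c \<in> carrier B" for b c
    proof -
      have "(\<Oplus>\<^bsub>B\<^esub>g\<in>carrier G. \<delta> g \<otimes>\<^bsub>B\<^esub> p (\<delta> (inv\<^bsub>G\<^esub> g) \<otimes>\<^bsub>B\<^esub> (b \<oplus>\<^bsub>B\<^esub> c))) =
          (\<Oplus>\<^bsub>B\<^esub>g\<in>carrier G. \<delta> g \<otimes>\<^bsub>B\<^esub> p (\<delta> (inv\<^bsub>G\<^esub> g) \<otimes>\<^bsub>B\<^esub> b) \<oplus>\<^bsub>B\<^esub> \<delta> g \<otimes>\<^bsub>B\<^esub> p (\<delta> (inv\<^bsub>G\<^esub> g) \<otimes>\<^bsub>B\<^esub> c))"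
        using b c pB by (intro B.M.finsum_cong') (auto simp: B.r_distr)
      also have "\<dots> = (\<Oplus>\<^bsub>B\<^esub>g\<in>carrier G. \<delta> g \<otimes>\<^bsub>B\<^esub> p (\<delta> (inv\<^bsub>G\<^esub> g) \<otimes>\<^bsub>B\<^esub> b)) \<oplus>\<^bsub>B\<^esub>
          (\<Oplus>\<^bsub>B\<^esub>g\<in>carrier G. \<delta> g \<otimes>\<^bsub>B\<^esub> p (\<delta> (inv\<^bsub>G\<^esub> g) \<otimes>\<^bsub>B\<^esub> c))"
        using b c pB by (intro B.M.finsum_addf) auto
      finally show ?thesis
        using n_inverse(2) IB[OF s[OF b]] IB[OF s[OF c]] by (simp add: q_def B.smult_r_distr)
    qed
    have smult: "q (r \<odot>\<^bsub>B\<^esub> b) = r \<odot>\<^bsub>B\<^esub> q b" if r: "r \<in> carrier K" and b: "b \<in> carrier B" for r b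
    proof -
      have "(\<Oplus>\<^bsub>B\<^esub>g\<in>carrier G. \<delta> g \<otimes>\<^bsub>B\<^esub> p (\<delta> (inv\<^bsub>G\<^esub> g) \<otimes>\<^bsub>B\<^esub> (r \<odot>\<^bsub>B\<^esub> b))) =
          (\<Oplus>\<^bsub>B\<^esub>g\<in>carrier G. r \<odot>\<^bsub>B\<^esub> (\<delta> g \<otimes>\<^bsub>B\<^esub> p (\<delta> (inv\<^bsub>G\<^esub> g) \<otimes>\<^bsub>B\<^esub> b)))"
        using r b pB by (intro B.M.finsum_cong') (auto simp: B.smult_mult_right)
      also have "\<dots> = r \<odot>\<^bsub>B\<^esub> (\<Oplus>\<^bsub>B\<^esub>g\<in>carrier G. \<delta> g \<otimes>\<^bsub>B\<^esub> p (\<delta> (inv\<^bsub>G\<^esub> g) \<otimes>\<^bsub>B\<^esub> b))"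
        using r b pB by (intro B.finsum_smult[symmetric]) auto
      finally show ?thesis
        using n_inverse(2) IB[OF s[OF b]] r by (simp add: q_def K.m_comm flip: B.smult_assoc1)
    qed
    show ?thesis using IB qI add smult by (auto simp: module_hom_def)
  qed
  have "x \<otimes>\<^bsub>B\<^esub> q \<one>\<^bsub>B\<^esub> = x" if x: "x \<in> I" for x
  proof -
    note xB = IB[OF x] and c = B_apply_closed[OF IB[OF x]]
    have q1: "q \<one>\<^bsub>B\<^esub> \<in> carrier B" using IB qI by simp
    have "x \<otimes>\<^bsub>B\<^esub> q \<one>\<^bsub>B\<^esub> = (\<Oplus>\<^bsub>B\<^esub>g\<in>carrier G. x g \<odot>\<^bsub>B\<^esub> \<delta> g) \<otimes>\<^bsub>B\<^esub> q \<one>\<^bsub>B\<^esub>"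
      using delta_expansion[OF xB] by simp
    also have "\<dots> = (\<Oplus>\<^bsub>B\<^esub>g\<in>carrier G. (x g \<odot>\<^bsub>B\<^esub> \<delta> g) \<otimes>\<^bsub>B\<^esub> q \<one>\<^bsub>B\<^esub>)"
      using c q1 finite_G by (intro B.finsum_ldistr) auto
    also have "\<dots> = (\<Oplus>\<^bsub>B\<^esub>g\<in>carrier G. x g \<odot>\<^bsub>B\<^esub> q (\<delta> g))"
      using c q1 IB qI by (intro B.M.finsum_cong') (auto simp: B.smult_mult_left q_delta)
    also have "\<dots> = q (\<Oplus>\<^bsub>B\<^esub>g\<in>carrier G. x g \<odot>\<^bsub>B\<^esub> \<delta> g)"
      using c finite_G B_module by (intro B.module_hom_lincomb[OF q_hom, symmetric]) auto
    also have "\<dots> = x" using delta_expansion[OF xB] q_id[OF x] by simp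
    finally show ?thesis .
  qed
  then show ?thesis using that qI by blast
qed

lemma B_semisimple: "semisimple B"
  by (rule B.semisimple_of_right_units) (metis maschke)

lemma A_semisimple: "semisimple A"
proof (rule A.semisimple_of_right_units)
  fix I assume I: "left_ideal I A"
  note sub = A.left_ideal_submodule[OF I]
  have IZ: "x \<in> Z" if "x \<in> I" for x using A.left_ideal_subset[OF I] that by (auto simp: A_simps)
  have IB: "x \<in> carrier B" if "x \<in> I" for x using Z_closed IZ that by blast
  have mult: "z \<otimes>\<^bsub>B\<^esub> x \<in> I" if "z \<in> Z" "x \<in> I" for z x
    using I that by (simp add: left_ideal_def A_simps)
  have add: "x \<oplus>\<^bsub>B\<^esub> y \<in> I" if "x \<in> I" "y \<in> I" for x y
    using submodule.m_closed[OF sub that] by (simp add: A_simps)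
  have smult: "r \<odot>\<^bsub>B\<^esub> x \<in> I" if "r \<in> carrier K" "x \<in> I" for r x
    using submodule.smult_closed[OF sub that] by (simp add: A_simps)
  have zero: "\<zero>\<^bsub>B\<^esub> \<in> I" using submodule.zero_closed[OF sub] by (simp add: A_simps)
  \<comment> \<open>The largest left ideal of \<open>B\<close> that \<open>conj_sum\<close> maps into \<open>I\<close>. It contains \<open>I\<close>, since
    \<open>conj_sum (c x) = conj_sum c * x\<close> for central \<open>x\<close>.\<close>
  define L where "L = {b \<in> carrier B. \<forall>c\<in>carrier B. conj_sum (c \<otimes>\<^bsub>B\<^esub> b) \<in> I}"
  have L: "left_ideal L B"
    unfolding left_ideal_def
  proof (intro conjI ballI additive_subgroup.intro subgroup.intro)
    show "L \<subseteq> carrier (add_monoid B)" by (auto simp: L_def)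
    show "x \<otimes>\<^bsub>add_monoid B\<^esub> y \<in> L" if "x \<in> L" "y \<in> L" for x y
      using that add by (auto simp: L_def B.r_distr conj_sum_add)
    have "conj_sum \<zero>\<^bsub>B\<^esub> = \<zero>\<^bsub>B\<^esub>" using conj_sum_smult[of "\<zero>\<^bsub>K\<^esub>" "\<zero>\<^bsub>B\<^esub>"] conj_sum_closed by simp
    then show "\<one>\<^bsub>add_monoid B\<^esub> \<in> L" using zero by (simp add: L_def)
    show "inv\<^bsub>add_monoid B\<^esub> x \<in> L" if "x \<in> L" for x
    proof -
      have x: "x \<in> carrier B" using that by (simp add: L_def)
      have "conj_sum (c \<otimes>\<^bsub>B\<^esub> ((\<ominus>\<^bsub>K\<^esub> \<one>\<^bsub>K\<^esub>) \<odot>\<^bsub>B\<^esub> x)) \<in> I" if "c \<in> carrier B" for c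
        using that \<open>x \<in> L\<close> smult by (auto simp: L_def B.smult_mult_right conj_sum_smult)
      then have "(\<ominus>\<^bsub>K\<^esub> \<one>\<^bsub>K\<^esub>) \<odot>\<^bsub>B\<^esub> x \<in> L" using x by (simp add: L_def)
      moreover have "inv\<^bsub>add_monoid B\<^esub> x = \<ominus>\<^bsub>B\<^esub> x" by (simp add: a_inv_def)
      ultimately show ?thesis using x by (simp add: B.smult_minus_1)
    qed
    show "c \<otimes>\<^bsub>B\<^esub> x \<in> L" if "c \<in> carrier B" "x \<in> L" for c x
      using that by (auto simp: L_def simp flip: B.m_assoc)
  qed
  have IL: "x \<in> L" if x: "x \<in> I" for x
    using x IB[OF x] mult[OF conj_sum_central x] by (auto simp: L_def conj_sum_mult_central(1)[OF _ IZ[OF x]])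
  obtain e where e: "e \<in> L" and Le: "\<And>x. x \<in> L \<Longrightarrow> x \<otimes>\<^bsub>B\<^esub> e = x"
    by (rule maschke[OF L]) (rule that)
  have eB: "e \<in> carrier B" using e by (simp add: L_def)
  show "\<exists>e\<in>I. \<forall>x\<in>I. x \<otimes>\<^bsub>A\<^esub> e = x"
  proof (intro bexI[of _ "inv_n \<odot>\<^bsub>B\<^esub> conj_sum e"] ballI)
    have "conj_sum (\<one>\<^bsub>B\<^esub> \<otimes>\<^bsub>B\<^esub> e) \<in> I" using e B.one_closed unfolding L_def by blast
    then show "inv_n \<odot>\<^bsub>B\<^esub> conj_sum e \<in> I" using eB smult n_inverse(2) by simp
    fix x assume x: "x \<in> I"
    have "x \<otimes>\<^bsub>B\<^esub> (inv_n \<odot>\<^bsub>B\<^esub> conj_sum e) = inv_n \<odot>\<^bsub>B\<^esub> conj_sum (x \<otimes>\<^bsub>B\<^esub> e)"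
      using IB[OF x] eB conj_sum_closed n_inverse(2)
      by (simp add: B.smult_mult_right conj_sum_mult_central(2)[OF eB IZ[OF x]])
    also have "\<dots> = x"
      using Le[OF IL[OF x]] IB[OF x] by (simp add: conj_sum_of_central[OF IZ[OF x]] inv_n_smult_n)
    finally show "x \<otimes>\<^bsub>A\<^esub> (inv_n \<odot>\<^bsub>B\<^esub> conj_sum e) = x" by (simp add: A_simps)
  qed
qed

section \<open>The equipped Cardy--Frobenius algebra\<close>

lemma group_algebra_equipped_cardy_frobenius:
  "semisimple_equipped_cardy_frobenius_algebra K A lA B lB \<phi> U starA star"
proof (intro semisimple_equipped_cardy_frobenius_algebra.intro
    semisimple_equipped_cardy_frobenius_algebra_axioms.intro
    equipped_cardy_frobenius_algebra.intro equipped_cardy_frobenius_algebra_axioms.intro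
    cardy_frobenius_algebra.intro cardy_frobenius_algebra_axioms.intro
    A.frobenius_pair_axioms B.frobenius_pair_axioms A_semisimple B_semisimple cardy)
  show "x \<otimes>\<^bsub>A\<^esub> y = y \<otimes>\<^bsub>A\<^esub> x" if "x \<in> carrier A" "y \<in> carrier A" for x y
    using that Z_commute Z_closed by (simp add: A_simps)
  have AB: "x \<in> carrier B" if "x \<in> carrier A" for x using that Z_closed by (simp add: A_simps)
  show "\<phi> \<in> ring_hom A B"
    using AB A.m_closed A.M.a_closed A.one_closed by (intro ring_hom_memI) (auto simp: A_simps)
  show "\<phi> \<in> module_hom K A B"
    using AB A.smult_closed A.M.a_closed by (auto simp: module_hom_def A_simps)
  show "\<phi> ` carrier A \<subseteq> ring_center B" by (auto simp: A_simps)
  show "involutive_anti_automorphism K A starA"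
    using starA_hom AB A.m_closed A.one_closed star_central
    by (auto simp: involutive_anti_automorphism_def A_simps star_one star_mult star_star)
  show "involutive_anti_automorphism K B star"
    by (simp add: involutive_anti_automorphism_def star_hom star_one star_mult star_star)
  show "lA (starA x) = lA x" if "x \<in> carrier A" for x
    using that AB by (simp add: star_apply)
  show "lB (star y) = lB y" if "y \<in> carrier B" for y
    using that by (simp add: star_apply)
  show "\<phi> (starA x) = star (\<phi> x)" if "x \<in> carrier A" for x
    using that star_central by (simp add: A_simps)
  show UA: "U \<in> carrier A" using U_central by (simp add: A_simps)
  show "U [^]\<^bsub>A\<^esub> (2::nat) = A.K_star starA"
    unfolding K_star_A using UA U_closed by (simp add: numeral_2_eq_2 A_simps)
  show "\<phi> U = B.K_star star" using UA K_star_B by simp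
qed

end

theorem theorem4:
  fixes G :: "('g, 'z) monoid_scheme" and K :: "('k, 'x) ring_scheme"
  assumes "group G" and "finite (carrier G)"
    and "field K" and "\<not> characteristic K dvd order G"
  shows "let B = group_algebra K G;
             lB = (\<lambda>f. f \<one>\<^bsub>G\<^esub>);
             A = center_algebra B;
             lA = (\<lambda>f. f \<one>\<^bsub>G\<^esub> \<otimes>\<^bsub>K\<^esub> inv\<^bsub>K\<^esub> ([order G] \<cdot>\<^bsub>K\<^esub> \<one>\<^bsub>K\<^esub>));
             \<phi> = (\<lambda>f\<in>carrier A. f);
             U = sum_of_squares K G;
             starB = group_star K G;
             starA = restrict starB (carrier A)
         in semisimple_equipped_cardy_frobenius_algebra K A lA B lB \<phi> U starA starB"
proof -
  interpret K: field K by fact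
  interpret finite_group_algebra G K
    using assms by (intro finite_group_algebra.intro finite_group_algebra_axioms.intro)
  interpret semisimple_group_algebra G K
    using K.characteristic_dvd assms(4) by unfold_locales auto
  show ?thesis
    unfolding Let_def by (rule group_algebra_equipped_cardy_frobenius)
qed

end
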